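(* Fix $d \ge 2$. (a) For any two $(d-1)$-polytopes $C_1, C_2$ combinatorially equivalent to the $(d-1)$-cube, there exists a $d$-tower $C \subset \mathbb{R}^d$ of $m$ cubes with $m \le 4d$ such that $C_1$ is projectively equivalent to the bottom facet of $C$ and $C_2$ is projectively equivalent to the top facet of $C$. (b) For any two cubical $d$-polytopes $P_1, P_2 \subset \mathbb{R}^d$ and facets $F_1$ of $P_1$ and $F_2$ of $P_2$, there exist a projective transformation $\phi$ and a $d$-tower $T$ of at most $4d$ cubes such that $P := P_1 \cup T \cup \phi(P_2)$ is convex, and $P_1 \cap T = F_1$ and $\phi(P_2) \cap T = \phi(F_2)$ are the top and bottom facets of $T$, respectively.
   Context: A $d$-polytope is cubical if each of its proper faces is combinatorially equivalent to a cube. A projective transformation is a map $\varphi(x) = \frac{Ax+b}{c^Tx+\alpha}$ with $\det\begin{pmatrix} A & b\\ c^T & \alpha\end{pmatrix} \ne 0$; two polytopes are projectively equivalent if one is the image of the other under a projective transformation whose denominator does not vanish on it (a facet of a $d$-polytope lying in an affine hyperplane is compared with a polytope in $\mathbb{R}^{d-1}$ after an affine identification of the hyperplane with $\mathbb{R}^{d-1}$). A $d$-tower of $1$ cube is a combinatorial $d$-cube with two chosen opposite facets, called bottom and top. For $s>1$, a $d$-tower of $s$ cubes is a convex polytope $T \cup K$, where $T$ is a $d$-tower of $s-1$ cubes with bottom facet $F$ and top facet $F'$, and $K$ is a combinatorial $d$-cube with $T \cap K = F'$ a facet of both; its bottom facet is $F$ and its top facet is the facet of $K$ opposite to $F'$.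 Such a tower is a cubical $d$-polytope. *)

theory Defs
  imports "HOL-Analysis.Analysis"
begin

text \<open>
  The face lattice of \<open>P\<close> is \<open>{F. F face_of P}\<close>; it contains \<open>{}\<close> and \<open>P\<close> itself.
\<close>

definition face_lattice_iso ::
    "('a::euclidean_space set \<Rightarrow> 'b::euclidean_space set) \<Rightarrow> 'a set \<Rightarrow> 'b set \<Rightarrow> bool" where
  "face_lattice_iso f P Q \<longleftrightarrow>
     bij_betw f {F. F face_of P} {G. G face_of Q} \<and>
     (\<forall>F G. F face_of P \<longrightarrow> G face_of P \<longrightarrow> (f F \<subseteq> f G \<longleftrightarrow> F \<subseteq> G))"

definition combinatorially_equivalent ::
    "'a::euclidean_space set \<Rightarrow> 'b::euclidean_space set \<Rightarrow> bool" where
  "combinatorially_equivalent P Q \<longleftrightarrow> (\<exists>f. face_lattice_iso f P Q)"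

text \<open>
  For \<open>B \<subseteq> Basis\<close> this is the unit cube spanned by the coordinate directions in \<open>B\<close>,
  a cube of dimension \<open>card B\<close>.
\<close>

definition std_cube :: "'a::euclidean_space set \<Rightarrow> 'a set" where
  "std_cube B = cbox 0 (\<Sum>B)"

definition combinatorial_cube :: "nat \<Rightarrow> 'a::euclidean_space set \<Rightarrow> bool" where
  "combinatorial_cube k P \<longleftrightarrow>
     polytope P \<and> aff_dim P = int k \<and>
     (\<exists>B\<subseteq>Basis. card B = k \<and> combinatorially_equivalent P (std_cube B :: 'a set))"

text \<open>The empty face is not a cube and is not counted among the proper faces.\<close>

definition cubical_polytope :: "nat \<Rightarrow> 'a::euclidean_space set \<Rightarrow> bool" where
  "cubical_polytope d P \<longleftrightarrow>
     polytope P \<and> aff_dim P = int d \<and>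
     (\<forall>F. F face_of P \<and> F \<noteq> {} \<and> F \<noteq> P \<longrightarrow> (\<exists>k. combinatorial_cube k F))"

text \<open>
  Opposite facets of a combinatorial cube are those that correspond to a pair
  \<open>x \<bullet> b = 0\<close>, \<open>x \<bullet> b = 1\<close> under an isomorphism with the face lattice of the standard cube.
\<close>

definition opposite_facets ::
    "'a::euclidean_space set \<Rightarrow> 'a set \<Rightarrow> 'a set \<Rightarrow> bool" where
  "opposite_facets K F F' \<longleftrightarrow>
     F facet_of K \<and> F' facet_of K \<and>
     (\<exists>f B b. B \<subseteq> Basis \<and> b \<in> B \<and> face_lattice_iso f K (std_cube B :: 'a set) \<and>
        f F = {x \<in> std_cube B. x \<bullet> b = 0} \<and>
        f F' = {x \<in> std_cube B. x \<bullet> b = 1})"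

text \<open>\<open>tower s T F F'\<close>: \<open>T\<close> is a tower of \<open>s\<close> cubes with bottom facet \<open>F\<close> and top facet \<open>F'\<close>.\<close>

inductive tower ::
    "nat \<Rightarrow> 'a::euclidean_space set \<Rightarrow> 'a set \<Rightarrow> 'a set \<Rightarrow> bool" where
  tower_one:
    "\<lbrakk>combinatorial_cube DIM('a) (K :: 'a set); opposite_facets K F F'\<rbrakk>
     \<Longrightarrow> tower 1 K F F'"
| tower_step:
    "\<lbrakk>tower s T F F'; combinatorial_cube DIM('a) (K :: 'a set);
      T \<inter> K = F'; F' facet_of T; F' facet_of K;
      polytope (T \<union> K); opposite_facets K F' G\<rbrakk>
     \<Longrightarrow> tower (Suc s) (T \<union> K) F G"

text \<open>The block matrix with rows \<open>(A, b)\<close> and \<open>(c\<^sup>T, \<alpha>)\<close>; \<open>None\<close> is the additional index.\<close>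

definition block_matrix ::
    "real^'n^'n \<Rightarrow> real^'n \<Rightarrow> real^'n \<Rightarrow> real \<Rightarrow> real^('n option)^('n option)" where
  "block_matrix A b c \<alpha> =
     (\<chi> i j. case i of
        Some k \<Rightarrow> (case j of Some l \<Rightarrow> A $ k $ l | None \<Rightarrow> b $ k)
      | None \<Rightarrow> (case j of Some l \<Rightarrow> c $ l | None \<Rightarrow> \<alpha>))"

text \<open>
  \<open>\<phi>\<close> is a projective transformation whose denominator does not vanish on \<open>S\<close>. Where the
  denominator vanishes, \<open>\<phi>\<close> has the meaningless value \<open>0\<close>.
\<close>

definition projective_transformation_on ::
    "(real^'n) set \<Rightarrow> (real^'n \<Rightarrow> real^'n) \<Rightarrow> bool" where
  "projective_transformation_on S \<phi> \<longleftrightarrow>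
     (\<exists>A b c \<alpha>. det (block_matrix A b c \<alpha>) \<noteq> 0 \<and>
        \<phi> = (\<lambda>x. (1 / (c \<bullet> x + \<alpha>)) *\<^sub>R (A *v x + b)) \<and>
        (\<forall>x\<in>S. c \<bullet> x + \<alpha> \<noteq> 0))"

definition projectively_equivalent :: "(real^'n) set \<Rightarrow> (real^'n) set \<Rightarrow> bool" where
  "projectively_equivalent P Q \<longleftrightarrow> (\<exists>\<phi>. projective_transformation_on P \<phi> \<and> \<phi> ` P = Q)"

text \<open>
  \<open>C\<close> is compared with the facet \<open>F\<close> of a polytope in the next higher dimension through an affine
  identification \<open>h\<close> of the hyperplane \<open>affine hull F\<close> with the space containing \<open>C\<close>. Since affine
  bijections are projective transformations, the choice of \<open>h\<close> is immaterial.
\<close>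

definition projectively_equivalent_to_facet :: "(real^'m) set \<Rightarrow> (real^'n) set \<Rightarrow> bool" where
  "projectively_equivalent_to_facet C F \<longleftrightarrow>
     (\<exists>h L v. linear L \<and> h = (\<lambda>x. L x + v) \<and>
        bij_betw h (affine hull F) (UNIV :: (real^'m) set) \<and>
        projectively_equivalent C (h ` F))"

end

theory Submission
  imports Defs
begin

text \<open>
  In homogeneous coordinates a projective transformation is a linear bijection, and a combinatorial
  \<open>n\<close>-cube is a cone \<open>C = {z. g\<^sub>i\<^sub>s(z) \<ge> 0}\<close> in dimension \<open>n + 1\<close> cut out by \<open>n\<close> pairs of functionals such
  that the two members of a pair never vanish together on \<open>C - {0}\<close>.

  Two ideas give the theorem. First, for an index \<open>k\<close> put \<open>t = g\<^sub>k\<^sub>0\<close> and \<open>u = g\<^sub>k\<^sub>0 + g\<^sub>k\<^sub>1\<close>. The cone of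
  all \<open>(w, r)\<close> with \<open>g\<^sub>i\<^sub>s(w) \<ge> 0\<close> for \<open>i \<noteq> k\<close>, \<open>0 \<le> t(w) + r \<le> u(w)\<close>, \<open>r \<ge> 0\<close> and \<open>t(w) + \<epsilon> u(w) \<ge> 0\<close> is, for
  small \<open>\<epsilon> > 0\<close>, a cube one dimension higher. Its facet \<open>r = 0\<close> is \<open>C\<close>, and the opposite facet is projectively
  a prism in direction \<open>k\<close>. Doing this once for every \<open>k\<close> turns \<open>C\<close> into a standard cube,
  so any two \<open>(d - 1)\<close>-cubes are joined by a chain of \<open>2(d - 1)\<close> cubes.

  Second, two polytopes with projectively equivalent facets can be glued along that facet with convex
  union: a projective map that fixes the facet and pulls the rest of one polytope far enough towards
  an interior point of the facet does it.
\<close>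

subsection \<open>Cones of combinatorial cubes\<close>

text \<open>A cube system asks only that opposite constraints never vanish together, since this one
  condition already forces the face lattice of a cube: sliding along edges realises every choice of
  one constraint per pair as a vertex. So each new cube is verified pair by pair, without general
  position and without a list of vertices.

  The number \<open>\<epsilon>\<close> has to meet two opposing demands. For
  \<open>\<epsilon> = 0\<close> the facet \<open>t = 0\<close> would meet the facet
  \<open>r = 0\<close>, so the ends of the new cube would not be opposite. A positive
  \<open>\<epsilon>\<close> lets \<open>w\<close> leave the old cone, where other pairs might vanish
  together. Compactness bounds the pair sums \<open>g i False + g i True\<close> from below on the
  old cone, and this leaves room for a small positive value.

  On the far facet the functionals outside pair \<open>k\<close> are corrected by multiples of
  \<open>t + \<epsilon> u\<close> so that they vanish on one vector \<open>v\<close>; pair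
  \<open>k\<close> is unchanged. Later corrections vanish on the earlier vectors, so prism
  directions accumulate until every index has one, and then the cone is a linear image of the cone
  over a unit cube.

  Part (a) starts with two cubes and no polytopes to glue to; pyramids over the cubes supply
  them.\<close>

definition hcone :: "'i set \<Rightarrow> ('i \<Rightarrow> bool \<Rightarrow> 'w::euclidean_space) \<Rightarrow> 'w set" where
  "hcone I g = {z. \<forall>i\<in>I. \<forall>s. 0 \<le> g i s \<bullet> z}"

text \<open>Such a cone has dimension \<open>card I + 1\<close>, one more than the cube it spans.
  The nonzero vector excludes the cone \<open>{0}\<close>, for which the condition on pairs would
  hold vacuously.\<close>

definition cube_system :: "'i set \<Rightarrow> ('i \<Rightarrow> bool \<Rightarrow> 'w::euclidean_space) \<Rightarrow> bool" where
  "cube_system I g \<longleftrightarrow> finite I \<and> I \<noteq> {} \<and> card I + 1 = DIM('w) \<and>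
     (\<exists>z\<in>hcone I g. z \<noteq> 0) \<and>
     (\<forall>i\<in>I. \<forall>z\<in>hcone I g. g i False \<bullet> z = 0 \<longrightarrow> g i True \<bullet> z = 0 \<longrightarrow> z = 0)"

lemma hconeD: "z \<in> hcone I g \<Longrightarrow> i \<in> I \<Longrightarrow> 0 \<le> g i s \<bullet> z"
  by (simp add: hcone_def)

lemma hcone_scaleR: "z \<in> hcone I g \<Longrightarrow> 0 \<le> c \<Longrightarrow> c *\<^sub>R z \<in> hcone I g"
  by (simp add: hcone_def)

lemma cube_system_opposite:
  assumes "cube_system I g" "i \<in> I" "z \<in> hcone I g" "g i s \<bullet> z = 0" "g i (\<not> s) \<bullet> z = 0"
  shows "z = 0"
  using assms by (cases s) (auto simp: cube_system_def)

lemma cube_system_pair_pos: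
  assumes "cube_system I g" "i \<in> I" "z \<in> hcone I g" "z \<noteq> 0"
  shows "0 < (g i False + g i True) \<bullet> z"
proof -
  have "0 \<le> g i False \<bullet> z" "0 \<le> g i True \<bullet> z"
    using assms by (auto simp: hcone_def)
  then show ?thesis
    using cube_system_opposite[OF assms(1,2,3), of False] assms(4)
    by (auto simp: inner_add_left) (smt (verit))
qed

lemma cube_system_opposite_pos:
  assumes "cube_system I g" "i \<in> I" "z \<in> hcone I g" "z \<noteq> 0" "g i s \<bullet> z = 0"
  shows "0 < g i (\<not> s) \<bullet> z"
  using hconeD[OF assms(3,2), of "\<not> s"] cube_system_opposite[OF assms(1-3,5)] assms(4) by force

text \<open>The minimum ratio rule of the simplex method: among the constraints that decrease along
  \<open>v\<close>, the one that reaches zero first determines \<open>t\<close>.\<close>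

lemma hcone_exit:
  assumes "finite I" "z \<in> hcone I g" "v \<notin> hcone I g"
  obtains t i s where "0 \<le> t" "i \<in> I" "g i s \<bullet> v < 0"
    "z + t *\<^sub>R v \<in> hcone I g" "g i s \<bullet> (z + t *\<^sub>R v) = 0"
proof -
  define A where "A = {(i, s). i \<in> I \<and> g i s \<bullet> v < 0}"
  define r where "r = (\<lambda>(i, s). (g i s \<bullet> z) / (- (g i s \<bullet> v)))"
  have "A \<subseteq> I \<times> UNIV" by (auto simp: A_def)
  then have fin: "finite A" by (rule finite_subset) (simp add: assms(1))
  have ne: "A \<noteq> {}" using assms(3) by (auto simp: A_def hcone_def not_le)
  obtain i s where mi: "(i, s) \<in> A" "r (i, s) = Min (r ` A)"
    using Min_in[of "r ` A"] fin ne by (metis (no_types, lifting) finite_imageI image_iff image_is_empty surj_pair)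
  define t where "t = r (i, s)"
  have min: "t \<le> r c" if "c \<in> A" for c
    using that fin mi by (simp add: t_def)
  have neg: "i \<in> I" "g i s \<bullet> v < 0" using mi by (auto simp: A_def)
  have t0: "0 \<le> t" using neg assms(2) by (auto simp: t_def r_def hcone_def intro!: divide_nonneg_neg)
  have "g i s \<bullet> (z + t *\<^sub>R v) = 0"
    using neg by (simp add: t_def r_def inner_add_right inner_diff_right)
  moreover have "0 \<le> g j q \<bullet> (z + t *\<^sub>R v)" if j: "j \<in> I" for j q
  proof (cases "g j q \<bullet> v < 0")
    case True
    then have "t \<le> (g j q \<bullet> z) / (- (g j q \<bullet> v))"
      using min[of "(j, q)"] j by (simp add: A_def r_def)
    then have "t * (- (g j q \<bullet> v)) \<le> g j q \<bullet> z"
      using True by (subst (asm) pos_le_divide_eq) auto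
    then show ?thesis by (simp add: inner_add_right)
  next
    case False
    then show ?thesis using t0 hconeD[OF assms(2) j, of q] by (simp add: inner_add_right)
  qed
  ultimately show ?thesis using that[OF t0 neg] by (auto simp: hcone_def)
qed

text \<open>
  The point slides along a common zero direction of the tight constraints until a new constraint becomes
  tight; \<open>a\<close> names one constraint that this new one is required to differ from.
\<close>

lemma cube_system_slide:
  fixes g :: "'i \<Rightarrow> bool \<Rightarrow> 'w::euclidean_space"
  assumes cs: "cube_system I g" and z: "z \<in> hcone I g" "z \<noteq> 0" and J: "J \<subset> I"
    and tight: "\<And>j. j \<in> J \<Longrightarrow> g j (\<sigma> j) \<bullet> z = 0"
  obtains z' i s where "z' \<in> hcone I g" "z' \<noteq> 0" "\<forall>j\<in>J. g j (\<sigma> j) \<bullet> z' = 0"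
    "i \<in> I - J" "g i s \<bullet> z' = 0" "g i s \<noteq> a"
proof -
  have fin: "finite I" and cI: "card I + 1 = DIM('w)" using cs by (auto simp: cube_system_def)
  obtain k where k: "k \<in> I" using cs by (auto simp: cube_system_def)
  define u where "u = g k False + g k True"
  \<comment> \<open>Besides the tight constraints, \<open>v\<close> must annihilate a pair sum
    \<open>u\<close>. As \<open>u\<close> is positive on the cone without the origin,
    \<open>v\<close> cannot lie in the cone, so the ray leaves it; and as \<open>u\<close> is
    constant along the ray, the exit point is not 0.\<close>
  let ?X = "insert u ((\<lambda>j. g j (\<sigma> j)) ` J)"
  have finJ: "finite J" using fin J finite_subset by blast
  have "dim ?X \<le> card ?X" using finJ by (intro dim_le_card') auto
  also have "\<dots> \<le> Suc (card J)" using finJ card_image_le[OF finJ, of "\<lambda>j. g j (\<sigma> j)"]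
    by (simp add: card_insert_if)
  also have "\<dots> < DIM('w)" using cI psubset_card_mono[OF fin J] by simp
  finally obtain v0 where v0: "v0 \<noteq> 0" "\<And>y. y \<in> span ?X \<Longrightarrow> orthogonal v0 y"
    using orthogonal_to_subspace_exists by blast
  \<comment> \<open>The sign makes \<open>a\<close> nondecreasing along \<open>v\<close>, whereas
    the constraint that is hit decreases strictly; so the two differ.\<close>
  define v where "v = (if 0 \<le> a \<bullet> v0 then v0 else - v0)"
  have v: "v \<noteq> 0" "0 \<le> a \<bullet> v" "\<And>y. y \<in> ?X \<Longrightarrow> y \<bullet> v = 0"
    using v0 span_base[of _ ?X] by (auto simp: v_def orthogonal_def inner_commute)
  have uv: "u \<bullet> v = 0" using v(3) by blast
  have "v \<notin> hcone I g"
    using cube_system_pair_pos[OF cs k _ v(1)] uv by (auto simp: u_def)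
  from hcone_exit[OF fin z(1) this] obtain t i s where e: "0 \<le> t" "i \<in> I" "g i s \<bullet> v < 0"
    "z + t *\<^sub>R v \<in> hcone I g" "g i s \<bullet> (z + t *\<^sub>R v) = 0" .
  have "0 < u \<bullet> (z + t *\<^sub>R v)"
    using cube_system_pair_pos[OF cs k z] uv by (simp add: u_def inner_add_right)
  then have nz: "z + t *\<^sub>R v \<noteq> 0" by (metis inner_zero_right less_irrefl)
  have tj: "g j (\<sigma> j) \<bullet> (z + t *\<^sub>R v) = 0" if "j \<in> J" for j
    using tight[OF that] v(3) that by (simp add: inner_add_right)
  \<comment> \<open>For an index in \<open>J\<close> the chosen constraint stays 0 along
    \<open>v\<close>, so only its opposite could be hit; a pair vanishing together would make the
    point 0.\<close>
  have "i \<notin> J"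
  proof
    assume i: "i \<in> J"
    then have "g i (\<sigma> i) \<bullet> v = 0" using v(3) by blast
    then have "s = (\<not> \<sigma> i)" using e(3) by (cases s; cases "\<sigma> i") auto
    then show False using cube_system_opposite[OF cs e(2,4) tj[OF i]] e(5) nz by simp
  qed
  moreover have "g i s \<noteq> a" using v(2) e(3) by auto
  ultimately show ?thesis using that[OF e(4) nz] tj e(2,5) by blast
qed

text \<open>Sliding enlarges the set of tight indices until some vertex is reached. From there one
  choice at a time is corrected by moving along an edge: all indices but \<open>a\<close> stay
  tight, the old constraint at \<open>a\<close> is excluded, and so the slide stops at its
  opposite.\<close>

lemma cube_system_vertex:
  assumes cs: "cube_system I g"
  obtains z where "z \<in> hcone I g" "z \<noteq> 0" "\<And>i. i \<in> I \<Longrightarrow> g i (\<tau> i) \<bullet> z = 0"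
proof -
  have fin: "finite I" using cs by (auto simp: cube_system_def)
  define V where "V = (\<lambda>J \<sigma>. \<exists>z\<in>hcone I g. z \<noteq> 0 \<and> (\<forall>j\<in>J. g j (\<sigma> j) \<bullet> z = 0))"
  have "\<exists>J\<subseteq>I. card J = n \<and> (\<exists>\<sigma>. V J \<sigma>)" if "n \<le> card I" for n
    using that
  proof (induction n)
    case 0
    then show ?case using cs by (intro exI[of _ "{}"]) (auto simp: V_def cube_system_def)
  next
    case (Suc n)
    then obtain J \<sigma> z where J: "J \<subseteq> I" "card J = n" "z \<in> hcone I g" "z \<noteq> 0"
      "\<And>j. j \<in> J \<Longrightarrow> g j (\<sigma> j) \<bullet> z = 0" unfolding V_def by (meson Suc_leD)
    have "J \<subset> I" using J Suc.prems by auto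
    from cube_system_slide[OF cs J(3,4) this J(5), where a=0] obtain z' i s where
      z': "z' \<in> hcone I g" "z' \<noteq> 0" "\<forall>j\<in>J. g j (\<sigma> j) \<bullet> z' = 0"
        "i \<in> I - J" "g i s \<bullet> z' = 0" "g i s \<noteq> 0" .
    have "finite J" using fin J(1) finite_subset by blast
    then have "insert i J \<subseteq> I" "card (insert i J) = Suc n" using z' J by auto
    moreover have "V (insert i J) (\<sigma>(i := s))" using z' by (auto simp: V_def intro!: bexI[of _ z'])
    ultimately show ?case by blast
  qed
  from this[of "card I"] obtain \<sigma>0 where s0: "V I \<sigma>0" using card_subset_eq[OF fin] by auto
  have "A \<subseteq> I \<Longrightarrow> \<exists>\<sigma>. V I \<sigma> \<and> (\<forall>i\<in>A. \<sigma> i = \<tau> i)" if "finite A" for A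
    using that
  proof (induction A)
    case empty
    then show ?case using s0 by auto
  next
    case (insert a A)
    then obtain \<sigma> z where s: "V I \<sigma>" "\<forall>i\<in>A. \<sigma> i = \<tau> i" and z: "z \<in> hcone I g" "z \<noteq> 0"
      "\<forall>j\<in>I. g j (\<sigma> j) \<bullet> z = 0" by (auto simp: V_def)
    have aI: "a \<in> I" using insert by auto
    show ?case
    proof (cases "\<sigma> a = \<tau> a")
      case True
      then show ?thesis using s by auto
    next
      case False
      have "I - {a} \<subset> I" using aI by auto
      have tz: "g j (\<sigma> j) \<bullet> z = 0" if "j \<in> I - {a}" for j using that z(3) by blast
      from cube_system_slide[OF cs z(1,2) \<open>I - {a} \<subset> I\<close> tz, where a="g a (\<sigma> a)"] obtain z' i r where
        z': "z' \<in> hcone I g" "z' \<noteq> 0" "\<forall>j\<in>I - {a}. g j (\<sigma> j) \<bullet> z' = 0"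
        "i \<in> I - (I - {a})" "g i r \<bullet> z' = 0" "g i r \<noteq> g a (\<sigma> a)" .
      then have ia: "i = a" by auto
      then have "r = \<tau> a" using z'(6) False by (cases r; cases "\<sigma> a"; cases "\<tau> a") auto
      then have "V I (\<sigma>(a := \<tau> a))" using z' ia by (auto simp: V_def intro!: bexI[of _ z'])
      moreover have "\<forall>i\<in>insert a A. (\<sigma>(a := \<tau> a)) i = \<tau> i" using s(2) by simp
      ultimately show ?thesis by blast
    qed
  qed
  from this[OF fin] obtain \<sigma> where "V I \<sigma>" "\<forall>i\<in>I. \<sigma> i = \<tau> i" by auto
  then show ?thesis using that by (auto simp: V_def)
qed

text \<open>At the vertex where all \<open>False\<close> constraints vanish every
  \<open>True\<close> constraint is positive, and conversely at the antipodal vertex; the sum of the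
  two vertices is therefore positive on all constraints.\<close>

lemma cube_system_interior_point:
  assumes cs: "cube_system I g"
  obtains z where "\<And>i s. i \<in> I \<Longrightarrow> 0 < g i s \<bullet> z"
proof -
  obtain a where a: "a \<in> hcone I g" "a \<noteq> 0" "\<And>i. i \<in> I \<Longrightarrow> g i False \<bullet> a = 0"
    using cube_system_vertex[OF cs, of "\<lambda>_. False"] by metis
  obtain b where b: "b \<in> hcone I g" "b \<noteq> 0" "\<And>i. i \<in> I \<Longrightarrow> g i True \<bullet> b = 0"
    using cube_system_vertex[OF cs, of "\<lambda>_. True"] by metis
  have "0 < g i s \<bullet> (a + b)" if i: "i \<in> I" for i s
    using cube_system_opposite_pos[OF cs i a(1,2) a(3)[OF i]] cube_system_opposite_pos[OF cs i b(1,2) b(3)[OF i]]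
      hconeD[OF a(1) i, of s] hconeD[OF b(1) i, of s]
    by (cases s) (auto simp: inner_add_right a(3)[OF i] b(3)[OF i])
  then show ?thesis by (rule that)
qed

lemma closed_hcone: "closed (hcone I g)"
proof -
  have "hcone I g = (\<Inter>i\<in>I. \<Inter>s. {z. 0 \<le> g i s \<bullet> z})" by (auto simp: hcone_def)
  then show ?thesis by (auto intro!: closed_INT closed_Collect_le continuous_intros)
qed

text \<open>By homogeneity it suffices to minimise \<open>a\<close> on the compact section of the
  cone by the unit sphere.\<close>

lemma linear_bound_on_cone:
  fixes a :: "'w::euclidean_space"
  assumes "closed C" "\<And>z c. z \<in> C \<Longrightarrow> 0 \<le> c \<Longrightarrow> c *\<^sub>R z \<in> C"
    and pos: "\<And>z. z \<in> C \<Longrightarrow> z \<noteq> 0 \<Longrightarrow> 0 < a \<bullet> z"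
  obtains \<delta> where "0 < \<delta>" "\<And>z. z \<in> C \<Longrightarrow> \<delta> * norm z \<le> a \<bullet> z"
proof (cases "C \<inter> sphere 0 1 = {}")
  case True
  have "z = 0" if "z \<in> C" for z
  proof (rule ccontr)
    assume "z \<noteq> 0"
    then have "(1 / norm z) *\<^sub>R z \<in> C \<inter> sphere 0 1" using assms(2)[OF that, of "1 / norm z"] by simp
    then show False using True by blast
  qed
  then show ?thesis using that[of 1] by fastforce
next
  case False
  have "compact (C \<inter> sphere 0 1)" using assms(1) by (simp add: closed_Int_compact)
  then obtain x where x: "x \<in> C \<inter> sphere 0 1" "\<And>y. y \<in> C \<inter> sphere 0 1 \<Longrightarrow> a \<bullet> x \<le> a \<bullet> y"
    using continuous_attains_inf[of "C \<inter> sphere 0 1" "\<lambda>y. a \<bullet> y"] False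
      continuous_on_inner[OF continuous_on_const continuous_on_id] by metis
  have "a \<bullet> x * norm z \<le> a \<bullet> z" if z: "z \<in> C" for z
  proof (cases "z = 0")
    case False
    then have "(1 / norm z) *\<^sub>R z \<in> C \<inter> sphere 0 1" using assms(2)[OF z, of "1 / norm z"] by simp
    from x(2)[OF this] have "a \<bullet> x \<le> (a \<bullet> z) / norm z" by simp
    then show ?thesis using False by (simp add: field_simps)
  qed simp
  moreover have "0 < a \<bullet> x" using x(1) pos[of x] by force
  ultimately show ?thesis using that by blast
qed

lemma interior_hcone:
  assumes "cube_system I g"
  shows "interior (hcone I g - {0}) \<noteq> {}"
proof -
  have fin: "finite I" "I \<noteq> {}" using assms by (auto simp: cube_system_def)
  let ?U = "\<Inter>i\<in>I. \<Inter>s. {z. 0 < g i s \<bullet> z}"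
  have "open ?U" using fin by (intro open_INT ballI open_Collect_less continuous_intros) auto
  moreover have "?U \<subseteq> hcone I g - {0}" using fin by (force simp: hcone_def intro: less_imp_le)
  moreover obtain z where "\<And>i s. i \<in> I \<Longrightarrow> 0 < g i s \<bullet> z" using cube_system_interior_point[OF assms] by metis
  ultimately have "z \<in> interior (hcone I g - {0})" by (intro interiorI[of ?U]) auto
  then show ?thesis by blast
qed

subsection \<open>Cubes joining two cones\<close>

text \<open>
  \<open>cube_link S S'\<close>: up to linear isomorphism, the cones \<open>S\<close> and \<open>S'\<close> (without the origin) are opposite
  facets of the cone over one cube of the next higher dimension.
\<close>

inductive cube_link :: "'a::euclidean_space set \<Rightarrow> 'a set \<Rightarrow> bool" where
  cube_linkI: "\<lbrakk>cube_system Basis (G :: 'a \<Rightarrow> bool \<Rightarrow> 'a \<times> real); j \<in> Basis;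
    linear \<Lambda>; inj \<Lambda>; linear \<Lambda>'; inj \<Lambda>';
    \<And>z. G j s \<bullet> \<Lambda> z = 0; \<And>z. G j (\<not> s) \<bullet> \<Lambda>' z = 0;
    \<Lambda> ` S = {y \<in> hcone Basis G - {0}. G j s \<bullet> y = 0};
    \<Lambda>' ` S' = {y \<in> hcone Basis G - {0}. G j (\<not> s) \<bullet> y = 0};
    interior S \<noteq> {}; interior S' \<noteq> {}\<rbrakk>
    \<Longrightarrow> cube_link S S'"

text \<open>The Boolean \<open>s\<close> leaves open which member of the pair carries the first
  cone, so exchanging the ends only negates it.\<close>

lemma cube_link_sym:
  assumes "cube_link S S'"
  shows "cube_link S' S"
  using assms
proof cases
  case (cube_linkI G j \<Lambda> \<Lambda>' s)
  then show ?thesis by (intro cube_link.cube_linkI[of G j \<Lambda>' \<Lambda> "\<not> s"]) simp_all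
qed

text \<open>The explicit formula for \<open>g'\<close> serves two purposes. The factor
  \<open>g k False + \<epsilon> (g k False + g k True)\<close> takes the value 1 at
  \<open>v\<close>, so every pair other than \<open>k\<close> now vanishes at \<open>v\<close>,
  which makes \<open>v\<close> a prism direction. The factor also vanishes wherever pair
  \<open>k\<close> does, which protects the prism directions obtained before.\<close>

lemma cube_link_step:
  fixes g :: "'a::euclidean_space \<Rightarrow> bool \<Rightarrow> 'a"
  assumes b0: "b0 \<in> Basis" and I: "I = Basis - {b0}" and cs: "cube_system I g" and k: "k \<in> I"
  obtains g' \<epsilon> v where "cube_system I g'" "cube_link (hcone I g - {0}) (hcone I g' - {0})"
    "\<forall>s. g' k s = g k s"
    "\<forall>i\<in>I - {k}. \<forall>s. g' i s = g i s - (g i s \<bullet> v) *\<^sub>R (g k False + \<epsilon> *\<^sub>R (g k False + g k True))"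
    "g k False \<bullet> v = 1" "g k True \<bullet> v = -1"
proof -
  have fin: "finite I" and cI: "card I + 1 = DIM('a)" using cs by (auto simp: cube_system_def)
  define t where "t = g k False"
  define u where "u = g k False + g k True"
  have gT: "g k True = u - t" by (simp add: t_def u_def)
  obtain q0 where q0: "q0 \<in> hcone I g" "q0 \<noteq> 0" "t \<bullet> q0 = 0"
    using cube_system_vertex[OF cs, of "\<lambda>_. False"] k t_def by metis
  obtain q1 where q1: "q1 \<in> hcone I g" "q1 \<noteq> 0" "g k True \<bullet> q1 = 0"
    using cube_system_vertex[OF cs, of "\<lambda>_. True"] k by metis
  have uq: "0 < u \<bullet> q0" "0 < u \<bullet> q1"
    using cube_system_pair_pos[OF cs k] q0 q1 by (auto simp: u_def)
  \<comment> \<open>The vertices on the two facets of pair \<open>k\<close> are scaled to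
    \<open>u = 1\<close>. Their difference \<open>v\<close> then has \<open>t . v = 1\<close> and
    \<open>u . v = 0\<close>.\<close>
  define p0 where "p0 = (1 / (u \<bullet> q0)) *\<^sub>R q0"
  define p1 where "p1 = (1 / (u \<bullet> q1)) *\<^sub>R q1"
  have p1C: "p1 \<in> hcone I g" using uq q1 by (auto simp: p1_def intro!: hcone_scaleR)
  have p0: "t \<bullet> p0 = 0" "u \<bullet> p0 = 1" using q0 uq by (auto simp: p0_def)
  have "t \<bullet> q1 = u \<bullet> q1" using q1(3) by (simp add: gT inner_diff_left)
  then have p1: "t \<bullet> p1 = 1" "u \<bullet> p1 = 1" using q1 uq by (auto simp: p1_def)
  define v where "v = p1 - p0"
  have v: "t \<bullet> v = 1" "u \<bullet> v = 0" using p0 p1 by (auto simp: v_def inner_diff_right)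

  have "\<exists>\<delta>>0. \<forall>z\<in>hcone I g. \<delta> * norm z \<le> (g i False + g i True) \<bullet> z" if "i \<in> I" for i
    using linear_bound_on_cone[OF closed_hcone hcone_scaleR cube_system_pair_pos[OF cs that]] by metis
  then obtain \<delta> where \<delta>: "\<And>i. i \<in> I \<Longrightarrow> 0 < \<delta> i"
    "\<And>i z. i \<in> I \<Longrightarrow> z \<in> hcone I g \<Longrightarrow> \<delta> i * norm z \<le> (g i False + g i True) \<bullet> z" by metis
  define \<eta> where "\<eta> = Min (\<delta> ` I)"
  have "\<eta> \<in> \<delta> ` I" unfolding \<eta>_def using fin k by (intro Min_in) auto
  then have \<eta>0: "0 < \<eta>" using \<delta>(1) by blast
  have \<eta>1: "\<eta> \<le> \<delta> i" if "i \<in> I" for i unfolding \<eta>_def using fin that by (intro Min_le) auto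
  note \<eta> = \<eta>0 \<eta>1
  define B where "B = Max ((\<lambda>i. (g i False + g i True) \<bullet> p1) ` I)"
  have B: "(g i False + g i True) \<bullet> p1 \<le> B" if "i \<in> I" for i
    unfolding B_def using that fin by (intro Max_ge) auto
  have B0: "0 \<le> B" using B[OF k] p1 by (simp add: u_def)
  have u0: "u \<noteq> 0" using uq by auto
  \<comment> \<open>Small enough for the final chain of estimates, which needs
    \<open>\<epsilon> * B * norm u < \<eta>\<close>; the summand 1 keeps the denominator visibly
    positive.\<close>
  define \<epsilon> where "\<epsilon> = \<eta> / (2 * (B + 1) * norm u)"
  have \<epsilon>0: "0 < \<epsilon>" using \<eta> B0 u0 by (simp add: \<epsilon>_def)
  have \<epsilon>B: "\<epsilon> * B * norm u < \<eta>"
  proof -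
    have "\<epsilon> * B * norm u = \<eta> * (B / (2 * (B + 1)))" using u0 by (simp add: \<epsilon>_def)
    also have "\<dots> < \<eta> * 1" using \<eta>(1) B0 by (intro mult_strict_left_mono) (auto simp: field_simps)
    finally show ?thesis by simp
  qed
  define m where "m = t + \<epsilon> *\<^sub>R u"
  have mv: "m \<bullet> v = 1" using v by (simp add: m_def inner_add_left)

  \<comment> \<open>The basis vector \<open>b0\<close>, left free by \<open>I\<close>, names the new
    pair: its \<open>False\<close> facet \<open>r = 0\<close> is the old cone and its
    \<open>True\<close> facet \<open>m = 0\<close> is the new one. Pair \<open>k\<close> is sheared
    by \<open>r\<close>, the others do not see \<open>r\<close>.\<close>
  define G :: "'a \<Rightarrow> bool \<Rightarrow> 'a \<times> real" where
    "G = (\<lambda>i s. if i = b0 then (if s then (m, 0) else (0, 1))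
                else if i = k then (if s then (u - t, -1) else (t, 1)) else (g i s, 0))"
  have kb: "k \<noteq> b0" "k \<in> Basis" using k I by auto
  have hG: "(w, r) \<in> hcone Basis G \<longleftrightarrow> 0 \<le> r \<and> 0 \<le> m \<bullet> w \<and> 0 \<le> t \<bullet> w + r \<and> 0 \<le> u \<bullet> w - t \<bullet> w - r \<and>
      (\<forall>i\<in>I - {k}. \<forall>s. 0 \<le> g i s \<bullet> w)" for w r
  proof
    assume L: "(w, r) \<in> hcone Basis G"
    then have "0 \<le> G b0 s \<bullet> (w, r)" "0 \<le> G k s \<bullet> (w, r)" for s
      using b0 kb by (auto dest: hconeD)
    from this(1)[of True] this(1)[of False] this(2)[of True] this(2)[of False]
    have "0 \<le> r \<and> 0 \<le> m \<bullet> w \<and> 0 \<le> t \<bullet> w + r \<and> 0 \<le> u \<bullet> w - t \<bullet> w - r"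
      using kb by (simp add: G_def inner_diff_left)
    moreover have "0 \<le> g i s \<bullet> w" if "i \<in> I - {k}" for i s
      using hconeD[OF L, of i s] that I by (auto simp: G_def)
    ultimately show "0 \<le> r \<and> 0 \<le> m \<bullet> w \<and> 0 \<le> t \<bullet> w + r \<and> 0 \<le> u \<bullet> w - t \<bullet> w - r \<and>
      (\<forall>i\<in>I - {k}. \<forall>s. 0 \<le> g i s \<bullet> w)" by blast
  qed (auto simp: hcone_def G_def I inner_diff_left)
  have hg: "w \<in> hcone I g \<longleftrightarrow> 0 \<le> t \<bullet> w \<and> 0 \<le> u \<bullet> w - t \<bullet> w \<and> (\<forall>i\<in>I - {k}. \<forall>s. 0 \<le> g i s \<bullet> w)" for w
  proof
    assume "w \<in> hcone I g"
    then show "0 \<le> t \<bullet> w \<and> 0 \<le> u \<bullet> w - t \<bullet> w \<and> (\<forall>i\<in>I - {k}. \<forall>s. 0 \<le> g i s \<bullet> w)"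
      using hconeD[OF _ k, of w g True] hconeD[OF _ k, of w g False] 
      by (auto simp: hcone_def gT inner_diff_left t_def[symmetric])
  next
    assume "0 \<le> t \<bullet> w \<and> 0 \<le> u \<bullet> w - t \<bullet> w \<and> (\<forall>i\<in>I - {k}. \<forall>s. 0 \<le> g i s \<bullet> w)"
    moreover from this have "0 \<le> g k s \<bullet> w" for s
      by (cases s) (auto simp: gT inner_diff_left t_def[symmetric])
    ultimately show "w \<in> hcone I g" unfolding hcone_def by blast
  qed
  have mw: "m \<bullet> w = t \<bullet> w + \<epsilon> * (u \<bullet> w)" for w by (simp add: m_def inner_add_left)
  have zero: "w = 0" if "w \<in> hcone I g" "t \<bullet> w = 0" "u \<bullet> w = 0" for w
    using cube_system_opposite[OF cs k that(1), of False] that by (simp add: gT t_def inner_diff_left)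
  have csG: "cube_system Basis G"
    unfolding cube_system_def
  proof (intro conjI ballI impI)
    have t1: "0 \<le> t \<bullet> p1" "0 \<le> u \<bullet> p1" using p1 by auto
    have "(p1, 0) \<in> hcone Basis G"
      using p1C unfolding hG hg mw using p1 \<epsilon>0 by simp
    moreover have "p1 \<noteq> 0" using p1 by auto
    ultimately show "\<exists>z\<in>hcone Basis G. z \<noteq> 0" by (metis fst_conv fst_zero)
  next
    fix i z assume i: "i \<in> (Basis::'a set)" and z: "z \<in> hcone Basis G"
      and F: "G i False \<bullet> z = 0" and T: "G i True \<bullet> z = 0"
    obtain w r where [simp]: "z = (w, r)" by (cases z)
    have H: "0 \<le> r" "0 \<le> m \<bullet> w" "0 \<le> t \<bullet> w + r" "0 \<le> u \<bullet> w - t \<bullet> w - r"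
      "\<forall>i\<in>I - {k}. \<forall>s. 0 \<le> g i s \<bullet> w" using z hG[of w r] by auto
    have uw: "0 \<le> u \<bullet> w" using H by simp
    have inC: "w \<in> hcone I g" if "0 \<le> t \<bullet> w" using H that by (simp add: hg)
    consider "i = b0" | "i = k" | "i \<in> I - {k}" using i I by blast
    then show "z = 0"
    proof cases
      case 1
      then have e: "r = 0" "t \<bullet> w + \<epsilon> * (u \<bullet> w) = 0" using F T mw by (auto simp: G_def)
      moreover have "0 \<le> \<epsilon> * (u \<bullet> w)" using \<epsilon>0 uw by simp
      ultimately have tw: "t \<bullet> w = 0" "\<epsilon> * (u \<bullet> w) = 0" using H by linarith+
      then have "u \<bullet> w = 0" using \<epsilon>0 by simp
      then show ?thesis using zero[OF inC] tw e by (simp add: zero_prod_def)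
    next
      case 2
      then have e: "t \<bullet> w + r = 0" "u \<bullet> w - t \<bullet> w - r = 0" using F T kb by (auto simp: G_def inner_diff_left)
      then have "u \<bullet> w = 0" by simp
      then have "t \<bullet> w = 0" "r = 0" using H(1,2) e mw[of w] by auto
      then show ?thesis using zero[OF inC] \<open>u \<bullet> w = 0\<close> by (simp add: zero_prod_def)
    next
      case 3
      then have gi: "g i s \<bullet> w = 0" for s using F T I by (cases s) (auto simp: G_def)
      show ?thesis
      proof (cases "0 \<le> t \<bullet> w")
        case True
        then have "w = 0" using cube_system_opposite[OF cs _ inC[OF True], of i False] 3 gi by simp
        then show ?thesis using H by (simp add: zero_prod_def)
      next
        case False
        \<comment> \<open>Here \<open>w\<close> has left the old cone, but by at most
          \<open>\<epsilon> (u . w)\<close>. Adding \<open>\<tau>\<close> times \<open>p1\<close>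
          brings it back to a point \<open>y\<close> with \<open>t . y = 0\<close>. The sum of pair
          \<open>i\<close> at \<open>y\<close> is at most \<open>\<tau> * B\<close>, too small
          compared with its lower bound \<open>\<eta> * norm y\<close>.\<close>
        define \<tau> where "\<tau> = - (t \<bullet> w)"
        have \<tau>: "0 < \<tau>" "\<tau> \<le> \<epsilon> * (u \<bullet> w)" using False H(2) mw[of w] by (auto simp: \<tau>_def)
        define y where "y = w + \<tau> *\<^sub>R p1"
        have ty: "t \<bullet> y = 0" and uy: "u \<bullet> y = u \<bullet> w + \<tau>"
          using p1 by (auto simp: y_def inner_add_right inner_diff_right \<tau>_def)
        have yC: "y \<in> hcone I g"
          unfolding hg
        proof (intro conjI ballI allI)
          fix j s assume "j \<in> I - {k}"
          then show "0 \<le> g j s \<bullet> y" using H(5) hconeD[OF p1C, of j s] \<tau> by (simp add: y_def inner_add_right)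
        qed (use ty uy uw \<tau> in auto)
        have "u \<bullet> y > 0" using uy uw \<tau> by simp
        then have y0: "y \<noteq> 0" by auto
        have "\<eta> * norm y \<le> \<delta> i * norm y" using \<eta>(2)[of i] 3 by (simp add: mult_right_mono)
        also have "\<dots> \<le> (g i False + g i True) \<bullet> y" using \<delta>(2)[OF _ yC, of i] 3 by simp
        also have "\<dots> = \<tau> * ((g i False + g i True) \<bullet> p1)"
          using gi by (simp add: y_def inner_add_right inner_add_left algebra_simps)
        also have "\<dots> \<le> \<tau> * B" using B[of i] 3 \<tau> by (intro mult_left_mono) auto
        also have "\<dots> \<le> \<epsilon> * (u \<bullet> w) * B" using \<tau> B0 by (intro mult_right_mono) auto
        also have "\<dots> \<le> \<epsilon> * (u \<bullet> y) * B" using \<tau> B0 \<epsilon>0 uy by (intro mult_right_mono mult_left_mono) auto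
        also have "\<dots> \<le> \<epsilon> * (norm u * norm y) * B"
          using B0 \<epsilon>0 by (intro mult_right_mono mult_left_mono norm_cauchy_schwarz) auto
        also have "\<dots> = (\<epsilon> * B * norm u) * norm y" by simp
        also have "\<dots> < \<eta> * norm y" using \<epsilon>B y0 by simp
        finally show ?thesis by simp
      qed
    qed
  qed auto

  define g' where "g' = (\<lambda>i s. if i = k then g k s else g i s - (g i s \<bullet> v) *\<^sub>R m)"
  define \<Lambda> :: "'a \<Rightarrow> 'a \<times> real" where "\<Lambda> = (\<lambda>w. (w, 0))"
  \<comment> \<open>A chart of the hyperplane \<open>m . w = 0\<close>: project along
    \<open>v\<close> and store the removed coefficient as \<open>r\<close>. Since
    \<open>t . v = 1\<close> and \<open>u . v = 0\<close>, the shear of pair \<open>k\<close>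
    cancels and this pair reads as before.\<close>
  define \<Lambda>' :: "'a \<Rightarrow> 'a \<times> real" where "\<Lambda>' = (\<lambda>x. (x - (m \<bullet> x) *\<^sub>R v, m \<bullet> x))"
  have lin: "linear \<Lambda>" "linear \<Lambda>'"
    by (auto intro!: linearI simp: \<Lambda>_def \<Lambda>'_def inner_add_right algebra_simps)
  have inj: "inj \<Lambda>" "inj \<Lambda>'" by (auto intro!: injI simp: \<Lambda>_def \<Lambda>'_def)
  have tight: "G b0 False \<bullet> \<Lambda> z = 0" "G b0 True \<bullet> \<Lambda>' z = 0" for z
    using mv by (auto simp: G_def \<Lambda>_def \<Lambda>'_def inner_diff_right)
  have GL': "G i s \<bullet> \<Lambda>' x = g' i s \<bullet> x" if "i \<in> I" for i s x
  proof (cases "i = k")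
    case True
    have "u \<bullet> x - (t \<bullet> x + (m \<bullet> x) * (u \<bullet> v)) = (u - t) \<bullet> x" using v by (simp add: inner_diff_left)
    then show ?thesis
      using True v kb gT by (cases s)
        (auto simp: G_def \<Lambda>'_def g'_def t_def[symmetric] inner_diff_left inner_diff_right)
  next
    case False
    then show ?thesis using that I
      by (auto simp: G_def \<Lambda>'_def g'_def inner_diff_left inner_diff_right)
  qed
  have L0: "\<Lambda> z = 0 \<longleftrightarrow> z = 0" "\<Lambda>' z = 0 \<longleftrightarrow> z = 0" for z
    using lin inj linear_0 by (metis injD)+
  have in': "\<Lambda>' z \<in> hcone Basis G \<longleftrightarrow> z \<in> hcone I g'" if "0 \<le> m \<bullet> z" for z
  proof
    assume "\<Lambda>' z \<in> hcone Basis G"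
    then show "z \<in> hcone I g'" using GL' I by (fastforce simp: hcone_def)
  next
    assume z: "z \<in> hcone I g'"
    have "0 \<le> G i s \<bullet> \<Lambda>' z" if "i \<in> Basis" for i s
    proof (cases "i = b0")
      case True
      then show ?thesis using \<open>0 \<le> m \<bullet> z\<close> tight(2) by (cases s) (auto simp: G_def \<Lambda>'_def)
    next
      case False
      then have "i \<in> I" using that I by auto
      then show ?thesis using GL'[of i s z] hconeD[OF z, of i s] by simp
    qed
    then show "\<Lambda>' z \<in> hcone Basis G" by (simp add: hcone_def)
  qed
  \<comment> \<open>In the chart the constraint \<open>r >= 0\<close> becomes
    \<open>0 <= m . z\<close>. It follows from pair \<open>k\<close>, so the pairs in
    \<open>I\<close> alone describe the far facet.\<close>
  have pos': "0 \<le> m \<bullet> z" if "z \<in> hcone I g'" for z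
  proof -
    have "0 \<le> g' k s \<bullet> z" for s using hconeD[OF that k] by simp
    from this[of True] this[of False] have "0 \<le> t \<bullet> z" "0 \<le> (u - t) \<bullet> z" by (auto simp: g'_def t_def u_def)
    then show ?thesis using \<epsilon>0 by (simp add: mw inner_diff_left)
  qed
  have im': "\<Lambda>' ` (hcone I g' - {0}) = {y \<in> hcone Basis G - {0}. G b0 True \<bullet> y = 0}"
  proof (intro equalityI subsetI)
    fix y assume "y \<in> \<Lambda>' ` (hcone I g' - {0})"
    then show "y \<in> {y \<in> hcone Basis G - {0}. G b0 True \<bullet> y = 0}" using tight in' pos' L0 by auto
  next
    fix y assume "y \<in> {y \<in> hcone Basis G - {0}. G b0 True \<bullet> y = 0}"
    then have y: "y \<in> hcone Basis G" "y \<noteq> 0" "G b0 True \<bullet> y = 0" by auto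
    obtain w r where [simp]: "y = (w, r)" by (cases y)
    define x where "x = w + r *\<^sub>R v"
    have "m \<bullet> w = 0" using y(3) by (simp add: G_def)
    then have mx: "m \<bullet> x = r" using mv by (simp add: x_def inner_add_right)
    then have yx: "y = \<Lambda>' x" by (simp add: \<Lambda>'_def x_def)
    moreover have "0 \<le> r" using y(1) hG[of w r] by simp
    ultimately show "y \<in> \<Lambda>' ` (hcone I g' - {0})" using in'[of x] mx y(1,2) L0 by auto
  qed
  have im: "\<Lambda> ` (hcone I g - {0}) = {y \<in> hcone Basis G - {0}. G b0 False \<bullet> y = 0}"
  proof -
    have "(w, 0) \<in> hcone Basis G \<longleftrightarrow> w \<in> hcone I g" for w
      using mw[of w] \<epsilon>0 unfolding hG hg by (auto intro!: add_nonneg_nonneg)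
    moreover have "G b0 False \<bullet> (w, r) = 0 \<longleftrightarrow> r = 0" for w r by (simp add: G_def)
    ultimately show ?thesis
      by (auto simp: \<Lambda>_def zero_prod_def image_iff)
  qed
  have cs': "cube_system I g'"
    unfolding cube_system_def
  proof (intro conjI ballI impI)
    show "finite I" "I \<noteq> {}" "card I + 1 = DIM('a)" using fin k cI by auto
    obtain y where "y \<in> hcone Basis G" "y \<noteq> 0" "\<And>i. i \<in> Basis \<Longrightarrow> G i True \<bullet> y = 0"
      using cube_system_vertex[OF csG, of "\<lambda>_. True"] by metis
    then have "y \<in> {y \<in> hcone Basis G - {0}. G b0 True \<bullet> y = 0}" using b0 by auto
    then show "\<exists>z\<in>hcone I g'. z \<noteq> 0" unfolding im'[symmetric] by auto
  next
    fix i z assume iz: "i \<in> I" "z \<in> hcone I g'" "g' i False \<bullet> z = 0" "g' i True \<bullet> z = 0"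
    then have "\<Lambda>' z \<in> hcone Basis G" using in' pos' by auto
    then have "\<Lambda>' z = 0" using cube_system_opposite[OF csG, of i "\<Lambda>' z" False] iz GL' I by auto
    then show "z = 0" using L0 by simp
  qed
  have "cube_link (hcone I g - {0}) (hcone I g' - {0})"
    by (rule cube_linkI[OF csG b0 lin(1) inj(1) lin(2) inj(2), where s=False]) (use tight im im' interior_hcone[OF cs] interior_hcone[OF cs'] in simp_all)
  moreover have "g k False \<bullet> v = 1" "g k True \<bullet> v = -1"
    using v by (auto simp: gT inner_diff_left t_def[symmetric])
  ultimately show ?thesis
    using cs' by (intro that[of g' v \<epsilon>]) (auto simp: g'_def m_def t_def u_def)
qed

section \<open>Reducing a cone to the cone over the unit cube\<close>

lemma cube_link_linear_image:
  fixes A :: "'a::euclidean_space \<Rightarrow> 'a"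
  assumes "cube_link S S'" "linear A" "bij A"
  shows "cube_link S (A ` S')"
  using assms(1)
proof cases
  case (cube_linkI G j \<Lambda> \<Lambda>' s)
  have lin: "linear (inv A)" using assms(2,3) by (simp add: bij_is_inj bij_is_surj inj_linear_imp_inv_linear)
  have img: "(\<Lambda>' \<circ> inv A) ` (A ` S') = \<Lambda>' ` S'"
    using assms(3) by (simp add: image_comp comp_def bij_is_inj)
  show ?thesis
  proof (rule cube_link.cube_linkI[of G j \<Lambda> "\<Lambda>' \<circ> inv A" s])
    show "linear (\<Lambda>' \<circ> inv A)" using lin cube_linkI by (simp add: linear_compose)
    show "inj (\<Lambda>' \<circ> inv A)" using cube_linkI assms(3) by (simp add: inj_compose bij_is_inj bij_imp_bij_inv)
    show "interior (A ` S') \<noteq> {}" using cube_linkI assms by (simp add: interior_bijective_linear_image)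
  qed (use cube_linkI img in auto)
qed

text \<open>Induction over the treated indices \<open>D\<close>, with \<open>v i\<close> the prism
  direction of index \<open>i\<close>. Treating a further \<open>k\<close> subtracts multiples of a
  combination of the two functionals of pair \<open>k\<close>; both vanish on \<open>v i\<close> for
  \<open>i\<close> in \<open>D\<close>, so all values at the old directions are preserved.\<close>

lemma cube_system_reduce:
  fixes g :: "'a::euclidean_space \<Rightarrow> bool \<Rightarrow> 'a"
  assumes b0: "b0 \<in> Basis" and I: "I = Basis - {b0}" and cs: "cube_system I g"
    and D: "finite D" "D \<subseteq> I"
  shows "\<exists>g' v. cube_system I g' \<and> (cube_link ^^ card D) (hcone I g - {0}) (hcone I g' - {0}) \<and>
    (\<forall>i\<in>D. (\<forall>j\<in>I - {i}. \<forall>s. g' j s \<bullet> v i = 0) \<and> g' i False \<bullet> v i = 1 \<and> g' i True \<bullet> v i = -1)"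
  using D
proof (induction D)
  case empty
  then show ?case using cs by auto
next
  case (insert k D)
  then obtain g' v where cs': "cube_system I g'"
    and ch: "(cube_link ^^ card D) (hcone I g - {0}) (hcone I g' - {0})"
    and inv: "\<forall>i\<in>D. (\<forall>j\<in>I - {i}. \<forall>s. g' j s \<bullet> v i = 0) \<and> g' i False \<bullet> v i = 1 \<and> g' i True \<bullet> v i = -1"
    by auto
  have van: "g' j s \<bullet> v i = 0" if "i \<in> D" "j \<in> I" "j \<noteq> i" for i j s using inv that by blast
  have dual: "g' i False \<bullet> v i = 1" "g' i True \<bullet> v i = -1" if "i \<in> D" for i using inv that by blast+
  have k: "k \<in> I" "k \<notin> D" using insert by auto
  obtain g1 \<epsilon> w where cs1: "cube_system I g1"
    and lk: "cube_link (hcone I g' - {0}) (hcone I g1 - {0})"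
    and g1k: "\<forall>s. g1 k s = g' k s"
    and g1: "\<forall>i\<in>I - {k}. \<forall>s. g1 i s = g' i s - (g' i s \<bullet> w) *\<^sub>R (g' k False + \<epsilon> *\<^sub>R (g' k False + g' k True))"
    and w: "g' k False \<bullet> w = 1" "g' k True \<bullet> w = -1"
    by (rule cube_link_step[OF b0 I cs' k(1)])
  have "(cube_link ^^ card (insert k D)) (hcone I g - {0}) (hcone I g1 - {0})"
    using relpowp_Suc_I[OF ch lk] insert by simp
  moreover have "(\<forall>j\<in>I - {i}. \<forall>s. g1 j s \<bullet> (v(k := w)) i = 0) \<and>
      g1 i False \<bullet> (v(k := w)) i = 1 \<and> g1 i True \<bullet> (v(k := w)) i = -1" if i: "i \<in> insert k D" for i
  proof (cases "i = k")
    case True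
    then show ?thesis using w g1k g1 by (auto simp: inner_diff_left inner_add_left)
  next
    case False
    then have iD: "i \<in> D" "i \<in> I" using i insert by auto
    have k0: "g' k s \<bullet> v i = 0" for s using van[OF iD(1) k(1)] False by simp
    have "g1 j s \<bullet> v i = g' j s \<bullet> v i" if "j \<in> I" for j s
      using g1k g1 that k0 by (cases "j = k") (auto simp: inner_diff_left inner_add_left)
    then show ?thesis using van[OF iD(1)] dual[OF iD(1)] iD False by simp
  qed
  ultimately show ?case using cs1 by (intro exI[of _ g1] exI[of _ "v(k := w)"]) blast
qed

text \<open>In dimension at least 2 this is the cone, without its apex, over the unit cube in the
  hyperplane \<open>y . b0 = 1\<close>.\<close>

definition box_cone :: "'a::euclidean_space \<Rightarrow> 'a set" where
  "box_cone b0 = {y. \<forall>i\<in>Basis - {b0}. 0 \<le> y \<bullet> i \<and> y \<bullet> i \<le> y \<bullet> b0} - {0}"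

text \<open>With a prism direction for every index the cube is a parallelepiped. Its corner is the
  vertex \<open>p\<close> on all \<open>False\<close> facets, its edges are the \<open>v i\<close>,
  and \<open>\<kappa> i = g i True . p\<close> is the edge length that puts the opposite facet at
  \<open>y . i = y . b0\<close>.\<close>

lemma hcone_linear_image_box_cone:
  fixes g :: "'a::euclidean_space \<Rightarrow> bool \<Rightarrow> 'a"
  assumes b0: "b0 \<in> Basis" and I: "I = Basis - {b0}" and cs: "cube_system I g"
    and van: "\<And>i j s. i \<in> I \<Longrightarrow> j \<in> I \<Longrightarrow> j \<noteq> i \<Longrightarrow> g j s \<bullet> v i = 0"
    and dual: "\<And>i. i \<in> I \<Longrightarrow> g i False \<bullet> v i = 1" "\<And>i. i \<in> I \<Longrightarrow> g i True \<bullet> v i = -1"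
  obtains T where "linear T" "bij T" "T ` box_cone b0 = hcone I g - {0}"
proof -
  have fin: "finite I" "I \<noteq> {}" using cs by (auto simp: cube_system_def)
  obtain p where p: "p \<in> hcone I g" "p \<noteq> 0" "\<And>i. i \<in> I \<Longrightarrow> g i False \<bullet> p = 0"
    using cube_system_vertex[OF cs, of "\<lambda>_. False"] by metis
  define \<kappa> where "\<kappa> i = g i True \<bullet> p" for i
  have \<kappa>: "0 < \<kappa> i" if "i \<in> I" for i
    using cube_system_opposite_pos[OF cs that p(1,2) p(3)[OF that]] by (simp add: \<kappa>_def)
  define T where "T y = (\<Sum>i\<in>I. (y \<bullet> i * \<kappa> i) *\<^sub>R v i) + (y \<bullet> b0) *\<^sub>R p" for y
  have lin: "linear T"
    by (rule linearI) (auto simp: T_def inner_add_left algebra_simps sum.distrib scaleR_sum_right)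
  have gT: "g j s \<bullet> T y = \<kappa> j * (y \<bullet> j) * (g j s \<bullet> v j) + (y \<bullet> b0) * (g j s \<bullet> p)" if "j \<in> I" for j s y
  proof -
    have "g j s \<bullet> T y = (\<Sum>i\<in>I. (y \<bullet> i * \<kappa> i) * (g j s \<bullet> v i)) + (y \<bullet> b0) * (g j s \<bullet> p)"
      by (simp add: T_def inner_add_right inner_sum_right)
    also have "(\<Sum>i\<in>I. (y \<bullet> i * \<kappa> i) * (g j s \<bullet> v i)) = (\<Sum>i\<in>I. if i = j then (y \<bullet> j * \<kappa> j) * (g j s \<bullet> v j) else 0)"
      using van that by (intro sum.cong) auto
    finally show ?thesis using that fin by simp
  qed
  have gF: "g j False \<bullet> T y = \<kappa> j * (y \<bullet> j)" if "j \<in> I" for j y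
    using gT[OF that] dual(1)[OF that] p(3)[OF that] by simp
  have gU: "g j True \<bullet> T y = \<kappa> j * (y \<bullet> b0 - y \<bullet> j)" if "j \<in> I" for j y
    using gT[OF that] dual(2)[OF that] by (simp add: \<kappa>_def algebra_simps)
  have "y = 0" if "T y = 0" for y
  proof -
    have 1: "y \<bullet> j = 0" if "j \<in> I" for j using gF[OF that, of y] \<open>T y = 0\<close> \<kappa>[OF that] by simp
    obtain j where j: "j \<in> I" using fin by auto
    have "y \<bullet> b0 = 0" using gU[OF j, of y] 1[OF j] \<open>T y = 0\<close> \<kappa>[OF j] by simp
    then show ?thesis using 1 I by (metis DiffI euclidean_all_zero_iff singletonD)
  qed
  then have inj: "inj T" using lin by (simp add: linear_injective_0)
  then have bij: "bij T" using lin by (simp add: bij_def linear_injective_imp_surjective)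
  have "T y \<in> hcone I g \<longleftrightarrow> (\<forall>i\<in>Basis - {b0}. 0 \<le> y \<bullet> i \<and> y \<bullet> i \<le> y \<bullet> b0)" for y
  proof -
    have "(\<forall>s. 0 \<le> g i s \<bullet> T y) \<longleftrightarrow> 0 \<le> y \<bullet> i \<and> y \<bullet> i \<le> y \<bullet> b0" if "i \<in> I" for i
      using gF[OF that, of y] gU[OF that, of y] \<kappa>[OF that]
      by (auto simp: all_bool_eq zero_le_mult_iff)
    then show ?thesis by (auto simp: hcone_def I)
  qed
  moreover have "T y = 0 \<longleftrightarrow> y = 0" for y using \<open>\<And>y. T y = 0 \<Longrightarrow> y = 0\<close> lin linear_0 by blast
  ultimately have "box_cone b0 = T -` (hcone I g - {0})" by (auto simp: box_cone_def)
  then have "T ` box_cone b0 = hcone I g - {0}"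
    using bij by (simp add: surj_image_vimage_eq bij_is_surj)
  then show ?thesis using that lin bij by blast
qed

lemma cube_system_linked_box_cone:
  fixes g :: "'a::euclidean_space \<Rightarrow> bool \<Rightarrow> 'a"
  assumes b0: "b0 \<in> Basis" and I: "I = Basis - {b0}" and cs: "cube_system I g"
  shows "(cube_link ^^ card I) (hcone I g - {0}) (box_cone b0)"
proof -
  have fin: "finite I" "I \<noteq> {}" using cs by (auto simp: cube_system_def)
  obtain g' v where cs': "cube_system I g'"
    and ch: "(cube_link ^^ card I) (hcone I g - {0}) (hcone I g' - {0})"
    and v: "\<forall>i\<in>I. (\<forall>j\<in>I - {i}. \<forall>s. g' j s \<bullet> v i = 0) \<and> g' i False \<bullet> v i = 1 \<and> g' i True \<bullet> v i = -1"
    using cube_system_reduce[OF b0 I cs fin(1) order_refl] by blast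
  obtain T where T: "linear T" "bij T" "T ` box_cone b0 = hcone I g' - {0}"
    using hcone_linear_image_box_cone[OF b0 I cs', of v] v by blast
  \<comment> \<open>The last link is split off so that the linear map \<open>T\<close> can be
    absorbed into it; the chain then ends exactly at \<open>box_cone b0\<close> without an
    additional link.\<close>
  obtain n where n: "card I = Suc n" using fin by (metis card_0_eq not0_implies_Suc)
  obtain X where X: "(cube_link ^^ n) (hcone I g - {0}) X" "cube_link X (hcone I g' - {0})"
    using ch unfolding n by (auto elim: relpowp_Suc_E)
  have "linear (inv T)" "bij (inv T)"
    using T by (auto simp: bij_is_inj bij_is_surj inj_linear_imp_inv_linear bij_imp_bij_inv)
  from cube_link_linear_image[OF X(2) this] have "cube_link X (box_cone b0)"
    using T by (metis bij_is_inj image_inv_f_f)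
  with X(1) show ?thesis unfolding n by (rule relpowp_Suc_I)
qed

lemma symp_relpowp:
  assumes "symp R"
  shows "symp (R ^^ n)"
proof (rule sympI)
  show "(R ^^ n) x y \<Longrightarrow> (R ^^ n) y x" for x y
  proof (induction n arbitrary: y)
    case (Suc n)
    then obtain z where "(R ^^ n) x z" "R z y" by (auto elim: relpowp_Suc_E)
    then show ?case using Suc.IH relpowp_Suc_I2[of R y z n x] assms sympD by metis
  qed simp
qed

text \<open>Both cones reach the same \<open>box_cone b0\<close> in \<open>card I\<close> links, and
  links are symmetric, so the second chain can be run backwards.\<close>

lemma cube_systems_linked:
  fixes g g' :: "'a::euclidean_space \<Rightarrow> bool \<Rightarrow> 'a"
  assumes "b0 \<in> Basis" and "I = Basis - {b0}" and "cube_system I g" and "cube_system I g'"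
  shows "(cube_link ^^ (2 * card I)) (hcone I g - {0}) (hcone I g' - {0})"
proof -
  have "symp (cube_link :: 'a set \<Rightarrow> 'a set \<Rightarrow> bool)" by (auto intro: sympI cube_link_sym)
  then have "(cube_link ^^ card I) (box_cone b0) (hcone I g' - {0})"
    using cube_system_linked_box_cone[OF assms(1,2,4)] symp_relpowp sympD by metis
  with cube_system_linked_box_cone[OF assms(1,2,3)] show ?thesis
    by (auto simp: mult_2 relpowp_add)
qed

subsection \<open>Polytopes in homogeneous coordinates\<close>

text \<open>
  \<open>pcone P\<close> is the open-ended cone over \<open>P \<times> {1}\<close>. The polytope \<open>Q\<close> is a projective image of \<open>P\<close>
  exactly if \<open>pcone Q = L ` pcone P\<close> for a linear bijection \<open>L\<close>.
\<close>

definition pcone :: "'a::euclidean_space set \<Rightarrow> ('a \<times> real) set" where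
  "pcone P = {y. 0 < snd y \<and> fst y /\<^sub>R snd y \<in> P}"

lemma inner_lift_combination:
  fixes x y :: "'a::euclidean_space" and h :: "'a \<times> real"
  assumes "u + v = 1"
  shows "h \<bullet> (u *\<^sub>R x + v *\<^sub>R y, 1) = u * (h \<bullet> (x, 1)) + v * (h \<bullet> (y, 1))"
proof -
  have "(u *\<^sub>R x + v *\<^sub>R y, 1) = u *\<^sub>R (x, 1::real) + v *\<^sub>R (y, 1)" using assms by simp
  then show ?thesis by (simp only: inner_add_right inner_scaleR_right)
qed

lemma lift_in_pcone [simp]: "(x, 1) \<in> pcone P \<longleftrightarrow> x \<in> P"
  by (simp add: pcone_def)

lemma pcone_snd_pos: "y \<in> pcone P \<Longrightarrow> 0 < snd y"
  by (simp add: pcone_def)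

lemma pconeE:
  assumes "y \<in> pcone P"
  obtains x c where "x \<in> P" "0 < c" "y = c *\<^sub>R (x, 1)"
  using assms that[of "fst y /\<^sub>R snd y" "snd y"] by (cases y) (auto simp: pcone_def)

lemma pcone_scaleR: "y \<in> pcone P \<Longrightarrow> 0 < c \<Longrightarrow> c *\<^sub>R y \<in> pcone P"
  by (simp add: pcone_def field_simps)

lemma pcone_eq_iff: "pcone P = pcone Q \<longleftrightarrow> P = Q"
  by (metis lift_in_pcone subsetI subset_antisym)

lemma pcone_hyperplane: "pcone {x \<in> P. h \<bullet> (x, 1) = 0} = {y \<in> pcone P. h \<bullet> y = 0}"
proof (rule set_eqI)
  fix y
  show "y \<in> pcone {x \<in> P. h \<bullet> (x, 1) = 0} \<longleftrightarrow> y \<in> {y \<in> pcone P. h \<bullet> y = 0}"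
  proof (cases "0 < snd y")
    case True
    have "y = snd y *\<^sub>R (fst y /\<^sub>R snd y, 1)" using True by (cases y) simp
    then have "h \<bullet> y = snd y * (h \<bullet> (fst y /\<^sub>R snd y, 1))" by (metis inner_scaleR_right)
    then show ?thesis using True by (auto simp: pcone_def)
  qed (simp add: pcone_def)
qed

lemma pcone_linear_image:
  assumes "linear f"
  shows "pcone (f ` B) = (\<lambda>y. (f (fst y), snd y)) ` pcone B"
proof (intro equalityI subsetI)
  fix y assume "y \<in> pcone (f ` B)"
  then obtain x c where x: "x \<in> f ` B" "0 < c" "y = c *\<^sub>R (x, 1)" by (rule pconeE)
  then obtain b where b: "b \<in> B" "x = f b" by blast
  have "c *\<^sub>R (b, 1) \<in> pcone B" using b x(2) by (intro pcone_scaleR) auto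
  then show "y \<in> (\<lambda>y. (f (fst y), snd y)) ` pcone B"
    using x b by (intro image_eqI[of _ _ "c *\<^sub>R (b, 1)"]) (auto simp: linear_cmul[OF assms])
next
  fix y assume "y \<in> (\<lambda>y. (f (fst y), snd y)) ` pcone B"
  then show "y \<in> pcone (f ` B)" by (auto simp: pcone_def linear_cmul[OF assms, symmetric])
qed

lemma pcone_section:
  assumes "\<And>y. y \<in> Y \<Longrightarrow> 0 < snd y" "\<And>y c. y \<in> Y \<Longrightarrow> 0 < c \<Longrightarrow> c *\<^sub>R y \<in> Y"
  shows "pcone {x. (x, 1) \<in> Y} = Y"
proof -
  have eq: "y = snd y *\<^sub>R (fst y /\<^sub>R snd y, 1)" "(fst y /\<^sub>R snd y, 1) = (1 / snd y) *\<^sub>R y" if "0 < snd y" for y :: "'a \<times> real"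
    using that by (cases y; simp add: inverse_eq_divide)+
  show ?thesis
  proof (intro set_eqI iffI)
    fix y assume "y \<in> pcone {x. (x, 1) \<in> Y}"
    then show "y \<in> Y" using assms(2)[of "(fst y /\<^sub>R snd y, 1)" "snd y"] eq(1)[of y] by (simp add: pcone_def)
  next
    fix y assume "y \<in> Y"
    then show "y \<in> pcone {x. (x, 1) \<in> Y}" using assms(1)[of y] assms(2)[of y "1 / snd y"] eq(2)[of y] 
      by (simp add: pcone_def)
  qed
qed

lemma pcone_add:
  assumes "convex P" "y \<in> pcone P" "z \<in> pcone P"
  shows "y + z \<in> pcone P"
proof -
  have pos: "0 < snd y" "0 < snd z" using pcone_snd_pos assms(2,3) by blast+
  define s where "s = snd y + snd z"
  have "(snd y / s) *\<^sub>R (fst y /\<^sub>R snd y) + (snd z / s) *\<^sub>R (fst z /\<^sub>R snd z) \<in> P"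
    using assms pos by (intro convexD[OF assms(1)]) (auto simp: pcone_def s_def add_divide_distrib[symmetric])
  also have "(snd y / s) *\<^sub>R (fst y /\<^sub>R snd y) + (snd z / s) *\<^sub>R (fst z /\<^sub>R snd z) = fst (y + z) /\<^sub>R snd (y + z)"
    using pos by (simp add: s_def scaleR_add_right inverse_eq_divide)
  finally show ?thesis using pos by (simp add: pcone_def)
qed

lemma convex_if_pcone_add:
  assumes "\<And>y z. y \<in> pcone P \<Longrightarrow> z \<in> pcone P \<Longrightarrow> y + z \<in> pcone P"
  shows "convex P"
  unfolding convex_alt
proof (intro ballI allI impI)
  fix x y and u :: real assume xy: "x \<in> P" "y \<in> P" and u: "0 \<le> u \<and> u \<le> 1"
  show "(1 - u) *\<^sub>R x + u *\<^sub>R y \<in> P"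
  proof (cases "u = 0 \<or> u = 1")
    case False
    then have "(1 - u) *\<^sub>R (x, 1) + u *\<^sub>R (y, 1) \<in> pcone P"
      using u xy by (intro assms pcone_scaleR) auto
    then show ?thesis by simp
  qed (use xy in auto)
qed

lemma convex_pcone_linear_image:
  assumes "convex P" "linear L" "pcone Q = L ` pcone P"
  shows "convex Q"
proof (rule convex_if_pcone_add)
  fix y z assume "y \<in> pcone Q" "z \<in> pcone Q"
  then obtain y' z' where "y' \<in> pcone P" "z' \<in> pcone P" "y = L y'" "z = L z'"
    using assms(3) by auto
  then show "y + z \<in> pcone Q"
    using pcone_add[OF assms(1), of y' z'] assms(3) linear_add[OF assms(2)] by (metis image_eqI)
qed

text \<open>The hypothesis on \<open>pcone Q\<close> keeps the denominator positive on
  \<open>P\<close>. Then \<open>Q\<close> is the hull of the images of the generators of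
  \<open>P\<close>: the points whose image lies in the cone over that hull form a convex set
  containing the generators.\<close>

lemma polytope_pcone_linear_image:
  fixes P :: "'a::euclidean_space set" and Q :: "'b::euclidean_space set"
  assumes P: "polytope P" and L: "linear L" and Q: "pcone Q = L ` pcone P"
  shows "polytope Q"
proof -
  obtain V where V: "finite V" "P = convex hull V" using P by (auto simp: polytope_def)
  define \<phi> where "\<phi> x = fst (L (x, 1)) /\<^sub>R snd (L (x, 1))" for x
  have Lx: "L (x, 1) \<in> pcone Q" if "x \<in> P" for x using that Q by auto
  let ?R = "convex hull (\<phi> ` V)"
  have cQ: "convex Q" using convex_pcone_linear_image[OF polytope_imp_convex[OF P] L Q] .
  have "\<phi> x \<in> Q" if "x \<in> P" for x using Lx[OF that] by (simp add: pcone_def \<phi>_def)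
  then have RQ: "?R \<subseteq> Q" using V cQ by (intro hull_minimal) (auto simp: hull_inc)
  have "convex {x. L (x, 1) \<in> pcone ?R}"
  proof (rule convex_alt[THEN iffD2], intro ballI allI impI)
    fix x y and u :: real
    assume xy: "x \<in> {x. L (x, 1) \<in> pcone ?R}" "y \<in> {x. L (x, 1) \<in> pcone ?R}" and u: "0 \<le> u \<and> u \<le> 1"
    show "(1 - u) *\<^sub>R x + u *\<^sub>R y \<in> {x. L (x, 1) \<in> pcone ?R}"
    proof (cases "u = 0 \<or> u = 1")
      case False
      have "L ((1 - u) *\<^sub>R x + u *\<^sub>R y, 1) = L ((1 - u) *\<^sub>R (x, 1) + u *\<^sub>R (y, 1))" by simp
      also have "\<dots> = (1 - u) *\<^sub>R L (x, 1) + u *\<^sub>R L (y, 1)"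
        using linear_add[OF L] linear_cmul[OF L] by metis
      also have "\<dots> \<in> pcone ?R" using False u xy by (intro pcone_add pcone_scaleR) auto
      finally show ?thesis by simp
    qed (use xy in auto)
  qed
  moreover have "V \<subseteq> {x. L (x, 1) \<in> pcone ?R}"
  proof (rule subsetI)
    fix x assume "x \<in> V"
    then have "L (x, 1) \<in> pcone Q" "\<phi> x \<in> ?R" using Lx[of x] V(2) by (simp_all add: hull_inc)
    then show "x \<in> {x. L (x, 1) \<in> pcone ?R}" by (simp add: pcone_def \<phi>_def)
  qed
  ultimately have sub: "P \<subseteq> {x. L (x, 1) \<in> pcone ?R}" unfolding V by (intro hull_minimal)
  have "Q \<subseteq> ?R"
  proof
    fix q assume "q \<in> Q"
    then have "(q, 1) \<in> L ` pcone P" using Q by auto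
    then obtain y where y: "y \<in> pcone P" "(q, 1) = L y" by auto
    obtain x c where x: "x \<in> P" "0 < c" "y = c *\<^sub>R (x, 1)" using y(1) by (rule pconeE)
    then have "L y = c *\<^sub>R L (x, 1)" using linear_cmul[OF L] by metis
    then have "(q, 1) \<in> pcone ?R" using x sub y(2) pcone_scaleR[of "L (x, 1)" ?R c] by auto
    then show "q \<in> ?R" by simp
  qed
  then show ?thesis using RQ V by (auto simp: polytope_def intro!: exI[of _ "\<phi> ` V"])
qed

text \<open>The lift \<open>P \<times> {1}\<close> has the affine dimension of \<open>P\<close>, and
  its affine hull misses 0, so adjoining 0 raises the dimension by one. For empty \<open>P\<close>
  both sides are 0, because the empty set has affine dimension -1.\<close>

lemma dim_pcone:
  fixes P :: "'a::euclidean_space set"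
  shows "int (dim (pcone P)) = aff_dim P + 1"
proof (cases "P = {}")
  case True
  then show ?thesis by (simp add: pcone_def)
next
  case False
  define E where "E = (\<lambda>x. (x, 1::real)) ` P"
  have "E \<subseteq> pcone P" by (auto simp: E_def)
  moreover have "pcone P \<subseteq> span E"
  proof
    fix y assume "y \<in> pcone P"
    then obtain x c where "x \<in> P" "y = c *\<^sub>R (x, 1)" by (rule pconeE)
    then show "y \<in> span E" by (metis E_def image_eqI span_base span_scale)
  qed
  ultimately have d: "dim (pcone P) = dim E" by (metis dim_span dim_subset le_antisym)
  have "E = (+) (0, 1) ` (\<lambda>x. (x, 0)) ` P" by (auto simp: E_def image_iff)
  moreover have "linear (\<lambda>x::'a. (x, 0::real))" by (auto intro: linearI)
  moreover have "inj (\<lambda>x::'a. (x, 0::real))" by (auto intro: injI)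
  ultimately have a: "aff_dim E = aff_dim P" by (metis aff_dim_translation_eq aff_dim_injective_linear_image)
  have "affine {y::'a \<times> real. snd y = 1}" by (auto simp: affine_def algebra_simps)
  then have "affine hull E \<subseteq> {y. snd y = 1}" by (intro hull_minimal) (auto simp: E_def)
  then have "0 \<notin> affine hull E" by auto
  then have "aff_dim (insert 0 E) = aff_dim P + 1" by (simp add: aff_dim_insert a)
  moreover have "aff_dim (insert 0 E) = int (dim (insert 0 E))" by (intro aff_dim_zero) (simp add: hull_inc)
  moreover have "dim (insert 0 E) = dim E" by (metis dim_span span_insert_0)
  ultimately show ?thesis using d by simp
qed

lemma dim_eq_DIM_if_interior:
  fixes S :: "'a::euclidean_space set"
  assumes "interior S \<noteq> {}"
  shows "dim S = DIM('a)"
proof -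
  have "dim (interior S) = DIM('a)"
    using dim_openin[of UNIV "interior S"] assms by simp
  then show ?thesis using dim_subset[OF interior_subset, of S] dim_subset_UNIV[of S] by simp
qed

subsection \<open>The face lattice of a cube\<close>

definition tight_face :: "('i \<Rightarrow> bool \<Rightarrow> 'a::euclidean_space \<times> real) \<Rightarrow> 'a set \<Rightarrow> ('i \<times> bool) set \<Rightarrow> 'a set" where
  "tight_face G K T = {x \<in> K. \<forall>(i, s)\<in>T. G i s \<bullet> (x, 1) = 0}"

definition tight_set :: "('i \<Rightarrow> bool \<Rightarrow> 'a::euclidean_space \<times> real) \<Rightarrow> 'i set \<Rightarrow> 'a set \<Rightarrow> ('i \<times> bool) set" where
  "tight_set G I X = {(i, s). i \<in> I \<and> (\<forall>x\<in>X. G i s \<bullet> (x, 1) = 0)}"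

text \<open>The sets of constraints that occur as tight sets of faces; \<open>I \<times> UNIV\<close> belongs to the empty face.\<close>

definition lattice_set :: "'i set \<Rightarrow> ('i \<times> bool) set \<Rightarrow> bool" where
  "lattice_set I T \<longleftrightarrow> T = I \<times> UNIV \<or> T \<subseteq> I \<times> UNIV \<and> (\<forall>i s. (i, s) \<in> T \<longrightarrow> (i, \<not> s) \<notin> T)"

text \<open>Elements of \<open>pcone K\<close> have positive height, so the second assumption also
  says that the cone meets height at most 0 only in the origin. This is what makes \<open>K\<close>
  bounded.\<close>

locale cube_polytope =
  fixes I :: "'i set" and G :: "'i \<Rightarrow> bool \<Rightarrow> 'a::euclidean_space \<times> real" and K :: "'a set"
  assumes cs: "cube_system I G" and pcone_K: "pcone K = hcone I G - {0}"
begin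

lemma mem_K: "x \<in> K \<longleftrightarrow> (\<forall>i\<in>I. \<forall>s. 0 \<le> G i s \<bullet> (x, 1))"
proof -
  have "x \<in> K \<longleftrightarrow> (x, 1) \<in> pcone K" by simp
  then show ?thesis unfolding pcone_K by (simp add: hcone_def zero_prod_def)
qed

lemma finite_I: "finite I" and I_nonempty: "I \<noteq> {}"
  using cs by (auto simp: cube_system_def)

lemma polytope_K: "polytope K"
proof -
  have halfspace: "0 \<le> G i s \<bullet> (x, 1) \<longleftrightarrow> - snd (G i s) \<le> fst (G i s) \<bullet> x" for i s x
    unfolding inner_prod_def fst_conv snd_conv inner_real_def mult_1_right by linarith
  have "K = (\<Inter>c\<in>I \<times> UNIV. {x. fst (G (fst c) (snd c)) \<bullet> x \<ge> - snd (G (fst c) (snd c))})"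
    using halfspace by (auto simp: mem_K)
  also have "polyhedron \<dots>" using finite_I by (intro polyhedron_Inter) (auto simp: polyhedron_halfspace_ge)
  finally have "polyhedron K" .
  moreover have "bounded K"
  proof -
    \<comment> \<open>The height is positive on the cone, hence bounded below by a multiple of the
      norm; at height 1 this bounds the norm.\<close>
    have "0 < (0, 1) \<bullet> z" if "z \<in> hcone I G" "z \<noteq> 0" for z
      using that pcone_K pcone_snd_pos[of z K] by (auto simp: inner_prod_def)
    then obtain \<delta> where \<delta>: "0 < \<delta>" "\<And>z. z \<in> hcone I G \<Longrightarrow> \<delta> * norm z \<le> (0, 1) \<bullet> z"
      using linear_bound_on_cone[OF closed_hcone hcone_scaleR, of I G "(0, 1)"] by metis
    have "norm x \<le> 1 / \<delta>" if "x \<in> K" for x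
    proof -
      have "(x, 1) \<in> hcone I G" using that by (simp add: mem_K hcone_def)
      from \<delta>(2)[OF this] have "\<delta> * norm (x, 1::real) \<le> 1" by simp
      moreover have "norm x \<le> norm (x, 1::real)" using norm_fst_le[of x "1::real"] by simp
      ultimately have "\<delta> * norm x \<le> 1" using \<delta>(1) by (smt (verit) mult_left_mono)
      then show ?thesis using \<delta>(1) by (simp add: field_simps)
    qed
    then show ?thesis by (auto simp: bounded_iff)
  qed
  ultimately show ?thesis by (simp add: polytope_eq_bounded_polyhedron)
qed

lemma convex_K: "convex K"
  by (rule polytope_imp_convex[OF polytope_K])

lemma aff_dim_K: "aff_dim K = int DIM('a)"
  using dim_pcone[of K] dim_eq_DIM_if_interior[OF interior_hcone[OF cs]] by (simp add: pcone_K)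

lemma opposite_not_tight: "x \<in> K \<Longrightarrow> i \<in> I \<Longrightarrow> G i s \<bullet> (x, 1) = 0 \<Longrightarrow> G i (\<not> s) \<bullet> (x, 1) \<noteq> 0"
  using cube_system_opposite[OF cs, of i "(x, 1)" s] by (auto simp: mem_K hcone_def zero_prod_def)

lemma vertex_K:
  obtains x where "x \<in> K" "\<forall>i\<in>I. G i (\<tau> i) \<bullet> (x, 1) = 0"
proof -
  obtain z where z: "z \<in> hcone I G" "z \<noteq> 0" "\<And>i. i \<in> I \<Longrightarrow> G i (\<tau> i) \<bullet> z = 0"
    using cube_system_vertex[OF cs, of \<tau>] by metis
  then have "z \<in> pcone K" by (simp add: pcone_K)
  then obtain x c where "x \<in> K" "0 < c" "z = c *\<^sub>R (x, 1)" by (rule pconeE)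
  moreover from this have "G i (\<tau> i) \<bullet> (x, 1) = 0" if "i \<in> I" for i
    using z(3)[OF that] by (simp del: scaleR_Pair)
  ultimately show ?thesis using that by blast
qed

lemma tight_face_face_of: "T \<subseteq> I \<times> UNIV \<Longrightarrow> tight_face G K T face_of K"
  unfolding face_of_def
proof (intro conjI ballI impI)
  show "tight_face G K T \<subseteq> K" by (auto simp: tight_face_def)
  show "convex (tight_face G K T)"
    using convex_K by (auto simp: tight_face_def convex_def inner_lift_combination split_beta)
next
  fix a b x assume T: "T \<subseteq> I \<times> UNIV" and ab: "a \<in> K" "b \<in> K" and x: "x \<in> tight_face G K T" "x \<in> open_segment a b"
  obtain u where u: "0 < u" "u < 1" "x = (1 - u) *\<^sub>R a + u *\<^sub>R b" using x(2) by (auto simp: in_segment)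
  have "G i s \<bullet> (a, 1) = 0 \<and> G i s \<bullet> (b, 1) = 0" if c: "(i, s) \<in> T" for i s
  proof -
    have 0: "(1 - u) * (G i s \<bullet> (a, 1)) + u * (G i s \<bullet> (b, 1)) = 0"
      using x(1) c unfolding u(3) by (auto simp: tight_face_def inner_lift_combination)
    have 1: "0 \<le> G i s \<bullet> (a, 1)" "0 \<le> G i s \<bullet> (b, 1)" using ab c T by (auto simp: mem_K)
    then have "0 \<le> (1 - u) * (G i s \<bullet> (a, 1))" "0 \<le> u * (G i s \<bullet> (b, 1))" using u by auto
    with 0 have "(1 - u) * (G i s \<bullet> (a, 1)) = 0" "u * (G i s \<bullet> (b, 1)) = 0" by linarith+
    then show ?thesis using u by simp
  qed
  then show "a \<in> tight_face G K T" "b \<in> tight_face G K T" using ab by (auto simp: tight_face_def)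
qed

lemma tight_face_single: "tight_face G K {(i, s)} = {x \<in> K. G i s \<bullet> (x, 1) = 0}"
  by (auto simp: tight_face_def)

text \<open>Averaging points of a nonempty face yields \<open>x\<close> in \<open>X\<close> at which
  every constraint not tight on all of \<open>X\<close> is positive. If \<open>y\<close> satisfies
  the tight constraints, the segment from \<open>y\<close> to \<open>x\<close> can be prolonged
  slightly beyond \<open>x\<close> inside \<open>K\<close>; the face property then puts
  \<open>y\<close> into \<open>X\<close>. For empty \<open>X\<close> every constraint is tight, and
  no point lies on both facets of a pair.\<close>

lemma tight_face_tight_set:
  assumes X: "X face_of K"
  shows "tight_face G K (tight_set G I X) = X"
proof (cases "X = {}")
  case True
  obtain i where "i \<in> I" using I_nonempty by auto
  then show ?thesis using True opposite_not_tight[of _ i True] by (fastforce simp: tight_face_def tight_set_def)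
next
  case False
  have XK: "X \<subseteq> K" and cX: "convex X" using X by (auto simp: face_of_def)
  let ?N = "I \<times> UNIV - tight_set G I X"
  have finN: "finite ?N" using finite_I by simp
  have "\<exists>x\<in>X. \<forall>(i, s)\<in>N. 0 < G i s \<bullet> (x, 1)" if "finite N" "N \<subseteq> ?N" for N
    using that
  proof (induction N)
    case empty
    then show ?case using False by auto
  next
    case (insert c N)
    obtain i s where c: "c = (i, s)" by (cases c)
    obtain x where x: "x \<in> X" "\<forall>(i, s)\<in>N. 0 < G i s \<bullet> (x, 1)" using insert by auto
    have "i \<in> I" "(i, s) \<notin> tight_set G I X" using insert.prems c by auto
    then obtain y where y: "y \<in> X" "G i s \<bullet> (y, 1) \<noteq> 0" by (auto simp: tight_set_def)
    have pos: "0 \<le> G j r \<bullet> (x, 1)" "0 \<le> G j r \<bullet> (y, 1)" if "j \<in> I" for j r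
      using x y XK that mem_K by blast+
    let ?m = "(1/2) *\<^sub>R x + (1/2) *\<^sub>R y"
    have "?m \<in> X" using cX x y by (intro convexD) auto
    moreover have "0 < G j r \<bullet> (?m, 1)" if jr: "(j, r) \<in> insert c N" for j r
    proof -
      have e: "G j r \<bullet> (?m, 1) = 1/2 * (G j r \<bullet> (x, 1)) + 1/2 * (G j r \<bullet> (y, 1))"
        by (rule inner_lift_combination) simp
      have "j \<in> I" using jr insert.prems by auto
      note p = pos[OF this, of r]
      show ?thesis
      proof (cases "(j, r) = c")
        case True
        then show ?thesis using e p y(2) c by auto
      next
        case False
        then have "0 < G j r \<bullet> (x, 1)" using jr x(2) by auto
        then show ?thesis using e p by simp
      qed
    qed
    ultimately show ?case by blast
  qed
  from this[OF finN order_refl] obtain x where x: "x \<in> X" "\<And>i s. (i, s) \<in> ?N \<Longrightarrow> 0 < G i s \<bullet> (x, 1)" by blast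
  show ?thesis
  proof (intro equalityI subsetI)
    fix y assume "y \<in> X"
    then show "y \<in> tight_face G K (tight_set G I X)" using XK by (auto simp: tight_face_def tight_set_def)
  next
    fix y assume y: "y \<in> tight_face G K (tight_set G I X)"
    then have yK: "y \<in> K" by (simp add: tight_face_def)
    show "y \<in> X"
    proof (cases "y = x")
      case False
      have "\<forall>\<^sub>F e in at_right 0. \<forall>c\<in>?N. 0 < (1 + e) * (G (fst c) (snd c) \<bullet> (x, 1)) + (- e) * (G (fst c) (snd c) \<bullet> (y, 1))"
      proof (intro eventually_ball_finite finN ballI)
        fix c assume "c \<in> ?N"
        then have "0 < G (fst c) (snd c) \<bullet> (x, 1)" using x(2)[of "fst c" "snd c"] by simp
        moreover have "((\<lambda>e. (1 + e) * (G (fst c) (snd c) \<bullet> (x, 1)) + (- e) * (G (fst c) (snd c) \<bullet> (y, 1))) \<longlongrightarrow>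
          (1 + 0) * (G (fst c) (snd c) \<bullet> (x, 1)) + (- 0) * (G (fst c) (snd c) \<bullet> (y, 1))) (at_right 0)"
          by (intro tendsto_intros)
        ultimately show "\<forall>\<^sub>F e in at_right 0. 0 < (1 + e) * (G (fst c) (snd c) \<bullet> (x, 1)) + (- e) * (G (fst c) (snd c) \<bullet> (y, 1))"
          by (auto dest: order_tendstoD(1))
      qed
      moreover have "\<forall>\<^sub>F e in at_right (0::real). 0 < e" by (rule eventually_at_right_less)
      ultimately have "\<forall>\<^sub>F e in at_right 0. 0 < e \<and> (\<forall>c\<in>?N. 0 < (1 + e) * (G (fst c) (snd c) \<bullet> (x, 1)) + (- e) * (G (fst c) (snd c) \<bullet> (y, 1)))"
        by eventually_elim auto
      then obtain e where e: "0 < e" "\<forall>c\<in>?N. 0 < (1 + e) * (G (fst c) (snd c) \<bullet> (x, 1)) + (- e) * (G (fst c) (snd c) \<bullet> (y, 1))"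
        using eventually_happens' trivial_limit_at_right_real by blast
      define z where "z = (1 + e) *\<^sub>R x + (- e) *\<^sub>R y"
      have Gz: "G i s \<bullet> (z, 1) = (1 + e) * (G i s \<bullet> (x, 1)) + (- e) * (G i s \<bullet> (y, 1))" for i s
        unfolding z_def by (rule inner_lift_combination) simp
      have "z \<in> K"
        unfolding mem_K
      proof (intro ballI allI)
        fix i s assume i: "i \<in> I"
        show "0 \<le> G i s \<bullet> (z, 1)"
        proof (cases "(i, s) \<in> tight_set G I X")
          case True
          then have "G i s \<bullet> (x, 1) = 0" "G i s \<bullet> (y, 1) = 0"
            using x(1) y by (auto simp: tight_set_def tight_face_def)
          then show ?thesis by (simp add: Gz)
        next
          case False
          then show ?thesis using e(2) i unfolding Gz by force
        qed
      qed
      moreover have "x \<in> open_segment y z"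
      proof -
        have "x = (1 - 1 / (1 + e)) *\<^sub>R y + (1 / (1 + e)) *\<^sub>R z"
          using e(1) unfolding z_def by (simp add: algebra_simps divide_simps flip: scaleR_add_left) 
        moreover have "y \<noteq> z"
        proof
          assume "y = z"
          then have "(1 + e) *\<^sub>R y = (1 + e) *\<^sub>R x" by (simp add: z_def algebra_simps)
          then show False using e(1) False by simp
        qed
        ultimately show ?thesis using e(1) by (auto simp: in_segment intro!: exI[of _ "1 / (1 + e)"])
      qed
      ultimately show ?thesis using X yK x(1) unfolding face_of_def by blast
    qed (use x in simp)
  qed
qed

lemma lattice_set_tight_set: "X \<subseteq> K \<Longrightarrow> lattice_set I (tight_set G I X)"
proof (cases "X = {}")
  case True
  then show ?thesis by (auto simp: lattice_set_def tight_set_def)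
next
  case False
  assume "X \<subseteq> K"
  then show ?thesis using False opposite_not_tight unfolding lattice_set_def tight_set_def by blast
qed

text \<open>This is where the vertices enter: a consistent choice \<open>T\<close> forces no further
  constraint \<open>(j, r)\<close>, since some vertex satisfies \<open>T\<close> and lies on the
  facet opposite to \<open>(j, r)\<close>.\<close>

lemma tight_set_tight_face:
  assumes "lattice_set I T"
  shows "tight_set G I (tight_face G K T) = T"
proof (cases "T = I \<times> UNIV")
  case True
  then have "tight_face G K T = {}" using I_nonempty opposite_not_tight by (fastforce simp: tight_face_def)
  then show ?thesis using True by (auto simp: tight_set_def)
next
  case False
  then have T: "T \<subseteq> I \<times> UNIV" "\<And>i s. (i, s) \<in> T \<Longrightarrow> (i, \<not> s) \<notin> T" using assms by (auto simp: lattice_set_def)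
  have "(j, r) \<in> T" if jr: "(j, r) \<in> tight_set G I (tight_face G K T)" for j r
  proof (rule ccontr)
    assume n: "(j, r) \<notin> T"
    \<comment> \<open>The vertex follows \<open>T\<close> where \<open>T\<close> chooses, takes the
      arbitrary value \<open>False\<close> where it does not, and takes the opposite of
      \<open>r\<close> at \<open>j\<close>; should \<open>T\<close> choose at \<open>j\<close>, it
      also chooses the opposite of \<open>r\<close>.\<close>
    define \<tau> where "\<tau> i = (if i = j then \<not> r else (i, True) \<in> T)" for i
    obtain x where x: "x \<in> K" "\<forall>i\<in>I. G i (\<tau> i) \<bullet> (x, 1) = 0" by (rule vertex_K)
    have "s = \<tau> i" if "(i, s) \<in> T" for i s
      using that T(2)[OF that] n by (cases s; cases r) (auto simp: \<tau>_def)
    then have "x \<in> tight_face G K T" using x T(1) by (auto simp: tight_face_def)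
    then have "G j r \<bullet> (x, 1) = 0" "j \<in> I" using jr by (auto simp: tight_set_def)
    then show False using x opposite_not_tight[of x j r] by (auto simp: \<tau>_def)
  qed
  moreover have "T \<subseteq> tight_set G I (tight_face G K T)" using T(1) by (auto simp: tight_set_def tight_face_def)
  ultimately show ?thesis by auto
qed

lemma face_subset_iff:
  assumes "X face_of K" "Y face_of K"
  shows "X \<subseteq> Y \<longleftrightarrow> tight_set G I Y \<subseteq> tight_set G I X"
proof
  assume "tight_set G I Y \<subseteq> tight_set G I X"
  then have "tight_face G K (tight_set G I X) \<subseteq> tight_face G K (tight_set G I Y)"
    by (auto simp: tight_face_def)
  then show "X \<subseteq> Y" using assms by (simp add: tight_face_tight_set)
qed (auto simp: tight_set_def)

end

text \<open>Both face lattices are anti-isomorphic to the sets satisfying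
  \<open>lattice_set I\<close>, an order that depends on \<open>I\<close> only. The second
  conclusion, that labelled facets correspond, is what identifies opposite facets.\<close>

lemma cube_polytope_face_lattice_iso:
  fixes G :: "'i \<Rightarrow> bool \<Rightarrow> 'a::euclidean_space \<times> real" and G' :: "'i \<Rightarrow> bool \<Rightarrow> 'b::euclidean_space \<times> real"
  assumes "cube_polytope I G K" "cube_polytope I G' K'"
  obtains f where "face_lattice_iso f K K'"
    "\<forall>i\<in>I. \<forall>s. f (tight_face G K {(i, s)}) = tight_face G' K' {(i, s)}"
proof -
  interpret A: cube_polytope I G K by fact
  interpret B: cube_polytope I G' K' by fact
  define f where "f X = tight_face G' K' (tight_set G I X)" for X
  define f' where "f' Y = tight_face G K (tight_set G' I Y)" for Y
  have face: "f X face_of K'" for X unfolding f_def by (rule B.tight_face_face_of) (auto simp: tight_set_def)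
  have face': "f' X face_of K" for X unfolding f'_def by (rule A.tight_face_face_of) (auto simp: tight_set_def)
  have ts: "tight_set G' I (f X) = tight_set G I X" if "X face_of K" for X
    using A.lattice_set_tight_set[OF face_of_imp_subset[OF that]] unfolding f_def
    by (rule B.tight_set_tight_face)
  have ts': "tight_set G I (f' Y) = tight_set G' I Y" if "Y face_of K'" for Y
    using B.lattice_set_tight_set[OF face_of_imp_subset[OF that]] unfolding f'_def
    by (rule A.tight_set_tight_face)
  have "bij_betw f {F. F face_of K} {G. G face_of K'}"
  proof (rule bij_betw_byWitness[where f' = f'])
    show "\<forall>X\<in>{F. F face_of K}. f' (f X) = X" using ts A.tight_face_tight_set by (simp add: f'_def)
    show "\<forall>Y\<in>{G. G face_of K'}. f (f' Y) = Y" using ts' B.tight_face_tight_set by (simp add: f_def)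
  qed (use face face' in auto)
  moreover have "f X \<subseteq> f Y \<longleftrightarrow> X \<subseteq> Y" if "X face_of K" "Y face_of K" for X Y
    using that by (simp add: A.face_subset_iff B.face_subset_iff[OF face face] ts)
  ultimately have "face_lattice_iso f K K'" by (auto simp: face_lattice_iso_def)
  moreover have "f (tight_face G K {(i, s)}) = tight_face G' K' {(i, s)}" if "i \<in> I" for i s
  proof -
    have "lattice_set I {(i, s)}" using that by (auto simp: lattice_set_def)
    then show ?thesis by (simp add: f_def A.tight_set_tight_face)
  qed
  ultimately show ?thesis using that by blast
qed

section \<open>The standard cube as a model, and opposite facets\<close>

lemma std_cube_Basis: "std_cube Basis = {x::'a::euclidean_space. \<forall>i\<in>Basis. 0 \<le> x \<bullet> i \<and> x \<bullet> i \<le> 1}"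
  by (auto simp: std_cube_def mem_box inner_sum_left inner_Basis sum.delta cong: if_cong)

text \<open>The parameter \<open>s\<close> decides which label gets \<open>x . i = 0\<close>, so
  that either facet of a pair can be matched with the bottom of the standard cube.\<close>

lemma cube_polytope_std_cube:
  fixes G :: "'a::euclidean_space \<Rightarrow> bool \<Rightarrow> 'a \<times> real"
  assumes G: "G = (\<lambda>i r. if r = s then (i, 0) else (- i, 1))"
  shows "cube_polytope Basis G (std_cube Basis)"
proof
  have h: "(w, r) \<in> hcone Basis G \<longleftrightarrow> (\<forall>i\<in>Basis. 0 \<le> w \<bullet> i \<and> w \<bullet> i \<le> r)" for w r
  proof -
    have "(\<forall>q. 0 \<le> G i q \<bullet> (w, r)) \<longleftrightarrow> 0 \<le> w \<bullet> i \<and> w \<bullet> i \<le> r" for i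
      by (cases s) (auto simp: G all_bool_eq inner_commute)
    then show ?thesis by (simp add: hcone_def)
  qed
  have z: "(w, r) = 0" if "(w, r) \<in> hcone Basis G" "r \<le> 0" for w r
  proof -
    obtain i :: 'a where i: "i \<in> Basis" using nonempty_Basis by blast
    then have "r = 0" using that h by force
    then have "w \<bullet> i = 0" if "i \<in> Basis" for i using h \<open>(w, r) \<in> hcone Basis G\<close> that by force
    then show ?thesis using \<open>r = 0\<close> by (metis euclidean_all_zero_iff zero_prod_def)
  qed
  show "cube_system Basis G"
    unfolding cube_system_def
  proof (intro conjI ballI impI)
    have "(0, 1) \<in> hcone Basis G" by (simp add: h)
    then show "\<exists>z\<in>hcone Basis G. z \<noteq> 0" by (metis snd_conv snd_zero zero_neq_one)
  next
    fix i y assume i: "i \<in> (Basis::'a set)" and y: "y \<in> hcone Basis G" "G i False \<bullet> y = 0" "G i True \<bullet> y = 0"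
    obtain w r where [simp]: "y = (w, r)" by (cases y)
    have "r = 0" using y(2,3) by (cases s) (auto simp: G)
    then show "y = 0" using z y(1) by simp
  qed auto
  show "pcone (std_cube Basis) = hcone Basis G - {0}"
  proof (intro set_eqI iffI)
    fix y :: "'a \<times> real" assume y: "y \<in> pcone (std_cube Basis)"
    obtain w r where [simp]: "y = (w, r)" by (cases y)
    show "y \<in> hcone Basis G - {0}" using y by (auto simp: h pcone_def std_cube_Basis zero_prod_def field_simps)
  next
    fix y :: "'a \<times> real" assume y: "y \<in> hcone Basis G - {0}"
    obtain w r where [simp]: "y = (w, r)" by (cases y)
    have "0 < r" using z[of w r] y by force
    then show "y \<in> pcone (std_cube Basis)" using y by (auto simp: h pcone_def std_cube_Basis field_simps)
  qed
qed

lemma combinatorial_cube_cube_polytope: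
  fixes G :: "'a::euclidean_space \<Rightarrow> bool \<Rightarrow> 'a \<times> real"
  assumes "cube_polytope Basis G K"
  shows "combinatorial_cube DIM('a) K"
proof -
  interpret cube_polytope Basis G K by fact
  obtain f where "face_lattice_iso f K (std_cube Basis :: 'a set)"
    by (rule cube_polytope_face_lattice_iso[OF assms cube_polytope_std_cube[OF refl]])
  then show ?thesis
    using polytope_K aff_dim_K
    unfolding combinatorial_cube_def combinatorially_equivalent_def by blast
qed

lemma opposite_facets_cube_polytope:
  fixes G :: "'a::euclidean_space \<Rightarrow> bool \<Rightarrow> 'a \<times> real"
  assumes "cube_polytope Basis G K" and j: "j \<in> Basis"
    and facets: "tight_face G K {(j, s)} facet_of K" "tight_face G K {(j, \<not> s)} facet_of K"
  shows "opposite_facets K (tight_face G K {(j, s)}) (tight_face G K {(j, \<not> s)})"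
proof -
  interpret cube_polytope Basis G K by fact
  define G' :: "'a \<Rightarrow> bool \<Rightarrow> 'a \<times> real" where "G' = (\<lambda>i r. if r = s then (i, 0) else (- i, 1))"
  obtain f where f: "face_lattice_iso f K (std_cube Basis :: 'a set)"
    "\<forall>i\<in>Basis. \<forall>r. f (tight_face G K {(i, r)}) = tight_face G' (std_cube Basis) {(i, r)}"
    by (rule cube_polytope_face_lattice_iso[OF assms(1) cube_polytope_std_cube[OF G'_def]])
  have "tight_face G' (std_cube Basis) {(j, s)} = {x \<in> std_cube Basis. x \<bullet> j = 0}"
    "tight_face G' (std_cube Basis) {(j, \<not> s)} = {x \<in> std_cube Basis. x \<bullet> j = 1}"
    by (auto simp: tight_face_def G'_def inner_commute)
  with f j have "f (tight_face G K {(j, s)}) = {x \<in> std_cube Basis. x \<bullet> j = 0}"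
    "f (tight_face G K {(j, \<not> s)}) = {x \<in> std_cube Basis. x \<bullet> j = 1}" by simp_all
  with f(1) j facets show ?thesis
    unfolding opposite_facets_def by (intro conjI exI[of _ f] exI[of _ Basis] exI[of _ j]) simp_all
qed

subsection \<open>Gluing along a facet\<close>

text \<open>The contragredient action: a functional is transported so that its value at
  \<open>L z\<close> is the old value at \<open>z\<close>.\<close>

definition push :: "('w::euclidean_space \<Rightarrow> 'w) \<Rightarrow> 'w \<Rightarrow> 'w" where
  "push L v = adjoint (inv L) v"

lemma linear_inv_bij:
  fixes L :: "'w::euclidean_space \<Rightarrow> 'w"
  assumes "linear L" "bij L"
  shows "linear (inv L)"
  using assms by (simp add: bij_is_inj bij_is_surj inj_linear_imp_inv_linear)

lemma push_inner:
  fixes L :: "'w::euclidean_space \<Rightarrow> 'w"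
  assumes "linear L" "bij L"
  shows "push L v \<bullet> L z = v \<bullet> z"
proof -
  have "L z \<bullet> push L v = inv L (L z) \<bullet> v"
    unfolding push_def by (rule adjoint_works[OF linear_inv_bij[OF assms]])
  then show ?thesis using assms(2) by (simp add: bij_is_inj inner_commute)
qed

lemma hcone_push:
  fixes L :: "'w::euclidean_space \<Rightarrow> 'w"
  assumes "linear L" "bij L"
  shows "hcone I (\<lambda>i s. push L (g i s)) = L ` hcone I g"
proof -
  have "L z \<in> hcone I (\<lambda>i s. push L (g i s)) \<longleftrightarrow> z \<in> hcone I g" for z
    by (simp add: hcone_def push_inner[OF assms])
  then have "hcone I g = L -` hcone I (\<lambda>i s. push L (g i s))" by auto
  then show ?thesis using assms(2) by (simp add: surj_image_vimage_eq bij_is_surj)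
qed

lemma linear_inj_eq_0:
  assumes "linear L" "inj L"
  shows "L z = 0 \<longleftrightarrow> z = 0"
  using assms linear_0 by (metis injD)

lemma cube_system_push:
  fixes L :: "'w::euclidean_space \<Rightarrow> 'w"
  assumes "linear L" "bij L" "cube_system I g"
  shows "cube_system I (\<lambda>i s. push L (g i s))"
  using assms(3) unfolding cube_system_def hcone_push[OF assms(1,2)]
  by (auto simp: push_inner[OF assms(1,2)] linear_inj_eq_0[OF assms(1) bij_is_inj[OF assms(2)]])

lemma cube_polytope_push:
  fixes L :: "'a::euclidean_space \<times> real \<Rightarrow> 'a \<times> real"
  assumes L: "linear L" "bij L" and K: "cube_polytope I G K" and K': "pcone K' = L ` pcone K"
  shows "cube_polytope I (\<lambda>i s. push L (G i s)) K'"
proof -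
  interpret cube_polytope I G K by fact
  have "L ` (hcone I G - {0}) = L ` hcone I G - {0}"
    using L by (auto simp: linear_inj_eq_0[OF L(1) bij_is_inj[OF L(2)]] )
  then show ?thesis
    using cube_system_push[OF L cs] K' pcone_K hcone_push[OF L, of I G]
    by (intro cube_polytope.intro) simp_all
qed

text \<open>\<open>h\<close> exposes the facet \<open>F\<close> of \<open>P\<close>, and \<open>S\<close> is a linear copy of the cone over \<open>F\<close>.\<close>

definition facet_chart :: "'a::euclidean_space set \<Rightarrow> 'a set \<Rightarrow> 'a \<times> real \<Rightarrow> 'a set \<Rightarrow> bool" where
  "facet_chart S F h P \<longleftrightarrow> polytope P \<and> h \<noteq> 0 \<and> (\<forall>x\<in>P. 0 \<le> h \<bullet> (x, 1)) \<and> F = {x\<in>P. h \<bullet> (x, 1) = 0} \<and>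
     (\<exists>\<Lambda>. linear \<Lambda> \<and> inj \<Lambda> \<and> (\<forall>z. h \<bullet> \<Lambda> z = 0) \<and> \<Lambda> ` S = pcone F)"

lemma facet_chartD:
  assumes "facet_chart S F h P"
  shows "polytope P" "h \<noteq> 0" "x \<in> P \<Longrightarrow> 0 \<le> h \<bullet> (x, 1)" "x \<in> F \<longleftrightarrow> x \<in> P \<and> h \<bullet> (x, 1) = 0"
  using assms by (auto simp: facet_chart_def)

lemma facet_chart_nonneg: "facet_chart S F h P \<Longrightarrow> y \<in> pcone P \<Longrightarrow> 0 \<le> h \<bullet> y"
  by (erule pconeE) (simp add: facet_chartD(3) del: scaleR_Pair)

lemma facet_chart_zero:
  assumes "facet_chart S F h P"
  shows "y \<in> pcone F \<longleftrightarrow> y \<in> pcone P \<and> h \<bullet> y = 0"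
proof -
  have "F = {x\<in>P. h \<bullet> (x, 1) = 0}" using assms by (simp add: facet_chart_def)
  then show ?thesis using pcone_hyperplane[of P h] by blast
qed

lemma facet_chartE:
  assumes "facet_chart S F h P"
  obtains \<Lambda> where "linear \<Lambda>" "inj \<Lambda>" "\<forall>z. h \<bullet> \<Lambda> z = 0" "\<Lambda> ` S = pcone F"
  using assms by (auto simp: facet_chart_def)

lemma facet_chart_nonempty: "facet_chart S F h P \<Longrightarrow> S \<noteq> {} \<Longrightarrow> F \<noteq> {}"
  by (elim facet_chartE) (auto simp: pcone_def)

lemma facet_chart_face_of:
  assumes "facet_chart S F h P"
  shows "F face_of P"
proof -
  have e: "h \<bullet> (x, 1) = fst h \<bullet> x + snd h" for x by (simp add: inner_prod_def)
  have "P \<inter> {x. fst h \<bullet> x = - snd h} face_of P"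
    using facet_chartD[OF assms] e
    by (intro face_of_Int_supporting_hyperplane_ge polytope_imp_convex) (auto, smt (verit))
  moreover have "F = P \<inter> {x. fst h \<bullet> x = - snd h}"
    using facet_chartD(4)[OF assms] e by (auto simp: eq_neg_iff_add_eq_0)
  ultimately show ?thesis by simp
qed

text \<open>The cone over \<open>F\<close> is an injective linear image of \<open>S\<close>, which
  has interior points. Hence it has full dimension \<open>DIM('a)\<close>, and \<open>F\<close> has
  affine dimension one less.\<close>

lemma facet_chart_facet_of:
  fixes P :: "'a::euclidean_space set"
  assumes "facet_chart S F h P" "interior S \<noteq> {}" "aff_dim P = int DIM('a)"
  shows "F facet_of P"
proof -
  obtain \<Lambda> where L: "linear \<Lambda>" "inj \<Lambda>" "\<Lambda> ` S = pcone F" using assms(1) by (rule facet_chartE)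
  have "dim (pcone F) = DIM('a)"
    using dim_image_eq[OF L(1), of S] L dim_eq_DIM_if_interior[OF assms(2)] by (simp add: inj_on_subset)
  then have "aff_dim F = aff_dim P - 1" using dim_pcone[of F] assms(3) by simp
  moreover have "F \<noteq> {}" using facet_chart_nonempty[OF assms(1)] assms(2) interior_subset by blast
  ultimately show ?thesis using facet_chart_face_of[OF assms(1)] by (simp add: facet_of_def)
qed

lemma range_eq_hyperplane:
  fixes \<Lambda> :: "'a::euclidean_space \<Rightarrow> 'a \<times> real"
  assumes "linear \<Lambda>" "inj \<Lambda>" "\<forall>z. h \<bullet> \<Lambda> z = 0" "h \<noteq> 0"
  shows "range \<Lambda> = {y. h \<bullet> y = 0}"
proof (rule subspace_dim_equal)
  show "subspace (range \<Lambda>)" using assms(1) by (simp add: linear_subspace_image)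
  show "subspace {y. h \<bullet> y = 0}" by (rule subspace_hyperplane)
  have "dim (range \<Lambda>) = DIM('a)" using dim_image_eq[OF assms(1), of UNIV] assms(2) by (simp add: inj_on_subset)
  then show "dim {y. h \<bullet> y = 0} \<le> dim (range \<Lambda>)" using dim_hyperplane[OF assms(4)] by simp
qed (use assms in auto)

text \<open>
  A segment from a point of \<open>G\<close> to a point of \<open>P\<close> on the wrong side of the hyperplane of \<open>G\<close> would,
  by connectedness, contain a point of \<open>P \<inter> Q\<close> lying in \<open>G\<close>.
\<close>

lemma facet_chart_Un:
  assumes G: "facet_chart S G k Q" and P: "polytope P" and conv: "convex (P \<union> Q)"
    and disj: "P \<inter> Q \<inter> G = {}" and ne: "G \<noteq> {}"
  shows "x \<in> P \<Longrightarrow> 0 < k \<bullet> (x, 1)" "polytope (P \<union> Q) \<Longrightarrow> facet_chart S G k (P \<union> Q)"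
proof -
  have *: "0 < k \<bullet> (p, 1)" if p: "p \<in> P" for p
  proof (rule ccontr)
    assume neg: "\<not> 0 < k \<bullet> (p, 1)"
    obtain b where b: "b \<in> G" using ne by blast
    then have bQ: "b \<in> Q" "k \<bullet> (b, 1) = 0" using facet_chartD(4)[OF G] by auto
    let ?s = "closed_segment b p"
    have sub: "?s \<subseteq> P \<union> Q" using conv p bQ by (meson UnCI closed_segment_subset)
    have "P \<inter> Q \<inter> ?s \<noteq> {}"
    proof
      assume "P \<inter> Q \<inter> ?s = {}"
      moreover have "closed P" "closed Q" using P facet_chartD(1)[OF G] by (auto simp: polytope_imp_closed)
      moreover have "p \<in> P \<inter> ?s" "b \<in> Q \<inter> ?s" using p bQ by auto
      moreover have "connected ?s" by simp
      ultimately show False using sub unfolding connected_closed by blast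
    qed
    then obtain q where q: "q \<in> P" "q \<in> Q" "q \<in> ?s" by blast
    then obtain u where u: "0 \<le> u" "u \<le> 1" "q = (1 - u) *\<^sub>R b + u *\<^sub>R p" by (auto simp: in_segment)
    have "k \<bullet> (q, 1) = u * (k \<bullet> (p, 1))" unfolding u(3) by (simp add: inner_lift_combination bQ)
    also have "\<dots> \<le> 0" using neg u by (simp add: mult_nonneg_nonpos)
    finally have "q \<in> G" using facet_chartD(3,4)[OF G, of q] q by auto
    then show False using disj q by blast
  qed
  then show "x \<in> P \<Longrightarrow> 0 < k \<bullet> (x, 1)" .
  show "facet_chart S G k (P \<union> Q)" if "polytope (P \<union> Q)"
  proof -
    have "G = {x \<in> P \<union> Q. k \<bullet> (x, 1) = 0}" using * facet_chartD(4)[OF G] by fastforce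
    moreover have "\<forall>x\<in>P \<union> Q. 0 \<le> k \<bullet> (x, 1)" using * facet_chartD(3)[OF G] by fastforce
    ultimately show ?thesis using G that unfolding facet_chart_def by blast
  qed
qed

lemma polytope_Un:
  assumes "polytope A" "polytope B" "convex (A \<union> B)"
  shows "polytope (A \<union> B)"
proof -
  obtain V W where V: "finite V" "A = convex hull V" and W: "finite W" "B = convex hull W"
    using assms by (auto simp: polytope_def)
  have "convex hull (V \<union> W) \<subseteq> A \<union> B" using V W assms(3) by (intro hull_minimal) (auto simp: hull_inc)
  moreover have "A \<union> B \<subseteq> convex hull (V \<union> W)" using V W by (auto intro: hull_mono[THEN subsetD])
  ultimately show ?thesis using V W unfolding polytope_def by (intro exI[of _ "V \<union> W"]) auto
qed

lemma facet_chart_push: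
  fixes L :: "'a::euclidean_space \<times> real \<Rightarrow> 'a \<times> real"
  assumes L: "linear L" "bij L" and G: "facet_chart S G k Q" and Q': "pcone Q' = L ` pcone Q"
    and G': "G' = {x\<in>Q'. push L k \<bullet> (x, 1) = 0}"
  shows "facet_chart S G' (push L k) Q'" "pcone G' = L ` pcone G"
proof -
  have pos: "0 \<le> push L k \<bullet> y" if "y \<in> pcone Q'" for y
    using that facet_chart_nonneg[OF G] unfolding Q' by (auto simp: push_inner[OF L])
  have "pcone G' = {y \<in> L ` pcone Q. push L k \<bullet> y = 0}" unfolding G' pcone_hyperplane Q' ..
  also have "\<dots> = L ` {y \<in> pcone Q. k \<bullet> y = 0}" using push_inner[OF L, of k] by (auto simp del: split_paired_All)
  also have "{y \<in> pcone Q. k \<bullet> y = 0} = pcone G" using facet_chart_zero[OF G] by blast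
  finally show pG: "pcone G' = L ` pcone G" .
  obtain \<Lambda> where \<Lambda>: "linear \<Lambda>" "inj \<Lambda>" "\<forall>z. k \<bullet> \<Lambda> z = 0" "\<Lambda> ` S = pcone G" using G by (rule facet_chartE)
  have "\<exists>\<Lambda>. linear \<Lambda> \<and> inj \<Lambda> \<and> (\<forall>z. push L k \<bullet> \<Lambda> z = 0) \<and> \<Lambda> ` S = pcone G'"
    using \<Lambda> L pG linear_compose[OF \<Lambda>(1) L(1)] inj_compose[OF bij_is_inj[OF L(2)] \<Lambda>(2)]
    by (intro exI[of _ "L \<circ> \<Lambda>"]) (simp add: push_inner[OF L] image_comp[symmetric] del: comp_apply, simp add: push_inner[OF L])
  moreover have "push L k \<noteq> 0"
  proof
    assume "push L k = 0"
    then have "k \<bullet> z = 0" for z using push_inner[OF L, of k z] by simp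
    then show False using facet_chartD(2)[OF G] by (metis inner_eq_zero_iff)
  qed
  ultimately show "facet_chart S G' (push L k) Q'"
    using pos[of "(_, 1)"] polytope_pcone_linear_image[OF facet_chartD(1)[OF G] L(1) Q'] G'
    unfolding facet_chart_def by auto
qed

text \<open>
  For \<open>L y = \<Lambda>1 (\<Gamma> y) + k(y) (a + N q)\<close> with \<open>q\<close> interior to the facet cone and \<open>N\<close> large, every vector
  \<open>k(w) x + h(x) L w\<close>, which is where the segment from \<open>x\<close> to \<open>L w\<close> crosses the hyperplane of the facet,
  lies in the cone over the facet. The vector is affine in both \<open>x\<close> and \<open>w\<close>, so
  it suffices to achieve this for the finitely many pairs of vertices.
\<close>

lemma glue_polytopes:
  fixes P Q :: "'a::euclidean_space set"
  assumes F: "facet_chart S F h P" and G: "facet_chart S G k Q" and int: "interior S \<noteq> {}"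
  obtains L Q' where "linear L" "bij L" "pcone Q' = L ` pcone Q" "pcone F = L ` pcone G"
    "convex (P \<union> Q')" "\<forall>y. h \<bullet> L y = - (k \<bullet> y)"
proof -
  obtain \<Lambda>1 where \<Lambda>1: "linear \<Lambda>1" "inj \<Lambda>1" "\<forall>z. h \<bullet> \<Lambda>1 z = 0" "\<Lambda>1 ` S = pcone F" using F by (rule facet_chartE)
  obtain \<Lambda>2 where \<Lambda>2: "linear \<Lambda>2" "inj \<Lambda>2" "\<forall>z. k \<bullet> \<Lambda>2 z = 0" "\<Lambda>2 ` S = pcone G" using G by (rule facet_chartE)
  \<comment> \<open>On the hyperplane of \<open>G\<close> the map
    \<open>\<Lambda>1 \<circ> \<Gamma>\<close> matches the two facet cones. Off that hyperplane
    \<open>\<Gamma>\<close> is uncontrolled; the large multiple of \<open>q\<close> makes up for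
    it.\<close>
  obtain \<Gamma> where \<Gamma>: "linear \<Gamma>" "\<Gamma> \<circ> \<Lambda>2 = id" using linear_injective_left_inverse[OF \<Lambda>2(1,2)] by blast
  have h0: "h \<noteq> 0" and k0: "k \<noteq> 0" using F G by (auto simp: facet_chart_def)
  note r1 = range_eq_hyperplane[OF \<Lambda>1(1-3) h0] and r2 = range_eq_hyperplane[OF \<Lambda>2(1-3) k0]
  obtain s0 where s0: "s0 \<in> interior S" using int by blast
  \<comment> \<open>The value \<open>h . a = -1\<close> gives \<open>h . L y = - (k . y)\<close>, so
    the image of \<open>Q\<close> lies on the side of the hyperplane away from
    \<open>P\<close>.\<close>
  define a where "a = (- 1 / (h \<bullet> h)) *\<^sub>R h"
  have ha: "h \<bullet> a = -1" using h0 by (simp add: a_def)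
  define q where "q = \<Lambda>1 s0"
  have hq: "h \<bullet> q = 0" using \<Lambda>1(3) by (simp add: q_def)
  have "q \<in> pcone F" using s0 interior_subset \<Lambda>1(4) by (auto simp: q_def)
  then have q0: "0 < snd q" by (rule pcone_snd_pos)
  have cF: "convex F" by (rule face_of_imp_convex[OF facet_chart_face_of[OF F]])
  define L where "L N y = \<Lambda>1 (\<Gamma> y) + (k \<bullet> y) *\<^sub>R (a + N *\<^sub>R q)" for N y
  have linL: "linear (L N)" for N
    by (rule linearI) (auto simp: L_def linear_add[OF \<Gamma>(1)] linear_add[OF \<Lambda>1(1)] linear_cmul[OF \<Gamma>(1)]
        linear_cmul[OF \<Lambda>1(1)] inner_add_right algebra_simps)
  have hL: "h \<bullet> L N y = - (k \<bullet> y)" for N y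
    using \<Lambda>1(3) ha hq by (simp add: L_def inner_add_right)
  have L\<Lambda>: "L N (\<Lambda>2 z) = \<Lambda>1 z" for N z
    using \<Lambda>2(3) \<Gamma>(2) by (simp add: L_def pointfree_idE)
  have "y = 0" if "L N y = 0" for N y
  proof -
    have "k \<bullet> y = 0" using hL[of N y] that by simp
    then obtain z where z: "y = \<Lambda>2 z" using r2 by blast
    then have "\<Lambda>1 z = 0" using L\<Lambda> that by metis
    then have "z = 0" using \<Lambda>1 linear_inj_eq_0 by blast
    then show ?thesis using z \<Lambda>2(1) linear_0 by blast
  qed
  then have "inj (L N)" for N using linL by (metis linear_injective_0)
  then have bijL: "bij (L N)" for N using linL by (simp add: bij_def linear_injective_imp_surjective)
  have LG: "L N ` pcone G = pcone F" for N
    unfolding \<Lambda>2(4)[symmetric] \<Lambda>1(4)[symmetric] image_image L\<Lambda> ..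

  \<comment> \<open>After division by \<open>N\<close> the vector is the image of \<open>s0\<close>
    plus a term tending to 0, hence eventually of an interior point of \<open>S\<close>.\<close>
  have absorb: "\<forall>\<^sub>F N in at_top. z + N *\<^sub>R q \<in> pcone F" if z: "h \<bullet> z = 0" for z
  proof -
    obtain x where x: "z = \<Lambda>1 x" using z r1 by blast
    have "((\<lambda>N. s0 + inverse N *\<^sub>R x) \<longlongrightarrow> s0 + 0 *\<^sub>R x) at_top"
      by (intro tendsto_intros tendsto_inverse_0_at_top filterlim_ident)
    then have "\<forall>\<^sub>F N in at_top. s0 + inverse N *\<^sub>R x \<in> interior S"
      using s0 topological_tendstoD[of _ s0 at_top "interior S"] by simp
    moreover have "\<forall>\<^sub>F N in at_top. (0::real) < N" by (rule eventually_gt_at_top)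
    ultimately show ?thesis
    proof eventually_elim
      case (elim N)
      then have "\<Lambda>1 (s0 + inverse N *\<^sub>R x) \<in> pcone F" using interior_subset \<Lambda>1(4) by blast
      then have "N *\<^sub>R \<Lambda>1 (s0 + inverse N *\<^sub>R x) \<in> pcone F" using elim by (intro pcone_scaleR)
      also have "N *\<^sub>R \<Lambda>1 (s0 + inverse N *\<^sub>R x) = z + N *\<^sub>R q"
        using elim by (simp add: x q_def linear_add[OF \<Lambda>1(1)] linear_cmul[OF \<Lambda>1(1)] scaleR_add_right)
      finally show ?case .
    qed
  qed

  obtain V where V: "finite V" "P = convex hull V" using facet_chartD(1)[OF F] by (auto simp: polytope_def)
  obtain W where W: "finite W" "Q = convex hull W" using facet_chartD(1)[OF G] by (auto simp: polytope_def)
  have VP: "v \<in> V \<Longrightarrow> v \<in> P" and WQ: "w \<in> W \<Longrightarrow> w \<in> Q" for v w using V W by (auto simp: hull_inc)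
  define \<Phi> where "\<Phi> N x w = (k \<bullet> (w, 1)) *\<^sub>R (x, 1) + (h \<bullet> (x, 1)) *\<^sub>R L N (w, 1)" for N x w
  have ev1: "\<forall>\<^sub>F N in at_top. 0 < h \<bullet> (v, 1) \<longrightarrow> 0 < k \<bullet> (w, 1) \<longrightarrow> \<Phi> N v w \<in> pcone F" for v w
  proof (cases "0 < h \<bullet> (v, 1) \<and> 0 < k \<bullet> (w, 1)")
    case True
    \<comment> \<open>The coefficient of \<open>q\<close> in \<open>\<Phi> N v w\<close> is
      \<open>c * N\<close>; dividing by \<open>c\<close> brings the vector into the form treated by
      \<open>absorb\<close>.\<close>
    define c where "c = (h \<bullet> (v, 1)) * (k \<bullet> (w, 1))"
    define z where "z = (k \<bullet> (w, 1)) *\<^sub>R (v, 1) + (h \<bullet> (v, 1)) *\<^sub>R (\<Lambda>1 (\<Gamma> (w, 1)) + (k \<bullet> (w, 1)) *\<^sub>R a)"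
    have c: "0 < c" using True by (simp add: c_def)
    have "h \<bullet> (inverse c *\<^sub>R z) = 0"
      unfolding z_def inner_scaleR_right inner_add_right using \<Lambda>1(3) ha by simp
    from absorb[OF this] show ?thesis
    proof eventually_elim
      case (elim N)
      then have "c *\<^sub>R (inverse c *\<^sub>R z + N *\<^sub>R q) \<in> pcone F" using c by (intro pcone_scaleR)
      also have "c *\<^sub>R (inverse c *\<^sub>R z + N *\<^sub>R q) = z + (c * N) *\<^sub>R q" using c by (simp add: scaleR_add_right)
      also have "\<dots> = \<Phi> N v w"
        unfolding \<Phi>_def z_def L_def c_def by (simp only: scaleR_add_right scaleR_scaleR add.assoc mult.assoc)
      finally show ?case by simp
    qed
  qed auto
  \<comment> \<open>The image of \<open>Q\<close> must also have positive denominators; since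
    \<open>q\<close> has positive height, this holds for large \<open>N\<close> too.\<close>
  have ev2: "\<forall>\<^sub>F N in at_top. 0 < k \<bullet> (w, 1) \<longrightarrow> 0 < snd (L N (w, 1))" for w
  proof (cases "0 < k \<bullet> (w, 1)")
    case True
    define z where "z = snd (\<Lambda>1 (\<Gamma> (w, 1)) + (k \<bullet> (w, 1)) *\<^sub>R a)"
    have e: "snd (L N (w, 1)) = z + N * ((k \<bullet> (w, 1)) * snd q)" for N
      by (simp add: L_def z_def algebra_simps)
    have pos: "0 < (k \<bullet> (w, 1)) * snd q" using True q0 by simp
    have "\<forall>\<^sub>F N in at_top. - z / ((k \<bullet> (w, 1)) * snd q) < N" by (rule eventually_gt_at_top)
    then show ?thesis
    proof eventually_elim
      case (elim N)
      then have "- z < N * ((k \<bullet> (w, 1)) * snd q)" using pos_divide_less_eq[OF pos] by blast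
      then show ?case unfolding e by simp
    qed
  qed auto
  have "\<forall>\<^sub>F N in at_top. (\<forall>v\<in>V. \<forall>w\<in>W. 0 < h \<bullet> (v, 1) \<longrightarrow> 0 < k \<bullet> (w, 1) \<longrightarrow> \<Phi> N v w \<in> pcone F)"
    using ev1 V W by (intro eventually_ball_finite ballI) auto
  moreover have "\<forall>\<^sub>F N in at_top. \<forall>w\<in>W. 0 < k \<bullet> (w, 1) \<longrightarrow> 0 < snd (L N (w, 1))"
    using ev2 W by (intro eventually_ball_finite ballI) auto
  ultimately have "\<forall>\<^sub>F N in at_top. (\<forall>v\<in>V. \<forall>w\<in>W. 0 < h \<bullet> (v, 1) \<longrightarrow> 0 < k \<bullet> (w, 1) \<longrightarrow> \<Phi> N v w \<in> pcone F) \<and>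
    (\<forall>w\<in>W. 0 < k \<bullet> (w, 1) \<longrightarrow> 0 < snd (L N (w, 1)))"
    by (rule eventually_conj)
  then obtain N :: real where
    N1: "\<forall>v\<in>V. \<forall>w\<in>W. 0 < h \<bullet> (v, 1) \<longrightarrow> 0 < k \<bullet> (w, 1) \<longrightarrow> \<Phi> N v w \<in> pcone F" and
    N2: "\<forall>w\<in>W. 0 < k \<bullet> (w, 1) \<longrightarrow> 0 < snd (L N (w, 1))"
    using eventually_happens' trivial_limit_at_top_linorder by blast
  have L0: "L N (w, 1) \<in> pcone F" if "w \<in> Q" "k \<bullet> (w, 1) = 0" for w
    using facet_chart_zero[OF G, of "(w, 1)"] that LG[of N] by (metis image_eqI lift_in_pcone)
  have Lcomb: "L N (u *\<^sub>R x + v *\<^sub>R y, 1) = u *\<^sub>R L N (x, 1) + v *\<^sub>R L N (y, 1)" if "u + v = 1" for u v x y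
  proof -
    have "(u *\<^sub>R x + v *\<^sub>R y, 1) = u *\<^sub>R (x, 1::real) + v *\<^sub>R (y, 1)" using that by simp
    then show ?thesis by (simp only: linear_add[OF linL] linear_cmul[OF linL])
  qed
  have sndL: "0 < snd (L N y)" if y: "y \<in> pcone Q" for y
  proof -
    have "convex {x. 0 < snd (L N (x, 1))}"
    proof (rule convexI)
      fix x y :: 'a and u v :: real
      assume "x \<in> {x. 0 < snd (L N (x, 1))}" "y \<in> {x. 0 < snd (L N (x, 1))}" "0 \<le> u" "0 \<le> v" and uv: "u + v = 1"
      then have "0 < u * snd (L N (x, 1)) + v * snd (L N (y, 1))"
        by (cases "u = 0") (auto intro: add_pos_nonneg)
      then show "u *\<^sub>R x + v *\<^sub>R y \<in> {x. 0 < snd (L N (x, 1))}" by (simp add: Lcomb[OF uv])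
    qed
    moreover have "W \<subseteq> {x. 0 < snd (L N (x, 1))}"
    proof
      fix w assume w: "w \<in> W"
      show "w \<in> {x. 0 < snd (L N (x, 1))}"
      proof (cases "k \<bullet> (w, 1) = 0")
        case True
        then show ?thesis using L0[OF WQ[OF w]] pcone_snd_pos by blast
      next
        case False
        then show ?thesis using N2 w facet_chartD(3)[OF G WQ[OF w]] by auto
      qed
    qed
    ultimately have "Q \<subseteq> {x. 0 < snd (L N (x, 1))}" unfolding W by (rule hull_minimal[rotated])
    moreover obtain x c where "x \<in> Q" "0 < c" "y = c *\<^sub>R (x, 1)" using y by (rule pconeE)
    ultimately show ?thesis using linear_cmul[OF linL, of N c "(x, 1)"] by auto
  qed
  define Q' where "Q' = {x. (x, 1) \<in> L N ` pcone Q}"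
  have pQ': "pcone Q' = L N ` pcone Q"
    unfolding Q'_def
  proof (rule pcone_section)
    fix y and c :: real assume "y \<in> L N ` pcone Q" "0 < c"
    then show "c *\<^sub>R y \<in> L N ` pcone Q" using pcone_scaleR linear_cmul[OF linL] by (smt (verit) imageE image_eqI)
  qed (use sndL in auto)

  \<comment> \<open>The origin is adjoined because \<open>\<Phi> N x w\<close> is 0 when
    \<open>x\<close> lies on \<open>F\<close> and \<open>w\<close> on \<open>G\<close>.\<close>
  let ?C = "insert 0 (pcone F)"
  have C: "u *\<^sub>R y + v *\<^sub>R z \<in> ?C" if "y \<in> ?C" "z \<in> ?C" "0 \<le> u" "0 \<le> v" for y z u v
  proof -
    have "u *\<^sub>R y \<in> ?C" "v *\<^sub>R z \<in> ?C" using that pcone_scaleR[of _ F] by (cases "u = 0"; cases "v = 0"; auto)+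
    then show ?thesis using pcone_add[OF cF, of "u *\<^sub>R y" "v *\<^sub>R z"] by auto
  qed
  have \<Phi>1: "\<Phi> N x w \<in> ?C" if w: "w \<in> W" and x: "x \<in> P" for x w
  proof -
    have kw: "0 \<le> k \<bullet> (w, 1)" using facet_chartD(3)[OF G WQ[OF w]] .
    have "convex {x. \<Phi> N x w \<in> ?C}"
    proof (rule convexI)
      fix x y :: 'a and u v :: real
      assume A: "x \<in> {x. \<Phi> N x w \<in> ?C}" "y \<in> {x. \<Phi> N x w \<in> ?C}" "0 \<le> u" "0 \<le> v" and uv: "u + v = 1"
      have "(u *\<^sub>R x + v *\<^sub>R y, 1) = u *\<^sub>R (x, 1::real) + v *\<^sub>R (y, 1)" using uv by simp
      then have "\<Phi> N (u *\<^sub>R x + v *\<^sub>R y) w = u *\<^sub>R \<Phi> N x w + v *\<^sub>R \<Phi> N y w"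
        unfolding \<Phi>_def by (simp only: inner_add_right inner_scaleR_right) (simp add: algebra_simps del: scaleR_Pair add_Pair)
      then show "u *\<^sub>R x + v *\<^sub>R y \<in> {x. \<Phi> N x w \<in> ?C}" using C A by simp
    qed
    moreover have "V \<subseteq> {x. \<Phi> N x w \<in> ?C}"
    proof
      fix v assume v: "v \<in> V"
      have hv: "0 \<le> h \<bullet> (v, 1)" using facet_chartD(3)[OF F VP[OF v]] .
      consider "h \<bullet> (v, 1) = 0" | "k \<bullet> (w, 1) = 0" | "0 < h \<bullet> (v, 1)" "0 < k \<bullet> (w, 1)" using hv kw by linarith
      then have "\<Phi> N v w \<in> ?C"
      proof cases
        case 1
        then have "v \<in> F" using facet_chartD(4)[OF F] VP[OF v] by simp
        then show ?thesis using 1 C[of "(v, 1)" 0 "k \<bullet> (w, 1)" 0] kw by (simp add: \<Phi>_def)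
      next
        case 2
        then show ?thesis using L0[OF WQ[OF w] 2] C[of "L N (w, 1)" 0 "h \<bullet> (v, 1)" 0] hv
            by (simp add: \<Phi>_def del: scaleR_Pair)
      next
        case 3
        then show ?thesis using N1 v w by blast
      qed
      then show "v \<in> {x. \<Phi> N x w \<in> ?C}" by simp
    qed
    ultimately have "P \<subseteq> {x. \<Phi> N x w \<in> ?C}" unfolding V by (rule hull_minimal[rotated])
    then show ?thesis using x by blast
  qed
  have \<Phi>2: "\<Phi> N x w \<in> ?C" if w: "w \<in> Q" and x: "x \<in> P" for x w
  proof -
    have "convex {w. \<Phi> N x w \<in> ?C}"
    proof (rule convexI)
      fix w y :: 'a and u v :: real
      assume A: "w \<in> {w. \<Phi> N x w \<in> ?C}" "y \<in> {w. \<Phi> N x w \<in> ?C}" "0 \<le> u" "0 \<le> v" and uv: "u + v = 1"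
      have "\<Phi> N x (u *\<^sub>R w + v *\<^sub>R y) = u *\<^sub>R \<Phi> N x w + v *\<^sub>R \<Phi> N x y"
        unfolding \<Phi>_def inner_lift_combination[OF uv] Lcomb[OF uv] by (simp add: algebra_simps del: scaleR_Pair)
      then show "u *\<^sub>R w + v *\<^sub>R y \<in> {w. \<Phi> N x w \<in> ?C}" using C A by simp
    qed
    moreover have "W \<subseteq> {w. \<Phi> N x w \<in> ?C}" using \<Phi>1 x by blast
    ultimately have "Q \<subseteq> {w. \<Phi> N x w \<in> ?C}" unfolding W by (rule hull_minimal[rotated])
    then show ?thesis using w by blast
  qed

  have cP: "convex P" using facet_chartD(1)[OF F] by (rule polytope_imp_convex)
  have cQ': "convex Q'"
    by (rule convex_pcone_linear_image[OF polytope_imp_convex[OF facet_chartD(1)[OF G]] linL pQ'])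
  have FP: "F \<subseteq> P" using facet_chartD(4)[OF F] by blast
  have FQ': "F \<subseteq> Q'"
  proof
    fix f assume "f \<in> F"
    then have "(f, 1) \<in> L N ` pcone G" unfolding LG by simp
    then show "f \<in> Q'" using facet_chart_zero[OF G] by (auto simp: Q'_def)
  qed
  have seg: "closed_segment x y \<subseteq> P \<union> Q'" if x: "x \<in> P" and y: "y \<in> Q'" for x y
  proof -
    obtain z where z: "z \<in> pcone Q" "(y, 1) = L N z" using y by (auto simp: Q'_def)
    obtain w c where w: "w \<in> Q" "0 < c" "z = c *\<^sub>R (w, 1)" using z(1) by (rule pconeE)
    define \<alpha> where "\<alpha> = h \<bullet> (x, 1)"
    define \<beta> where "\<beta> = k \<bullet> z"
    have \<alpha>: "0 \<le> \<alpha>" using facet_chartD(3)[OF F x] by (simp add: \<alpha>_def)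
    have \<beta>: "0 \<le> \<beta>" using facet_chart_nonneg[OF G z(1)] by (simp add: \<beta>_def)
    have Lz: "(y, 1) = c *\<^sub>R L N (w, 1)" using z(2) w(3) linear_cmul[OF linL] by metis
    have \<beta>c: "\<beta> = c * (k \<bullet> (w, 1))" by (simp only: \<beta>_def w(3) inner_scaleR_right)
    have "\<beta> *\<^sub>R (x, 1) + \<alpha> *\<^sub>R (y, 1) = c *\<^sub>R \<Phi> N x w"
      unfolding \<Phi>_def \<beta>c Lz \<alpha>_def by (simp add: algebra_simps del: scaleR_Pair)
    also have "\<dots> \<in> ?C" using C[OF \<Phi>2[OF w(1) x] \<Phi>2[OF w(1) x], of c 0] w(2) by simp
    finally have comb: "\<beta> *\<^sub>R (x, 1) + \<alpha> *\<^sub>R (y, 1) \<in> ?C" .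
    consider "\<alpha> = 0" | "\<beta> = 0" | "0 < \<alpha>" "0 < \<beta>" using \<alpha> \<beta> by linarith
    then show ?thesis
    proof cases
      case 1
      then have "x \<in> Q'" using x facet_chartD(4)[OF F] FQ' by (auto simp: \<alpha>_def)
      then have "closed_segment x y \<subseteq> Q'" using y cQ' by (simp add: closed_segment_subset)
      then show ?thesis by blast
    next
      case 2
      then have "z \<in> pcone G" using facet_chart_zero[OF G] z(1) by (simp add: \<beta>_def)
      then have "(y, 1) \<in> pcone F" using z(2) LG by blast
      then have "y \<in> P" using FP by auto
      then have "closed_segment x y \<subseteq> P" using x cP by (simp add: closed_segment_subset)
      then show ?thesis by blast
    next
      case 3
      then have s: "0 < \<beta> + \<alpha>" by simp
      then have "\<beta> *\<^sub>R (x, 1::real) + \<alpha> *\<^sub>R (y, 1) \<noteq> 0" by (auto simp: zero_prod_def)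
      then have "\<beta> *\<^sub>R (x, 1) + \<alpha> *\<^sub>R (y, 1) \<in> pcone F" using comb by blast
      then have f: "(\<beta> *\<^sub>R x + \<alpha> *\<^sub>R y) /\<^sub>R (\<beta> + \<alpha>) \<in> F" by (simp add: pcone_def)
      let ?f = "(\<beta> *\<^sub>R x + \<alpha> *\<^sub>R y) /\<^sub>R (\<beta> + \<alpha>)"
      have "?f = (1 - \<alpha> / (\<beta> + \<alpha>)) *\<^sub>R x + (\<alpha> / (\<beta> + \<alpha>)) *\<^sub>R y"
      proof -
        have "1 - \<alpha> / (\<beta> + \<alpha>) = \<beta> / (\<beta> + \<alpha>)" using s by (simp add: field_simps)
        then show ?thesis by (simp add: scaleR_add_right divide_inverse mult.commute)
      qed
      then have "?f \<in> closed_segment x y"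
        using 3 by (auto simp: in_segment intro!: exI[of _ "\<alpha> / (\<beta> + \<alpha>)"])
      then have "closed_segment x y = closed_segment x ?f \<union> closed_segment ?f y" by (simp add: Un_closed_segment)
      moreover have "closed_segment x ?f \<subseteq> P" using f FP x cP by (intro closed_segment_subset) auto
      moreover have "closed_segment ?f y \<subseteq> Q'" using f FQ' y cQ' by (intro closed_segment_subset) auto
      ultimately show ?thesis by blast
    qed
  qed
  have "convex (P \<union> Q')"
    unfolding convex_contains_segment
  proof (intro ballI)
    fix x y assume "x \<in> P \<union> Q'" "y \<in> P \<union> Q'"
    then consider "x \<in> P" "y \<in> P" | "x \<in> P" "y \<in> Q'" | "x \<in> Q'" "y \<in> P" | "x \<in> Q'" "y \<in> Q'" by blast
    then show "closed_segment x y \<subseteq> P \<union> Q'"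
    proof cases
      case 1 then show ?thesis using closed_segment_subset[OF _ _ cP, of x y] by blast
    next
      case 2 then show ?thesis by (rule seg)
    next
      case 3 then show ?thesis using seg[of y x] by (simp add: closed_segment_commute)
    next
      case 4 then show ?thesis using closed_segment_subset[OF _ _ cQ', of x y] by blast
    qed
  qed
  then show ?thesis using that[OF linL bijL pQ' LG[symmetric]] hL by blast
qed

subsection \<open>Towers\<close>

text \<open>Any nonzero functional can serve as the homogenising coordinate. If \<open>c\<close> has
  last entry 0, replacing the last coordinate by \<open>c . z\<close> would forget
  \<open>snd z\<close>; adding \<open>snd z\<close> times \<open>a\<close> to the first component,
  where \<open>a\<close> is the normal vector, keeps the map injective.\<close>

lemma projective_chart_exists:
  fixes c :: "'a::euclidean_space \<times> real"
  assumes "c \<noteq> 0"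
  obtains \<Psi> :: "'a \<times> real \<Rightarrow> 'a \<times> real" where "linear \<Psi>" "bij \<Psi>" "\<forall>z. snd (\<Psi> z) = c \<bullet> z"
proof -
  obtain a r where c: "c = (a, r)" by (cases c)
  have "\<exists>\<Psi> :: 'a \<times> real \<Rightarrow> 'a \<times> real. linear \<Psi> \<and> inj \<Psi> \<and> (\<forall>z. snd (\<Psi> z) = c \<bullet> z)"
  proof (cases "r = 0")
    case False
    define \<Psi> where "\<Psi> z = (fst z, c \<bullet> z)" for z
    have "linear \<Psi>" by (rule linearI) (auto simp: \<Psi>_def inner_add_right)
    moreover have "inj \<Psi>" using False by (auto intro!: injI simp: \<Psi>_def c)
    ultimately show ?thesis by (intro exI[of _ \<Psi>]) (simp add: \<Psi>_def)
  next
    case True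
    then have a: "a \<noteq> 0" using assms c by (auto simp: zero_prod_def)
    define \<Psi> where "\<Psi> z = (fst z + snd z *\<^sub>R a, c \<bullet> z)" for z
    have lin: "linear \<Psi>" by (rule linearI) (auto simp: \<Psi>_def inner_add_right algebra_simps)
    have "z = 0" if "\<Psi> z = 0" for z
    proof -
      have 1: "fst z = - (snd z *\<^sub>R a)" "a \<bullet> fst z = 0"
        using that True by (auto simp: \<Psi>_def c zero_prod_def inner_prod_def eq_neg_iff_add_eq_0)
      then have "snd z * (a \<bullet> a) = 0" by simp
      then have "snd z = 0" using a by simp
      then show ?thesis using 1 by (simp add: prod_eq_iff)
    qed
    then have "inj \<Psi>" using lin by (simp add: linear_injective_0)
    then show ?thesis using lin by (intro exI[of _ \<Psi>]) (simp add: \<Psi>_def)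
  qed
  then obtain \<Psi> :: "'a \<times> real \<Rightarrow> 'a \<times> real" where "linear \<Psi>" "inj \<Psi>" "\<forall>z. snd (\<Psi> z) = c \<bullet> z" by blast
  then show ?thesis using that by (simp add: bij_def linear_injective_imp_surjective)
qed

text \<open>The cone in a link has no preferred height. The sum of one opposite pair is positive on
  it away from the origin, so taking this sum as the last coordinate gives a bounded slice at height
  1, an actual cube.\<close>

lemma cube_link_polytope:
  fixes S S' :: "'a::euclidean_space set"
  assumes "cube_link S S'"
  obtains G :: "'a \<Rightarrow> bool \<Rightarrow> 'a \<times> real" and K j s where "cube_polytope Basis G K" "j \<in> Basis"
    "facet_chart S (tight_face G K {(j, s)}) (G j s) K"
    "facet_chart S' (tight_face G K {(j, \<not> s)}) (G j (\<not> s)) K"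
  using assms
proof cases
  case (cube_linkI G j \<Lambda> \<Lambda>' s)
  note H = cube_linkI
  obtain i :: 'a where i: "i \<in> Basis" using nonempty_Basis by blast
  have pos: "0 < (G i False + G i True) \<bullet> z" if "z \<in> hcone Basis G" "z \<noteq> 0" for z
    using cube_system_pair_pos[OF H(1) i that] .
  obtain z where "z \<in> hcone Basis G" "z \<noteq> 0" using H(1) by (auto simp: cube_system_def)
  from pos[OF this] have "G i False + G i True \<noteq> 0" by auto
  then obtain \<Psi> :: "'a \<times> real \<Rightarrow> 'a \<times> real" where \<Psi>: "linear \<Psi>" "bij \<Psi>" "\<forall>z. snd (\<Psi> z) = (G i False + G i True) \<bullet> z"
    by (rule projective_chart_exists)
  define G' where "G' = (\<lambda>i s. push \<Psi> (G i s))"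
  define K where "K = {x. (x, 1) \<in> hcone Basis G' - {0}}"
  have hG': "hcone Basis G' - {0} = \<Psi> ` (hcone Basis G - {0})"
    unfolding G'_def hcone_push[OF \<Psi>(1,2)] using linear_inj_eq_0[OF \<Psi>(1) bij_is_inj[OF \<Psi>(2)]]
    by (auto simp del: split_paired_All)
  have pK: "pcone K = hcone Basis G' - {0}"
    unfolding K_def
  proof (rule pcone_section)
    fix y assume "y \<in> hcone Basis G' - {0}"
    then obtain z where "z \<in> hcone Basis G" "z \<noteq> 0" "y = \<Psi> z" unfolding hG' by blast
    then show "0 < snd y" using pos[of z] \<Psi>(3)[rule_format, of z] by simp
  qed (auto simp: hcone_scaleR)
  interpret cube_polytope Basis G' K
    using cube_system_push[OF \<Psi>(1,2) H(1)] pK by (intro cube_polytope.intro) (simp_all add: G'_def)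
  have G'\<Psi>: "G' i s \<bullet> \<Psi> z = G i s \<bullet> z" for i s z by (simp add: G'_def push_inner[OF \<Psi>(1,2)])
  have chart: "facet_chart X (tight_face G' K {(j, r)}) (G' j r) K"
    if \<Lambda>: "linear \<Lambda>" "inj \<Lambda>" "\<And>z. G j r \<bullet> \<Lambda> z = 0" "\<Lambda> ` X = {y \<in> hcone Basis G - {0}. G j r \<bullet> y = 0}" for X \<Lambda> r
  proof -
    obtain z where "0 < G' j r \<bullet> z" using cube_system_interior_point[OF cs] H(2) by metis
    then have n0: "G' j r \<noteq> 0" by auto
    have "pcone (tight_face G' K {(j, r)}) = {y \<in> \<Psi> ` (hcone Basis G - {0}). G' j r \<bullet> y = 0}"
      unfolding tight_face_single pcone_hyperplane pK hG' ..
    also have "\<dots> = \<Psi> ` {y \<in> hcone Basis G - {0}. G j r \<bullet> y = 0}" using G'\<Psi>[of j r] by (auto simp del: split_paired_All)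
    also have "\<dots> = (\<Psi> \<circ> \<Lambda>) ` X" unfolding \<Lambda>(4)[symmetric] by (simp add: image_comp)
    finally have im: "(\<Psi> \<circ> \<Lambda>) ` X = pcone (tight_face G' K {(j, r)})" ..
    have "linear (\<Psi> \<circ> \<Lambda>)" "inj (\<Psi> \<circ> \<Lambda>)" "\<forall>z. G' j r \<bullet> (\<Psi> \<circ> \<Lambda>) z = 0"
      using \<Lambda> \<Psi> linear_compose inj_compose[OF bij_is_inj[OF \<Psi>(2)] \<Lambda>(2)] G'\<Psi> by auto
    then show ?thesis
      using polytope_K n0 im H(2) mem_K unfolding facet_chart_def tight_face_single by blast
  qed
  show ?thesis
  proof (rule that[of G' K j s])
    show "cube_polytope Basis G' K" by unfold_locales
    show "j \<in> Basis" by fact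
    show "facet_chart S (tight_face G' K {(j, s)}) (G' j s) K" using H by (intro chart[of \<Lambda>])
    show "facet_chart S' (tight_face G' K {(j, \<not> s)}) (G' j (\<not> s)) K" using H by (intro chart[of \<Lambda>'])
  qed
qed

text \<open>The facet \<open>G\<close> opposite to \<open>F\<close> is disjoint from
  \<open>P\<close>, hence it stays an exposed facet of the union with the same chart. This is what
  allows the next cube of a chain to be attached there.\<close>

lemma attach_cube:
  fixes P :: "'a::euclidean_space set"
  assumes link: "cube_link S S'" and F: "facet_chart S F h P"
  obtains K G k where "combinatorial_cube DIM('a) K" "polytope K" "aff_dim K = int DIM('a)" "opposite_facets K G F"
    "facet_chart S F (- h) K" "G facet_of K" "F facet_of K" "F \<inter> G = {}"
    "convex (P \<union> K)" "P \<inter> K = F" "facet_chart S' G k (P \<union> K)" "F \<noteq> {}" "G \<subseteq> K"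
proof -
  have int: "interior S \<noteq> {}" "interior S' \<noteq> {}" using link by (auto elim: cube_link.cases)
  obtain H :: "'a \<Rightarrow> bool \<Rightarrow> 'a \<times> real" and K j s where K: "cube_polytope Basis H K" "j \<in> Basis"
    "facet_chart S (tight_face H K {(j, s)}) (H j s) K"
    "facet_chart S' (tight_face H K {(j, \<not> s)}) (H j (\<not> s)) K"
    using link by (rule cube_link_polytope)
  obtain L K' where L: "linear L" "bij L" and K': "pcone K' = L ` pcone K"
    and FL: "pcone F = L ` pcone (tight_face H K {(j, s)})" and conv: "convex (P \<union> K')"
    and hL: "\<forall>y. h \<bullet> L y = - (H j s \<bullet> y)"
    using glue_polytopes[OF F K(3) int(1)] .
  define H' where "H' = (\<lambda>i r. push L (H i r))"
  have cp: "cube_polytope Basis H' K'"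
    unfolding H'_def by (rule cube_polytope_push[OF L K(1) K'])
  interpret cube_polytope Basis H' K' by fact
  \<comment> \<open>The gluing map reverses the sign of the facet functional at every
    \<open>L y\<close>, and \<open>L\<close> is surjective, so the transported functional is exactly
    \<open>- h\<close>.\<close>
  have "H' j s \<bullet> w = (- h) \<bullet> w" for w
  proof -
    obtain y where y: "w = L y" using bij_is_surj[OF L(2)] by (metis surjD)
    show ?thesis using hL[rule_format, of y] push_inner[OF L, of "H j s" y] by (simp add: H'_def y)
  qed
  then have Hs: "H' j s = - h" by (metis vector_eq_rdot)
  note c1 = facet_chart_push[OF L K(3) K' refl, folded H'_def]
  note c2 = facet_chart_push[OF L K(4) K' refl, folded H'_def]
  have eqs: "push L (H j r) = H' j r" for r by (simp add: H'_def)
  have tf: "{x \<in> K'. push L (H j r) \<bullet> (x, 1) = 0} = tight_face H' K' {(j, r)}" for r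
    by (simp add: tight_face_single eqs)
  have Feq: "tight_face H' K' {(j, s)} = F" using c1(2) FL unfolding tf by (metis pcone_eq_iff)
  have chF: "facet_chart S F (- h) K'" using c1(1)[unfolded tf Feq, unfolded eqs Hs] .
  let ?G = "tight_face H' K' {(j, \<not> s)}"
  have chG: "facet_chart S' ?G (H' j (\<not> s)) K'" using c2(1)[unfolded tf, unfolded eqs] .
  have Fne: "F \<noteq> {}" using facet_chart_nonempty[OF F] int(1) interior_subset by blast
  have Gne: "?G \<noteq> {}" using facet_chart_nonempty[OF chG] int(2) interior_subset by blast
  have facets: "F facet_of K'" "?G facet_of K'"
    using facet_chart_facet_of[OF chF int(1) aff_dim_K] facet_chart_facet_of[OF chG int(2) aff_dim_K] by auto
  have opp: "opposite_facets K' ?G F"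
    using opposite_facets_cube_polytope[OF cp K(2), of "\<not> s"] facets by (simp add: Feq)
  have disj: "F \<inter> ?G = {}"
    unfolding Feq[symmetric] tight_face_single using opposite_not_tight K(2) by blast
  have inter: "P \<inter> K' = F"
  proof (intro equalityI subsetI)
    fix x assume "x \<in> P \<inter> K'"
    then show "x \<in> F" using facet_chartD(3,4)[OF F, of x] facet_chartD(3)[OF chF, of x] by simp
  next
    fix x assume "x \<in> F"
    then show "x \<in> P \<inter> K'" using facet_chartD(4)[OF F] facet_chartD(4)[OF chF] by blast
  qed
  have "polytope (P \<union> K')" using facet_chartD(1)[OF F] polytope_K conv by (rule polytope_Un)
  then have chGU: "facet_chart S' ?G (H' j (\<not> s)) (P \<union> K')"
    using facet_chart_Un(2)[OF chG facet_chartD(1)[OF F] conv _ Gne] inter disj by blast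
  have "?G \<subseteq> K'" by (auto simp: tight_face_def)
  then show ?thesis
    using that[OF combinatorial_cube_cube_polytope[OF cp] polytope_K aff_dim_K opp chF facets(2,1) disj conv inter chGU Fne]
    by blast
qed

text \<open>The first cube of the chain is attached to \<open>P\<close>, so it becomes the topmost cube of the tower.\<close>

lemma tower_on_facet:
  fixes P :: "'a::euclidean_space set"
  assumes "(cube_link ^^ Suc n) S S'" "facet_chart S F h P"
  shows "\<exists>T B k. tower (Suc n) T B F \<and> polytope T \<and> F facet_of T \<and> convex (P \<union> T) \<and> P \<inter> T = F \<and> B \<subseteq> T \<and>
    facet_chart S' B k (P \<union> T)"
  using assms
proof (induction n arbitrary: S F h P)
  case 0
  then have "cube_link S S'" by (simp add: eq_OO)
  from attach_cube[OF this 0(2)] obtain K G k where K: "combinatorial_cube DIM('a) K" "polytope K"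
    "opposite_facets K G F" "F facet_of K" "convex (P \<union> K)" "P \<inter> K = F" "facet_chart S' G k (P \<union> K)" "G \<subseteq> K"
    by metis
  then show ?case using tower_one[OF K(1,3)] by (intro exI[of _ K] exI[of _ G] exI[of _ k]) simp
next
  case (Suc n)
  obtain X where X: "cube_link S X" "(cube_link ^^ Suc n) X S'" using relpowp_Suc_D2[OF Suc.prems(1)] by blast
  note ch = Suc.prems(2)
  have intS: "interior S \<noteq> {}" using X(1) by (auto elim: cube_link.cases)
  obtain K G k where K: "combinatorial_cube DIM('a) K" "polytope K" "aff_dim K = int DIM('a)" "opposite_facets K G F"
    "facet_chart S F (- h) K" "G facet_of K" "F facet_of K" "F \<inter> G = {}"
    "convex (P \<union> K)" "P \<inter> K = F" "facet_chart X G k (P \<union> K)" "F \<noteq> {}" "G \<subseteq> K"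
    using attach_cube[OF X(1) ch] .
  from Suc.IH[OF X(2) K(11)] obtain T B k' where T: "tower (Suc n) T B G" "polytope T" "G facet_of T"
    "convex (P \<union> K \<union> T)" "(P \<union> K) \<inter> T = G" "B \<subseteq> T" "facet_chart S' B k' (P \<union> K \<union> T)" by metis
  have PT: "P \<inter> T = {}" using T(5) K(8,10,13) by blast
  have TK: "T \<inter> K = G" using T(5) K(13) by blast
  have hP: "0 \<le> h \<bullet> (x, 1)" if "x \<in> P" for x using facet_chartD(3)[OF ch that] .
  have hK: "h \<bullet> (x, 1) \<le> 0" if "x \<in> K" for x using facet_chartD(3)[OF K(5) that] by simp
  have FK: "x \<in> F \<longleftrightarrow> x \<in> K \<and> h \<bullet> (x, 1) = 0" for x using facet_chartD(4)[OF K(5), of x] by simp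
  have FP: "x \<in> F \<longleftrightarrow> x \<in> P \<and> h \<bullet> (x, 1) = 0" for x using facet_chartD(4)[OF ch, of x] .
  have halfspace: "convex {x. 0 \<le> c \<bullet> (x, 1)}" for c :: "'a \<times> real"
    by (auto simp: convex_def inner_lift_combination)
  \<comment> \<open>On the side \<open>h >= 0\<close> the convex union consists of \<open>P\<close>
    and the part of \<open>T\<close> there. These are disjoint closed sets, so connectedness forbids
    the second one.\<close>
  have hT: "h \<bullet> (x, 1) < 0" if x: "x \<in> T" for x
  proof (rule ccontr)
    assume neg: "\<not> h \<bullet> (x, 1) < 0"
    let ?H = "{x. 0 \<le> h \<bullet> (x, 1)}"
    have eq: "(P \<union> K \<union> T) \<inter> ?H = P \<union> (T \<inter> ?H)" using hP hK FK FP by fastforce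
    have "connected (P \<union> (T \<inter> ?H))"
      unfolding eq[symmetric] by (intro convex_connected convex_Int T(4) halfspace)
    moreover have "closed ?H" by (intro closed_Collect_le continuous_intros)
    then have "closed P" "closed (T \<inter> ?H)"
      using facet_chartD(1)[OF ch] T(2) polytope_imp_closed closed_Int by blast+
    moreover have "P \<inter> (P \<union> (T \<inter> ?H)) \<noteq> {}" using K(12) FP by blast
    moreover have "x \<in> (T \<inter> ?H) \<inter> (P \<union> (T \<inter> ?H))" using x neg by simp
    ultimately show False
      using connected_closedD[of "P \<union> (T \<inter> ?H)" P "T \<inter> ?H"] PT by blast
  qed
  \<comment> \<open>Cutting the convex union along the hyperplane of \<open>F\<close> leaves exactly
    the new tower, which is therefore convex.\<close>
  have "(P \<union> K \<union> T) \<inter> {x. 0 \<le> (- h) \<bullet> (x, 1)} = T \<union> K"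
    using hT hK hP FP FK by (fastforce simp: less_imp_le)
  then have conv: "convex (T \<union> K)" using T(4) halfspace convex_Int by metis
  have poly: "polytope (T \<union> K)" using T(2) K(2) conv by (rule polytope_Un)
  have "tower (Suc (Suc n)) (T \<union> K) B F"
    by (rule tower_step[OF T(1) K(1) TK T(3) K(6) poly K(4)])
  moreover have "F facet_of (T \<union> K)"
  proof (rule facet_chart_facet_of[OF _ intS])
    show "facet_chart S F (- h) (T \<union> K)"
      using facet_chart_Un(2)[OF K(5) T(2) conv _ K(12) poly] TK K(8) by blast
    show "aff_dim (T \<union> K) = int DIM('a)"
      using aff_dim_subset[of K "T \<union> K"] K(3) aff_dim_le_DIM[of "T \<union> K"] by simp
  qed
  moreover have "P \<union> (T \<union> K) = P \<union> K \<union> T" by blast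
  moreover have "P \<inter> (T \<union> K) = F" using PT K(10) by blast
  moreover have "B \<subseteq> T \<union> K" using T(6) by blast
  ultimately show ?case using poly T(4,7) by metis
qed

subsection \<open>From combinatorial cubes to cones\<close>

text \<open>For a base point \<open>p\<close> of \<open>F\<close>, the linear map taking
  \<open>y\<close> to \<open>fst y - snd y *\<^sub>R p\<close> sends all lifts, hence their span,
  into the direction space of the affine hull; at height 1 its value is
  \<open>x - p\<close>.\<close>

lemma lift_in_span_iff:
  fixes F :: "'b::euclidean_space set"
  shows "(x, 1::real) \<in> span ((\<lambda>x. (x, 1)) ` F) \<longleftrightarrow> x \<in> affine hull F"
proof -
  let ?E = "(\<lambda>x. (x, 1::real)) ` F"
  have sub: "fst y - snd y *\<^sub>R p \<in> (\<lambda>x. x - p) ` (affine hull F)" if p: "p \<in> F" and y: "y \<in> span ?E" for p y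
  proof -
    let ?D = "(\<lambda>x. x - p) ` (affine hull F)"
    have D: "subspace ?D" using p by (intro affine_diffs_subspace_subtract) (auto simp: hull_inc)
    have "subspace {y :: 'b \<times> real. fst y - snd y *\<^sub>R p \<in> ?D}"
    proof (rule subspaceI)
      show "0 \<in> {y :: 'b \<times> real. fst y - snd y *\<^sub>R p \<in> ?D}" using subspace_0[OF D] by simp
      fix x y :: "'b \<times> real" and c
      assume xy: "x \<in> {y. fst y - snd y *\<^sub>R p \<in> ?D}"
      have "c *\<^sub>R (fst x - snd x *\<^sub>R p) \<in> ?D" using xy subspace_scale[OF D] by blast
      then show "c *\<^sub>R x \<in> {y. fst y - snd y *\<^sub>R p \<in> ?D}" by (simp add: algebra_simps)
      assume "y \<in> {y. fst y - snd y *\<^sub>R p \<in> ?D}"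
      then have "(fst x - snd x *\<^sub>R p) + (fst y - snd y *\<^sub>R p) \<in> ?D" using xy subspace_add[OF D] by blast
      then show "x + y \<in> {y. fst y - snd y *\<^sub>R p \<in> ?D}" by (simp add: algebra_simps)
    qed
    moreover have "?E \<subseteq> {y. fst y - snd y *\<^sub>R p \<in> ?D}" by (auto simp: hull_inc)
    ultimately show ?thesis using y span_minimal[of ?E] by blast
  qed
  show "(x, 1) \<in> span ?E \<longleftrightarrow> x \<in> affine hull F"
  proof
    assume x: "(x, 1) \<in> span ?E"
    have "F \<noteq> {}"
    proof
      assume "F = {}"
      then show False using x by (simp add: zero_prod_def)
    qed
    then show "x \<in> affine hull F" using sub[of _ "(x, 1)"] x by fastforce
  next
    have "affine {x. (x, 1) \<in> span ?E}"
      unfolding affine_def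
    proof (intro ballI allI impI)
      fix x y u v assume "x \<in> {x. (x, 1) \<in> span ?E}" "y \<in> {x. (x, 1) \<in> span ?E}" "u + v = (1::real)"
      moreover from this have "u *\<^sub>R (x, 1) + v *\<^sub>R (y, 1) \<in> span ?E" by (intro span_add span_scale) auto
      ultimately show "u *\<^sub>R x + v *\<^sub>R y \<in> {x. (x, 1) \<in> span ?E}" by simp
    qed
    then have "affine hull F \<subseteq> {x. (x, 1) \<in> span ?E}" by (intro hull_minimal) (auto simp: span_base)
    then show "x \<in> affine hull F \<Longrightarrow> (x, 1) \<in> span ?E" by blast
  qed
qed

lemma span_pcone: "span (pcone F) = span ((\<lambda>x. (x, 1)) ` F)"
proof (rule span_unique)
  show "pcone F \<subseteq> span ((\<lambda>x. (x, 1)) ` F)"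
  proof
    fix y assume "y \<in> pcone F"
    then obtain x c where "x \<in> F" "y = c *\<^sub>R (x, 1)" by (rule pconeE)
    then show "y \<in> span ((\<lambda>x. (x, 1)) ` F)" by (metis image_eqI span_base span_scale)
  qed
  show "span ((\<lambda>x. (x, 1)) ` F) \<subseteq> T" if "pcone F \<subseteq> T" "subspace T" for T
    using that by (intro span_minimal) auto
qed simp

section \<open>Faces of the standard cube\<close>

lemma std_cube_eq:
  assumes "B \<subseteq> (Basis :: 'b::euclidean_space set)"
  shows "std_cube B = {x. (\<forall>i\<in>B. 0 \<le> x \<bullet> i \<and> x \<bullet> i \<le> 1) \<and> (\<forall>i\<in>Basis - B. x \<bullet> i = 0)}"
proof -
  have fin: "finite B" using assms finite_Basis finite_subset by blast
  have s: "\<Sum>B \<bullet> i = (if i \<in> B then 1 else 0)" if i: "i \<in> Basis" for i :: 'b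
  proof -
    have "\<Sum>B \<bullet> i = (\<Sum>b\<in>B. if b = i then 1 else 0)"
      unfolding inner_sum_left using assms i by (intro sum.cong) (auto simp: inner_Basis)
    then show ?thesis using fin by simp
  qed
  show ?thesis
  proof (rule set_eqI)
    fix x :: 'b
    have "x \<in> std_cube B \<longleftrightarrow> (\<forall>i\<in>Basis. 0 \<le> x \<bullet> i \<and> x \<bullet> i \<le> (if i \<in> B then 1 else 0))"
      by (simp add: std_cube_def mem_box s)
    also have "\<dots> \<longleftrightarrow> (\<forall>i\<in>B. 0 \<le> x \<bullet> i \<and> x \<bullet> i \<le> 1) \<and> (\<forall>i\<in>Basis - B. x \<bullet> i = 0)"
      using assms by (auto split: if_splits)
    finally show "x \<in> std_cube B \<longleftrightarrow> x \<in> {x. (\<forall>i\<in>B. 0 \<le> x \<bullet> i \<and> x \<bullet> i \<le> 1) \<and> (\<forall>i\<in>Basis - B. x \<bullet> i = 0)}" by simp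
  qed
qed

definition std_facet :: "'b::euclidean_space set \<Rightarrow> 'b \<Rightarrow> bool \<Rightarrow> 'b set" where
  "std_facet B i s = {x \<in> std_cube B. i \<bullet> x = (if s then 1 else 0)}"

lemma std_facet_face_of:
  assumes B: "B \<subseteq> Basis" and i: "i \<in> B"
  shows "std_facet B i s face_of std_cube B"
proof -
  have c: "convex (std_cube B)" by (simp add: std_cube_def)
  have eq: "std_facet B i s = std_cube B \<inter> {x. i \<bullet> x = (if s then 1 else 0)}" by (auto simp: std_facet_def)
  show ?thesis unfolding eq
    using face_of_Int_supporting_hyperplane_ge[OF c, of 0 i] face_of_Int_supporting_hyperplane_le[OF c, of i 1]
      std_cube_eq[OF B] i by (cases s) (auto simp: inner_commute)
qed

text \<open>A relative interior point of \<open>Y\<close> lying in a facet would put all of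
  \<open>Y\<close> into that facet. If it lies in none, its coordinates in \<open>B\<close> are
  strictly between 0 and 1, so it is a relative interior point of the cube, which no proper face
  contains.\<close>

lemma proper_face_std_cube:
  fixes B :: "'b::euclidean_space set"
  assumes B: "B \<subseteq> Basis" "B \<noteq> {}" and Y: "Y face_of std_cube B" "Y \<noteq> std_cube B"
  obtains i s where "i \<in> B" "Y \<subseteq> std_facet B i s"
proof (rule ccontr)
  assume "\<not> thesis"
  then have no: "\<not> Y \<subseteq> std_facet B i s" if "i \<in> B" for i s using that \<open>\<And>i s. i \<in> B \<Longrightarrow> Y \<subseteq> std_facet B i s \<Longrightarrow> thesis\<close> by blast
  have fin: "finite B" using B finite_Basis finite_subset by blast
  have sub: "Y \<subseteq> std_cube B" and cY: "convex Y" using Y(1) by (auto simp: face_of_def)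
  have "Y \<noteq> {}" using no B(2) by auto
  then obtain y where y: "y \<in> rel_interior Y" using rel_interior_eq_empty[OF cY] by blast
  then have yY: "y \<in> Y" using rel_interior_subset by blast
  have ne: "i \<bullet> y \<noteq> (if s then 1 else 0)" if i: "i \<in> B" for i s
  proof
    assume e: "i \<bullet> y = (if s then 1 else 0)"
    have "std_facet B i s face_of std_cube B" by (rule std_facet_face_of[OF B(1) i])
    moreover have "y \<in> std_facet B i s" using e yY sub by (auto simp: std_facet_def)
    ultimately have "Y \<subseteq> std_facet B i s" using subset_of_face_of[of "std_facet B i s" "std_cube B" Y] sub y by blast
    then show False using no[OF i] by blast
  qed
  have yb: "0 < y \<bullet> i \<and> y \<bullet> i < 1" if i: "i \<in> B" for i
    using ne[OF i, of True] ne[OF i, of False] yY sub std_cube_eq[OF B(1)] i by (force simp: inner_commute)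
  define e where "e = Min ((\<lambda>i. min (y \<bullet> i) (1 - y \<bullet> i)) ` B)"
  have "e \<in> (\<lambda>i. min (y \<bullet> i) (1 - y \<bullet> i)) ` B" unfolding e_def using fin B(2) by (intro Min_in) auto
  then have e0: "0 < e" using yb by auto
  have e1: "e \<le> min (y \<bullet> i) (1 - y \<bullet> i)" if "i \<in> B" for i unfolding e_def using fin that by (intro Min_le) auto
  have "affine {x::'b. \<forall>i\<in>Basis - B. x \<bullet> i = 0}" by (auto simp: affine_def inner_add_left)
  then have aff: "affine hull std_cube B \<subseteq> {x. \<forall>i\<in>Basis - B. x \<bullet> i = 0}"
    using std_cube_eq[OF B(1)] by (intro hull_minimal) auto
  have "ball y e \<inter> affine hull std_cube B \<subseteq> std_cube B"
  proof
    fix x assume x: "x \<in> ball y e \<inter> affine hull std_cube B"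
    have "0 \<le> x \<bullet> i \<and> x \<bullet> i \<le> 1" if i: "i \<in> B" for i
    proof -
      have "\<bar>(x - y) \<bullet> i\<bar> \<le> norm (x - y)" using B(1) i by (intro Basis_le_norm) auto
      also have "\<dots> < e" using x by (auto simp: dist_norm norm_minus_commute)
      finally show ?thesis using e1[OF i] by (auto simp: inner_diff_left)
    qed
    then show "x \<in> std_cube B" using x aff std_cube_eq[OF B(1)] by blast
  qed
  then have "y \<in> rel_interior (std_cube B)" using e0 yY sub by (auto simp: mem_rel_interior_ball)
  then show False using face_of_disjoint_rel_interior[OF Y] yY by blast
qed

lemma polytope_exposing_functional:
  assumes "polytope P" "E face_of P"
  obtains h :: "'b::euclidean_space \<times> real" where "\<forall>x\<in>P. 0 \<le> h \<bullet> (x, 1)" "E = {x\<in>P. h \<bullet> (x, 1) = 0}"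
proof -
  have "E exposed_face_of P" using assms exposed_face_of_polyhedron polytope_imp_polyhedron by blast
  then obtain a b where ab: "P \<subseteq> {x. a \<bullet> x \<le> b}" "E = P \<inter> {x. a \<bullet> x = b}" by (auto simp: exposed_face_of_def)
  have e: "(- a, b) \<bullet> (x, 1) = b - a \<bullet> x" for x by simp
  show ?thesis by (rule that[of "(- a, b)"]) (use ab in \<open>auto simp: e simp del: inner_Pair\<close>)
qed

text \<open>Two features of the lattice suffice to build a cube system: paired facets are disjoint,
  and the facets cover all proper faces. For \<open>n = 0\<close> the empty face would be proper
  without any facet to contain it.\<close>

lemma combinatorial_cube_facets:
  fixes F :: "'b::euclidean_space set"
  assumes F: "combinatorial_cube n F" and n: "1 \<le> n"
  obtains B :: "'b set" and E where "finite B" "card B = n"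
    "\<forall>i\<in>B. \<forall>s. E i s face_of F \<and> E i s \<noteq> F" "\<forall>i\<in>B. E i False \<inter> E i True = {}"
    "\<forall>X. X face_of F \<longrightarrow> X \<noteq> F \<longrightarrow> (\<exists>i\<in>B. \<exists>s. X \<subseteq> E i s)"
proof -
  obtain B f where B: "B \<subseteq> Basis" "card B = n" and f: "face_lattice_iso f F (std_cube B :: 'b set)"
    using F unfolding combinatorial_cube_def combinatorially_equivalent_def by blast
  have fin: "finite B" using B finite_Basis finite_subset by blast
  have Bne: "B \<noteq> {}" using B n by auto
  have bij: "bij_betw f {X. X face_of F} {Y. Y face_of std_cube B}"
    and ord: "\<And>X Y. X face_of F \<Longrightarrow> Y face_of F \<Longrightarrow> f X \<subseteq> f Y \<longleftrightarrow> X \<subseteq> Y"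
    using f by (auto simp: face_lattice_iso_def)
  have surj: "\<exists>X. X face_of F \<and> f X = Y" if "Y face_of std_cube B" for Y
    using bij that unfolding bij_betw_def by (metis (mono_tags, lifting) imageE mem_Collect_eq)
  have face: "f X face_of std_cube B" if "X face_of F" for X
    using bij that by (auto simp: bij_betw_def)
  have inj: "X = Y" if "X face_of F" "Y face_of F" "f X = f Y" for X Y
    using ord that by blast
  have cF: "convex F" using F polytope_imp_convex by (auto simp: combinatorial_cube_def)
  have refF: "F face_of F" using cF by (rule face_of_refl)
  have top: "f F = std_cube B"
  proof -
    have "std_cube B face_of (std_cube B :: 'b set)" by (intro face_of_refl) (simp add: std_cube_def)
    then obtain Y where "Y face_of F" "f Y = std_cube B" using surj by blast
    then have "std_cube B \<subseteq> f F" using ord[of Y F] refF face_of_imp_subset by blast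
    then show ?thesis using face_of_imp_subset[OF face[OF refF]] by blast
  qed
  define E where "E i s = (SOME X. X face_of F \<and> f X = std_facet B i s)" for i s
  have E: "E i s face_of F" "f (E i s) = std_facet B i s" if i: "i \<in> B" for i s
    using someI_ex[OF surj[OF std_facet_face_of[OF B(1) i, of s]]] by (simp_all add: E_def)
  have proper: "E i s \<noteq> F" if i: "i \<in> B" for i s
  proof
    assume "E i s = F"
    then have eq: "std_facet B i s = std_cube B" using E(2)[OF i] top by metis
    have "0 \<in> std_cube B" by (simp add: std_cube_eq[OF B(1)])
    moreover have "i \<bullet> j = (if j = i then 1 else 0)" if "j \<in> Basis" for j
      using inner_Basis[of i j] i B(1) that by auto
    then have "i \<in> std_cube B" using i B(1) by (auto simp: std_cube_eq[OF B(1)] subset_iff)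
    ultimately have "0 \<in> std_facet B i s" "i \<in> std_facet B i s" using eq by auto
    moreover have "i \<bullet> i = 1" using i B(1) by (auto simp: inner_Basis)
    ultimately show False by (cases s) (auto simp: std_facet_def)
  qed
  have disj: "E i False \<inter> E i True = {}" if i: "i \<in> B" for i
  proof -
    let ?X = "E i False \<inter> E i True"
    have X: "?X face_of F" using E(1)[OF i] by (intro face_of_Int)
    have "f ?X \<subseteq> std_facet B i False \<inter> std_facet B i True" using ord[OF X E(1)[OF i]] E(2)[OF i] by blast
    moreover have "std_facet B i False \<inter> std_facet B i True = {}" by (auto simp: std_facet_def)
    ultimately have "f ?X = {}" by simp
    moreover have "f {} \<subseteq> f ?X" using ord[of "{}" ?X] X by simp
    ultimately show ?thesis using inj[OF X, of "{}"] by simp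
  qed
  have "\<exists>i\<in>B. \<exists>s. X \<subseteq> E i s" if X: "X face_of F" "X \<noteq> F" for X
  proof -
    have "f X \<noteq> std_cube B" using inj[OF X(1) refF] X(2) top by auto
    then obtain i s where "i \<in> B" "f X \<subseteq> std_facet B i s" using proper_face_std_cube[OF B(1) Bne face[OF X(1)]] by blast
    then show ?thesis using ord[OF X(1) E(1)] E(2) by blast
  qed
  then show ?thesis using E(1) proper disj by (intro that[OF fin B(2), of E]) simp_all
qed

text \<open>Functionals exposing the facets \<open>E i s\<close> cut \<open>F\<close> out of its
  affine hull, and paired ones never vanish together because paired facets are disjoint. The ambient
  space of \<open>F\<close> is left open, as the result is needed both for facets of
  \<open>d\<close>-polytopes and for cubes in one dimension less.\<close>

lemma combinatorial_cube_cube_system: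
  fixes F :: "'b::euclidean_space set" and b0 :: "'a::euclidean_space"
  assumes F: "combinatorial_cube n F" and n: "1 \<le> n" and d: "DIM('a) = Suc n"
    and b0: "b0 \<in> Basis" and I: "I = Basis - {b0}"
  obtains g :: "'a \<Rightarrow> bool \<Rightarrow> 'a" and \<Lambda> where "cube_system I g" "linear \<Lambda>" "inj \<Lambda>"
    "range \<Lambda> = span ((\<lambda>x. (x, 1)) ` F)" "\<Lambda> ` (hcone I g - {0}) = pcone F"
proof -
  have pF: "polytope F" and adF: "aff_dim F = int n" using F by (auto simp: combinatorial_cube_def)
  have cF: "convex F" and bF: "bounded F" and clF: "closed F"
    using pF by (auto simp: polytope_imp_convex polytope_imp_bounded polytope_imp_closed)
  obtain B :: "'b set" and E where B: "finite B" "card B = n"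
    and E: "\<forall>i\<in>B. \<forall>s. E i s face_of F \<and> E i s \<noteq> F" and disj: "\<forall>i\<in>B. E i False \<inter> E i True = {}"
    and cover: "\<forall>X. X face_of F \<longrightarrow> X \<noteq> F \<longrightarrow> (\<exists>i\<in>B. \<exists>s. X \<subseteq> E i s)"
    using combinatorial_cube_facets[OF F n] .
  define exposes where "exposes i s h \<longleftrightarrow> (\<forall>x\<in>F. 0 \<le> h \<bullet> (x, 1)) \<and> E i s = {x\<in>F. h \<bullet> (x, 1) = 0}"
    for i s and h :: "'b \<times> real"
  define \<gamma> where "\<gamma> i s = (SOME h. exposes i s h)" for i s
  have exposes: "exposes i s (\<gamma> i s)" if i: "i \<in> B" for i s
  proof -
    have "E i s face_of F" using E i by blast
    then obtain h :: "'b \<times> real" where "\<forall>x\<in>F. 0 \<le> h \<bullet> (x, 1)" "E i s = {x\<in>F. h \<bullet> (x, 1) = 0}"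
      by (rule polytope_exposing_functional[OF pF])
    then have "exposes i s h" by (simp add: exposes_def)
    then show ?thesis unfolding \<gamma>_def by (rule someI)
  qed
  have \<gamma>0: "0 \<le> \<gamma> i s \<bullet> (x, 1)" if "i \<in> B" "x \<in> F" for i s x
    using exposes[OF that(1)] that(2) by (simp add: exposes_def)
  have \<gamma>E: "E i s = {x\<in>F. \<gamma> i s \<bullet> (x, 1) = 0}" if "i \<in> B" for i s
    using exposes[OF that] by (simp add: exposes_def)
  have Fne: "F \<noteq> {}" using adF by auto
  obtain p where p: "p \<in> rel_interior F" using rel_interior_eq_empty[OF cF] Fne by blast
  have pF': "p \<in> F" using p rel_interior_subset by blast
  have \<gamma>p: "0 < \<gamma> i s \<bullet> (p, 1)" if i: "i \<in> B" for i s
  proof -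
    have "p \<notin> E i s" using face_of_disjoint_rel_interior[of "E i s" F] E i p by blast
    then show ?thesis using \<gamma>E[OF i, of s] \<gamma>0[OF i pF', of s] pF' by force
  qed
  \<comment> \<open>A segment from the relative interior point \<open>p\<close> to \<open>x\<close>
    outside \<open>F\<close> would cross the relative frontier in some \<open>E i s\<close> at a
    parameter \<open>t <= 1\<close>. As that functional is positive at \<open>p\<close> and
    nonnegative at \<open>x\<close>, its vanishing forces \<open>t = 1\<close>, so \<open>x\<close>
    itself lies on the frontier.\<close>
  have inF: "x \<in> F" if x: "x \<in> affine hull F" "\<And>i s. i \<in> B \<Longrightarrow> 0 \<le> \<gamma> i s \<bullet> (x, 1)" for x
  proof (rule ccontr)
    assume xF: "x \<notin> F"
    then have "x - p \<noteq> 0" using pF' by auto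
    then obtain t where t: "0 < t" "p + t *\<^sub>R (x - p) \<in> rel_frontier F"
      "\<And>e. 0 \<le> e \<Longrightarrow> e < t \<Longrightarrow> p + e *\<^sub>R (x - p) \<in> rel_interior F"
      using ray_to_rel_frontier[OF bF p, of "x - p"] x(1) by auto
    have t1: "t \<le> 1" using t(3)[of 1] xF rel_interior_subset[of F] by force
    obtain X where X: "X face_of F" "X \<noteq> F" "p + t *\<^sub>R (x - p) \<in> X"
      using t(2) rel_frontier_of_polyhedron_alt[OF polytope_imp_polyhedron[OF pF]] by blast
    then obtain i s where i: "i \<in> B" "p + t *\<^sub>R (x - p) \<in> E i s" using cover by blast
    have "p + t *\<^sub>R (x - p) = (1 - t) *\<^sub>R p + t *\<^sub>R x" by (simp add: algebra_simps)
    then have "\<gamma> i s \<bullet> ((1 - t) *\<^sub>R p + t *\<^sub>R x, 1) = 0" using i \<gamma>E[OF i(1), of s] by simp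
    then have 0: "(1 - t) * (\<gamma> i s \<bullet> (p, 1)) + t * (\<gamma> i s \<bullet> (x, 1)) = 0" by (simp add: inner_lift_combination)
    have "0 \<le> (1 - t) * (\<gamma> i s \<bullet> (p, 1))" "0 \<le> t * (\<gamma> i s \<bullet> (x, 1))"
      using t t1 \<gamma>p[OF i(1), of s] x(2)[OF i(1), of s] by auto
    with 0 have "(1 - t) * (\<gamma> i s \<bullet> (p, 1)) = 0" by linarith
    then have "t = 1" using \<gamma>p[OF i(1), of s] by simp
    then have "x \<in> rel_frontier F" using t(2) by simp
    then show False using xF clF by (simp add: rel_frontier_def)
  qed
  let ?R = "span ((\<lambda>x. (x, 1::real)) ` F)"
  define D where "D = {y \<in> ?R. \<forall>i\<in>B. \<forall>s. 0 \<le> \<gamma> i s \<bullet> y}"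
  have Dadd: "y + z \<in> D" if "y \<in> D" "z \<in> D" for y z
    using that by (auto simp: D_def inner_add_right span_add)
  have Dsc: "c *\<^sub>R y \<in> D" if "y \<in> D" "0 \<le> c" for y c
    using that by (auto simp: D_def span_scale)
  have lD: "(x, 1) \<in> D" if "x \<in> F" for x
    using that \<gamma>0 by (auto simp: D_def span_base)
  have D1: "x \<in> F" if "(x, 1) \<in> D" for x
    using that inF[of x] lift_in_span_iff[of x F] by (auto simp: D_def)
  \<comment> \<open>A vector of height 0 in \<open>D\<close> is a recession direction of the bounded
    set \<open>F\<close>; the factor \<open>c\<close> carries \<open>p\<close> beyond the bound
    \<open>r\<close>.\<close>
  have rec: "x = 0" if x: "(x, 0) \<in> D" for x
  proof (rule ccontr)
    assume "x \<noteq> 0"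
    obtain r where r: "\<And>y. y \<in> F \<Longrightarrow> norm y \<le> r" using bF by (auto simp: bounded_iff)
    define c where "c = (r + norm p + 1) / norm x"
    have r0: "0 \<le> r" using r[OF pF'] norm_ge_zero order_trans by blast
    have c: "0 \<le> c" using r0 by (simp add: c_def)
    have "(p, 1) + c *\<^sub>R (x, 0) \<in> D" using lD[OF pF'] x c by (intro Dadd Dsc)
    then have "p + c *\<^sub>R x \<in> F" using D1 by simp
    then have "norm (p + c *\<^sub>R x) \<le> r" by (rule r)
    moreover have "norm (c *\<^sub>R x) = r + norm p + 1" using \<open>x \<noteq> 0\<close> r0 by (simp add: c_def)
    moreover have "norm (c *\<^sub>R x) \<le> norm (p + c *\<^sub>R x) + norm p"
      using norm_triangle_ineq4[of "p + c *\<^sub>R x" p] by simp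
    ultimately show False by simp
  qed
  \<comment> \<open>A second point of \<open>F\<close> is needed to exclude negative heights: a
    vector \<open>(w, r)\<close> of \<open>D\<close> with \<open>r < 0\<close> would satisfy
    \<open>w = r *\<^sub>R q\<close> for every \<open>q\<close> in \<open>F\<close>.\<close>
  obtain p' where p': "p' \<in> F" "p' \<noteq> p"
  proof -
    have "F \<noteq> {p}" using adF n by auto
    then show ?thesis using that pF' by blast
  qed
  have Dpc: "D - {0} = pcone F"
  proof (intro equalityI subsetI)
    fix y assume "y \<in> pcone F"
    then obtain x c where "x \<in> F" "0 < c" "y = c *\<^sub>R (x, 1)" by (rule pconeE)
    then show "y \<in> D - {0}" using Dsc[OF lD[of x], of c] by (auto simp: zero_prod_def)
  next
    fix y assume y: "y \<in> D - {0}"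
    obtain w r where [simp]: "y = (w, r)" by (cases y)
    consider "0 < r" | "r = 0" | "r < 0" by linarith
    then show "y \<in> pcone F"
    proof cases
      case 1
      then have "(w /\<^sub>R r, 1) \<in> D" using Dsc[of y "inverse r"] y by simp
      then show ?thesis using D1 1 by (simp add: pcone_def)
    next
      case 2
      then show ?thesis using rec[of w] y by (simp add: zero_prod_def)
    next
      case 3
      have "w = r *\<^sub>R q" if q: "q \<in> F" for q
      proof -
        have "y + (- r) *\<^sub>R (q, 1) \<in> D" using y 3 lD[OF q] by (intro Dadd Dsc) auto
        then have "w - r *\<^sub>R q = 0" using rec[of "w - r *\<^sub>R q"] by simp
        then show ?thesis by simp
      qed
      then have "r *\<^sub>R p = r *\<^sub>R p'" using pF' p'(1) by metis
      then show ?thesis using 3 p'(2) by simp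
    qed
  qed
  have dimR: "dim ?R = DIM('a)"
    using dim_pcone[of F] adF d dim_span[of "pcone F"] unfolding span_pcone by simp
  \<comment> \<open>The span of the lifts has dimension \<open>n + 1\<close>, the dimension of the
    type \<open>'a\<close>, so \<open>'a\<close> is a coordinate space for it; functionals are
    pulled back by the adjoint.\<close>
  obtain \<Lambda> :: "'a \<Rightarrow> 'b \<times> real" and \<Lambda>i where \<Lambda>: "linear \<Lambda>" "\<Lambda> ` UNIV = ?R" "\<And>x. \<Lambda>i (\<Lambda> x) = x"
    using isometries_subspaces[of "UNIV :: 'a set" ?R] dimR by (metis UNIV_I dim_UNIV subspace_UNIV subspace_span)
  have inj: "inj \<Lambda>" using \<Lambda>(3) by (metis injI)
  have finI: "finite I" "card I = n" using b0 d I by auto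
  obtain \<beta> where \<beta>: "bij_betw \<beta> I B" using finite_same_card_bij[OF finI(1) B(1)] finI B by auto
  define g where "g i s = adjoint \<Lambda> (\<gamma> (\<beta> i) s)" for i s
  have g: "g i s \<bullet> z = \<gamma> (\<beta> i) s \<bullet> \<Lambda> z" for i s z
    using adjoint_works[OF \<Lambda>(1), of z "\<gamma> (\<beta> i) s"] by (simp add: g_def inner_commute)
  have hg: "z \<in> hcone I g \<longleftrightarrow> \<Lambda> z \<in> D" for z
  proof -
    have "z \<in> hcone I g \<longleftrightarrow> (\<forall>i\<in>I. \<forall>s. 0 \<le> \<gamma> (\<beta> i) s \<bullet> \<Lambda> z)" by (simp add: hcone_def g)
    also have "\<dots> \<longleftrightarrow> (\<forall>i\<in>B. \<forall>s. 0 \<le> \<gamma> i s \<bullet> \<Lambda> z)" using \<beta> by (auto simp: bij_betw_def)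
    finally show ?thesis using \<Lambda>(2) by (auto simp: D_def)
  qed
  have L0: "\<Lambda> z = 0 \<longleftrightarrow> z = 0" for z by (rule linear_inj_eq_0[OF \<Lambda>(1) inj])
  have im: "\<Lambda> ` (hcone I g - {0}) = pcone F"
    unfolding Dpc[symmetric]
  proof (intro equalityI subsetI)
    fix y assume "y \<in> \<Lambda> ` (hcone I g - {0})"
    then show "y \<in> D - {0}" using hg L0 by auto
  next
    fix y assume y: "y \<in> D - {0}"
    then have "y \<in> ?R" by (simp add: D_def)
    then obtain z where "y = \<Lambda> z" using \<Lambda>(2) by blast
    then show "y \<in> \<Lambda> ` (hcone I g - {0})" using y hg L0 by auto
  qed
  have "cube_system I g"
    unfolding cube_system_def
  proof (intro conjI ballI impI)
    show "finite I" "I \<noteq> {}" "card I + 1 = DIM('a)" using finI n d by auto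
    have "(p, 1) \<in> \<Lambda> ` (hcone I g - {0})" unfolding im using pF' by simp
    then show "\<exists>z\<in>hcone I g. z \<noteq> 0" by blast
  next
    fix i z assume i: "i \<in> I" and z: "z \<in> hcone I g" "g i False \<bullet> z = 0" "g i True \<bullet> z = 0"
    have iB: "\<beta> i \<in> B" using \<beta> i by (auto simp: bij_betw_def)
    show "z = 0"
    proof (rule ccontr)
      assume "z \<noteq> 0"
      then have "\<Lambda> z \<in> pcone F" using z(1) im by blast
      then obtain x c where x: "x \<in> F" "0 < c" "\<Lambda> z = c *\<^sub>R (x, 1)" by (rule pconeE)
      have "\<gamma> (\<beta> i) s \<bullet> (x, 1) = 0" for s
      proof -
        have "\<gamma> (\<beta> i) s \<bullet> \<Lambda> z = 0" using z(2,3) g by (cases s) auto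
        then show ?thesis using x(2) unfolding x(3) inner_scaleR_right by simp
      qed
      then have "x \<in> E (\<beta> i) False \<inter> E (\<beta> i) True" using x(1) \<gamma>E[OF iB] by blast
      then show False using disj iB by blast
    qed
  qed
  then show ?thesis using that[OF _ \<Lambda>(1) inj \<Lambda>(2) im] by blast
qed

subsection \<open>The theorem\<close>

lemma facet_of_chart:
  fixes P :: "'a::euclidean_space set" and b0 :: 'a
  assumes P: "polytope P" and F: "F facet_of P"
    and cube: "combinatorial_cube n F" and d: "DIM('a) = Suc n" "1 \<le> n" and b0: "b0 \<in> Basis" and I: "I = Basis - {b0}"
  obtains g h where "cube_system I g" "facet_chart (hcone I g - {0}) F h P"
proof -
  obtain g :: "'a \<Rightarrow> bool \<Rightarrow> 'a" and \<Lambda> where g: "cube_system I g" "linear \<Lambda>" "inj \<Lambda>"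
    "range \<Lambda> = span ((\<lambda>x. (x, 1)) ` F)" "\<Lambda> ` (hcone I g - {0}) = pcone F"
    by (rule combinatorial_cube_cube_system[OF cube d(2,1) b0 I])
  obtain h :: "'a \<times> real" where h: "\<forall>x\<in>P. 0 \<le> h \<bullet> (x, 1)" "F = {x\<in>P. h \<bullet> (x, 1) = 0}"
    by (rule polytope_exposing_functional[OF P facet_of_imp_face_of[OF F]])
  have "h \<noteq> 0"
  proof
    assume "h = 0"
    then have "F = P" using h by auto
    then show False using F by (simp add: facet_of_def)
  qed
  moreover have "h \<bullet> \<Lambda> z = 0" for z
  proof -
    have "span ((\<lambda>x. (x, 1)) ` F) \<subseteq> {y. h \<bullet> y = 0}"
      using h(2) by (intro span_minimal subspace_hyperplane) auto
    then show ?thesis using g(4) by blast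
  qed
  ultimately have "facet_chart (hcone I g - {0}) F h P"
    unfolding facet_chart_def using P h g by blast
  then show ?thesis using that g(1) by blast
qed

text \<open>The tower is attached to \<open>P\<^sub>1\<close> with top \<open>F\<^sub>1\<close>.
  Only then is \<open>P\<^sub>2\<close> glued, to the bottom of the union of
  \<open>P\<^sub>1\<close> and the tower, so that convexity of all three pieces together comes from
  a single gluing.\<close>

lemma connecting_tower:
  fixes P\<^sub>1 P\<^sub>2 :: "'a::euclidean_space set" and b0 :: 'a
  assumes b0: "b0 \<in> Basis" and I: "I = Basis - {b0}"
    and g1: "cube_system I g\<^sub>1" and g2: "cube_system I g\<^sub>2"
    and F1: "facet_chart (hcone I g\<^sub>1 - {0}) F\<^sub>1 h\<^sub>1 P\<^sub>1" and F2: "facet_chart (hcone I g\<^sub>2 - {0}) F\<^sub>2 h\<^sub>2 P\<^sub>2"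
  obtains L Q T B where "linear L" "bij L" "pcone Q = L ` pcone P\<^sub>2" "pcone B = L ` pcone F\<^sub>2"
    "tower (2 * card I) T B F\<^sub>1" "convex (P\<^sub>1 \<union> T \<union> Q)" "P\<^sub>1 \<inter> T = F\<^sub>1" "Q \<inter> T = B"
proof -
  have "I \<noteq> {}" "finite I" using g1 by (auto simp: cube_system_def)
  then obtain n where n: "2 * card I = Suc n" by (metis card_0_eq mult_eq_0_iff not0_implies_Suc zero_neq_numeral)
  have "(cube_link ^^ Suc n) (hcone I g\<^sub>1 - {0}) (hcone I g\<^sub>2 - {0})"
    using cube_systems_linked[OF b0 I g1 g2] n by simp
  from tower_on_facet[OF this F1] obtain T B k where T: "tower (Suc n) T B F\<^sub>1"
    "convex (P\<^sub>1 \<union> T)" "P\<^sub>1 \<inter> T = F\<^sub>1" "B \<subseteq> T" "facet_chart (hcone I g\<^sub>2 - {0}) B k (P\<^sub>1 \<union> T)" by blast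
  obtain L Q where L: "linear L" "bij L" "pcone Q = L ` pcone P\<^sub>2" "pcone B = L ` pcone F\<^sub>2"
    "convex (P\<^sub>1 \<union> T \<union> Q)" "\<forall>y. k \<bullet> L y = - (h\<^sub>2 \<bullet> y)"
    by (rule glue_polytopes[OF T(5) F2 interior_hcone[OF g2]])
  \<comment> \<open>The functional \<open>k\<close> is nonpositive on \<open>Q\<close> and
    nonnegative on the rest, so common points lie on its zero set, the facet
    \<open>B\<close>.\<close>
  have "Q \<inter> T = B"
  proof (intro equalityI subsetI)
    fix x assume x: "x \<in> Q \<inter> T"
    then have "(x, 1) \<in> L ` pcone P\<^sub>2" using L(3) by (metis IntD1 lift_in_pcone)
    then obtain y where y: "y \<in> pcone P\<^sub>2" "(x, 1) = L y" by blast
    have "k \<bullet> (x, 1) \<le> 0" using L(6)[rule_format, of y] facet_chart_nonneg[OF F2 y(1)] y(2) by simp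
    then show "x \<in> B" using facet_chartD(3,4)[OF T(5), of x] x by auto
  next
    fix x assume x: "x \<in> B"
    have "pcone F\<^sub>2 \<subseteq> pcone P\<^sub>2" using facet_chart_zero[OF F2] by blast
    moreover have "(x, 1) \<in> L ` pcone F\<^sub>2" using x L(4) by (metis lift_in_pcone)
    ultimately have "(x, 1) \<in> pcone Q" using L(3) by blast
    then show "x \<in> Q \<inter> T" using x T(4) by auto
  qed
  then show ?thesis using that[OF L(1-4) _ L(5) T(3)] T(1) n by simp
qed

section \<open>From linear bijections to projective transformations\<close>

lemma projective_image:
  assumes "linear L" "pcone Q = L ` pcone P"
  shows "(\<lambda>x. fst (L (x, 1)) /\<^sub>R snd (L (x, 1))) ` P = Q"
proof (intro equalityI subsetI)
  fix q assume "q \<in> (\<lambda>x. fst (L (x, 1)) /\<^sub>R snd (L (x, 1))) ` P"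
  then obtain x where x: "x \<in> P" "q = fst (L (x, 1)) /\<^sub>R snd (L (x, 1))" by blast
  then have "L (x, 1) \<in> pcone Q" using assms(2) by (metis imageI lift_in_pcone)
  then show "q \<in> Q" using x by (simp add: pcone_def)
next
  fix q assume "q \<in> Q"
  then have "(q, 1) \<in> L ` pcone P" using assms(2) by (metis lift_in_pcone)
  then obtain y where y: "y \<in> pcone P" "(q, 1) = L y" by blast
  obtain x c where x: "x \<in> P" "0 < c" "y = c *\<^sub>R (x, 1)" using y(1) by (rule pconeE)
  have "c *\<^sub>R L (x, 1) = (q, 1)" using y(2) x(3) linear_cmul[OF assms(1)] by metis
  then have "c *\<^sub>R fst (L (x, 1)) = q" "c * snd (L (x, 1)) = 1"
    by (metis fst_conv fst_scaleR, metis snd_conv snd_scaleR real_scaleR_def)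
  moreover from this x(2) have "inverse (snd (L (x, 1))) = c" by (metis inverse_unique mult.commute)
  ultimately show "q \<in> (\<lambda>x. fst (L (x, 1)) /\<^sub>R snd (L (x, 1))) ` P" using x(1) by force
qed

text \<open>The entries of the block matrix are read off from \<open>L\<close> on vectors of the
  form \<open>(x, 0)\<close> and on \<open>(0, 1)\<close>; injectivity of \<open>L\<close> becomes
  injectivity of the matrix, hence a nonzero determinant.\<close>

lemma projective_transformation_on_linear:
  fixes L :: "(real^'n) \<times> real \<Rightarrow> (real^'n) \<times> real"
  assumes L: "linear L" "inj L" and S: "\<forall>x\<in>S. snd (L (x, 1)) \<noteq> 0"
  shows "projective_transformation_on S (\<lambda>x. fst (L (x, 1)) /\<^sub>R snd (L (x, 1)))"
proof -
  define A where "A = matrix (\<lambda>x. fst (L (x, 0)))"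
  define b where "b = fst (L (0, 1))"
  \<comment> \<open>The adjoint of a real functional, evaluated at 1, is the vector representing
    it.\<close>
  define c :: "real^'n" where "c = adjoint (\<lambda>x. snd (L (x, 0))) 1"
  define \<alpha> where "\<alpha> = snd (L (0, 1))"
  have l1: "linear (\<lambda>x. (x, 0::real))" by (auto intro: linearI)
  have l2: "linear (\<lambda>x. fst (L (x, 0)))" "linear (\<lambda>x. snd (L (x, 0)))"
    using linear_compose[OF linear_compose[OF l1 L(1)] linear_fst] linear_compose[OF linear_compose[OF l1 L(1)] linear_snd]
    by (auto simp: comp_def)
  have Ax: "A *v x = fst (L (x, 0))" for x unfolding A_def using matrix_works l2(1) by (metis linear_matrix_vector_mul_eq matrix_vector_mul(1))
  have cx: "c \<bullet> x = snd (L (x, 0))" for x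
    using adjoint_works[OF l2(2), of x 1] by (simp add: c_def inner_commute)
  have Lx: "L (x, t) = (A *v x + t *\<^sub>R b, c \<bullet> x + t * \<alpha>)" for x t
  proof -
    have "(x, t) = (x, 0) + t *\<^sub>R (0, 1)" by simp
    then have "L (x, t) = L (x, 0) + t *\<^sub>R L (0, 1)" by (simp only: linear_add[OF L(1)] linear_cmul[OF L(1)])
    then show ?thesis by (simp add: prod_eq_iff Ax cx b_def \<alpha>_def)
  qed
  let ?M = "block_matrix A b c \<alpha>"
  have M: "(?M *v v) $ Some k = (A *v (\<chi> i. v $ Some i) + (v $ None) *\<^sub>R b) $ k"
    "(?M *v v) $ None = c \<bullet> (\<chi> i. v $ Some i) + (v $ None) * \<alpha>" for v k
    by (simp_all add: matrix_vector_mult_def block_matrix_def UNIV_option_conv sum.reindex inner_vec_def)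
  have "inj ((*v) ?M)"
  proof -
    have "v = 0" if "?M *v v = 0" for v
    proof -
      have "A *v (\<chi> i. v $ Some i) + (v $ None) *\<^sub>R b = 0" using M(1)[of v] that by (simp add: vec_eq_iff)
      moreover have "c \<bullet> (\<chi> i. v $ Some i) + (v $ None) * \<alpha> = 0" using M(2)[of v] that by simp
      ultimately have "L (\<chi> i. v $ Some i, v $ None) = 0" by (simp add: Lx zero_prod_def)
      then have "((\<chi> i. v $ Some i), v $ None) = 0" using linear_inj_eq_0[OF L] by blast
      then have z: "v $ None = 0" "\<And>i. v $ Some i = 0" by (auto simp: zero_prod_def vec_eq_iff)
      show ?thesis
      proof (rule vec_eq_iff[THEN iffD2], rule allI)
        fix i show "v $ i = 0 $ i" using z by (cases i) auto
      qed
    qed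
    then show ?thesis by (simp add: linear_injective_0[OF matrix_vector_mul_linear])
  qed
  then have "det ?M \<noteq> 0" using matrix_left_invertible_injective[of ?M] invertible_left_inverse invertible_det_nz by metis
  moreover have "(\<lambda>x. fst (L (x, 1)) /\<^sub>R snd (L (x, 1))) = (\<lambda>x. (1 / (c \<bullet> x + \<alpha>)) *\<^sub>R (A *v x + b))"
    by (auto simp: Lx inverse_eq_divide)
  moreover have "\<forall>x\<in>S. c \<bullet> x + \<alpha> \<noteq> 0" using S by (simp add: Lx)
  ultimately show ?thesis unfolding projective_transformation_on_def by blast
qed

text \<open>The map \<open>M\<close> leads into a larger space. Composing it with a linear
  identification of the hyperplane of \<open>B\<close> with the space of \<open>C\<close> gives a
  square injective map, to which the matrix form applies.\<close>

lemma projectively_equivalent_to_facet_linear: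
  fixes C :: "(real^'m) set" and B :: "(real^'n) set"
  assumes M: "linear M" "inj M" and C: "aff_dim C = int CARD('m)" and B: "pcone B = M ` pcone C"
  shows "projectively_equivalent_to_facet C B"
proof -
  have dC: "dim (pcone C) = Suc CARD('m)" using dim_pcone[of C] C by simp
  have "span (pcone C) = UNIV" using dC by (intro dim_eq_full[THEN iffD1]) simp
  then have R: "span ((\<lambda>x. (x, 1)) ` B) = range M"
    using linear_span_image[OF M(1), of "pcone C"] B by (simp add: span_pcone[symmetric])
  have "C \<noteq> {}" using C by auto
  then obtain p where p: "p \<in> B" using B by (metis ex_in_conv image_is_empty lift_in_pcone pconeE)
  have aff: "x \<in> affine hull B \<longleftrightarrow> (x, 1) \<in> range M" for x using lift_in_span_iff[of x B] R by simp
  define D where "D = {x. (x, 0) \<in> range M}"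
  have sR: "subspace (range M)" using M(1) by (simp add: linear_subspace_image)
  have sD: "subspace D"
  proof (rule subspaceI)
    show "0 \<in> D" using subspace_0[OF sR] by (simp add: D_def zero_prod_def)
    show "x + y \<in> D" if "x \<in> D" "y \<in> D" for x y
      using subspace_add[OF sR, of "(x, 0)" "(y, 0)"] that by (simp add: D_def)
    show "c *\<^sub>R x \<in> D" if "x \<in> D" for c x
      using subspace_scale[OF sR, of "(x, 0)" c] that by (simp add: D_def)
  qed
  have pR: "(p, 1) \<in> range M" using aff hull_inc[OF p] by blast
  have hullB: "affine hull B = (+) p ` D"
  proof (intro equalityI subsetI)
    fix x assume "x \<in> affine hull B"
    then have "x - p \<in> D" using subspace_diff[OF sR, of "(x, 1)" "(p, 1)"] aff pR by (simp add: D_def)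
    then show "x \<in> (+) p ` D" by (metis add.commute diff_add_cancel image_eqI)
  next
    fix x assume "x \<in> (+) p ` D"
    then obtain y where "(y, 0) \<in> range M" "x = p + y" by (auto simp: D_def)
    then show "x \<in> affine hull B" using subspace_add[OF sR pR, of "(y, 0)"] aff by simp
  qed
  have "int (dim D) = aff_dim B"
    using aff_dim_affine_hull[of B] aff_dim_subspace[OF sD] by (simp add: hullB aff_dim_translation_eq)
  moreover have "aff_dim B = int CARD('m)"
    using dim_pcone[of B] dim_image_eq[OF M(1), of "pcone C"] M(2) dC B by (simp add: inj_on_subset)
  ultimately have dD: "dim D = dim (UNIV :: (real^'m) set)" by simp
  \<comment> \<open>An isometry of the direction space \<open>D\<close> onto \<open>real^'m\<close>.
    It is linear on the whole space, so it also maps the translate \<open>p + D\<close>, the affine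
    hull of \<open>B\<close>, bijectively, and the translation part can be taken as 0.\<close>
  obtain f :: "real^'n \<Rightarrow> real^'m" and f' where f: "linear f" "f ` D = UNIV" "\<And>x. x \<in> D \<Longrightarrow> f' (f x) = x"
    using isometries_subspaces[OF sD subspace_UNIV dD] by metis
  have fD: "x = 0" if "x \<in> D" "f x = 0" for x using f(3)[OF that(1)] f(3)[OF subspace_0[OF sD]] that(2) linear_0[OF f(1)] by simp
  have "bij_betw f (affine hull B) UNIV"
    unfolding bij_betw_def
  proof
    show "inj_on f (affine hull B)"
    proof (rule inj_onI)
      fix x y assume "x \<in> affine hull B" "y \<in> affine hull B" "f x = f y"
      moreover from this obtain x' y' where "x = p + x'" "y = p + y'" "x' \<in> D" "y' \<in> D" by (auto simp: hullB)
      ultimately show "x = y" using fD[of "x' - y'"] subspace_diff[OF sD] linear_add[OF f(1)] linear_diff[OF f(1)] by auto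
    qed
    show "f ` (affine hull B) = UNIV"
    proof -
      have "z \<in> f ` (affine hull B)" for z
      proof -
        obtain x where "x \<in> D" "f x = z - f p" using f(2) by (metis UNIV_I imageE)
        then have "f (p + x) = z" "p + x \<in> affine hull B" using linear_add[OF f(1)] by (auto simp: hullB)
        then show ?thesis by blast
      qed
      then show ?thesis by blast
    qed
  qed
  moreover have "projectively_equivalent C (f ` B)"
  proof -
    \<comment> \<open>Its kernel is trivial: a zero of \<open>N\<close> has height 0 under
      \<open>M\<close>, so its image direction lies in \<open>D\<close>, where \<open>f\<close> is
      injective.\<close>
    define N where "N y = (f (fst (M y)), snd (M y))" for y
    have lN: "linear N"
      by (rule linearI) (auto simp: N_def linear_add[OF M(1)] linear_cmul[OF M(1)] linear_add[OF f(1)] linear_cmul[OF f(1)])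
    have "y = 0" if "N y = 0" for y
    proof -
      have y: "f (fst (M y)) = 0" "snd (M y) = 0" using that by (auto simp: N_def zero_prod_def)
      then have "fst (M y) \<in> D" unfolding D_def by (metis mem_Collect_eq prod.collapse rangeI)
      then have "M y = 0" using fD y by (simp add: prod_eq_iff)
      then show ?thesis using linear_inj_eq_0[OF M] by blast
    qed
    then have iN: "inj N" using lN by (simp add: linear_injective_0)
    have pc: "pcone (f ` B) = N ` pcone C"
      unfolding pcone_linear_image[OF f(1)] B by (simp add: N_def image_image)
    have "snd (N (x, 1)) \<noteq> 0" if "x \<in> C" for x
    proof -
      have "N (x, 1) \<in> pcone (f ` B)" using that pc by (metis imageI lift_in_pcone)
      then show ?thesis using pcone_snd_pos by fastforce
    qed
    then have "projective_transformation_on C (\<lambda>x. fst (N (x, 1)) /\<^sub>R snd (N (x, 1)))"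
      using projective_transformation_on_linear[OF lN iN] by blast
    then show ?thesis unfolding projectively_equivalent_def using projective_image[OF lN pc] by blast
  qed
  ultimately show ?thesis
    unfolding projectively_equivalent_to_facet_def using f(1)
    by (intro exI[of _ f] exI[of _ f] exI[of _ 0]) auto
qed

text \<open>A pyramid with apex \<open>b0\<close> over the embedded cube provides a polytope having
  that cube as a facet. It need not be cubical: attaching a tower uses only the chart of this one
  facet.\<close>

lemma pyramid_chart:
  fixes C :: "'b::euclidean_space set" and b0 :: "'a::euclidean_space"
  assumes \<iota>: "linear \<iota>" "inj \<iota>" "range \<iota> = {x. b0 \<bullet> x = 0}" and b0: "b0 \<in> Basis" and I: "I = Basis - {b0}"
    and C: "combinatorial_cube n C" and d: "DIM('a) = Suc n" "1 \<le> n"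
  obtains g P where "cube_system I g" "facet_chart (hcone I g - {0}) (\<iota> ` C) (b0, 0) P"
proof -
  obtain g :: "'a \<Rightarrow> bool \<Rightarrow> 'a" and \<Lambda> where g: "cube_system I g" "linear \<Lambda>" "inj \<Lambda>"
    "\<Lambda> ` (hcone I g - {0}) = pcone C"
    by (rule combinatorial_cube_cube_system[OF C d(2,1) b0 I])
  have pC: "polytope C" and Cne: "C \<noteq> {}" using C by (auto simp: combinatorial_cube_def)
  define F where "F = \<iota> ` C"
  have pF: "polytope F" unfolding F_def using pC \<iota>(1) by (rule polytope_linear_image[rotated])
  have Fne: "F \<noteq> {}" and hF: "\<And>x. x \<in> F \<Longrightarrow> b0 \<bullet> x = 0" using Cne \<iota>(3) by (auto simp: F_def)
  define P where "P = convex hull (insert b0 F)"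
  have pP: "polytope P"
  proof -
    obtain V where V: "finite V" "F = convex hull V" using pF by (auto simp: polytope_def)
    have "P = convex hull (insert b0 V)" unfolding P_def V(2) by (metis hull_insert)
    then show ?thesis using V(1) by (auto simp: polytope_def)
  qed
  have b1: "b0 \<bullet> b0 = 1" using b0 by (simp add: inner_Basis)
  have P: "x \<in> P \<longleftrightarrow> (\<exists>u\<ge>0. \<exists>v\<ge>0. \<exists>b. u + v = 1 \<and> b \<in> F \<and> x = u *\<^sub>R b0 + v *\<^sub>R b)" for x
    unfolding P_def convex_hull_insert[OF Fne] using hull_same[of convex, OF polytope_imp_convex[OF pF]] by simp
  have "0 \<le> (b0, 0::real) \<bullet> (x, 1)" if "x \<in> P" for x using that hF b1 by (auto simp: P inner_add_right)
  moreover have "F = {x \<in> P. (b0, 0::real) \<bullet> (x, 1) = 0}"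
  proof (intro equalityI subsetI)
    fix x assume "x \<in> F"
    then show "x \<in> {x \<in> P. (b0, 0::real) \<bullet> (x, 1) = 0}" using hF by (auto simp: P_def hull_inc)
  next
    fix x assume x: "x \<in> {x \<in> P. (b0, 0::real) \<bullet> (x, 1) = 0}"
    then obtain u v b where u: "u + v = 1" "b \<in> F" "x = u *\<^sub>R b0 + v *\<^sub>R b" by (auto simp: P)
    then have "u = 0" using x hF b1 by (simp add: inner_add_right)
    then show "x \<in> F" using u by simp
  qed
  moreover have pc: "pcone F = (\<lambda>y. (\<iota> (fst y), snd y)) ` pcone C"
    unfolding F_def by (rule pcone_linear_image[OF \<iota>(1)])
  moreover define \<Lambda>' where "\<Lambda>' = (\<lambda>z. (\<iota> (fst (\<Lambda> z)), snd (\<Lambda> z)))"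
  have "linear \<Lambda>'"
    by (rule linearI) (auto simp: \<Lambda>'_def linear_add[OF g(2)] linear_cmul[OF g(2)] linear_add[OF \<iota>(1)] linear_cmul[OF \<iota>(1)])
  moreover have "inj \<Lambda>'"
  proof (rule injI)
    fix x y assume "\<Lambda>' x = \<Lambda>' y"
    then have "\<Lambda> x = \<Lambda> y" using \<iota>(2) by (simp add: \<Lambda>'_def prod_eq_iff inj_eq)
    then show "x = y" using g(3) by (simp add: inj_eq)
  qed
  moreover have "(b0, 0) \<bullet> \<Lambda>' z = 0" for z using \<iota>(3) by (auto simp: \<Lambda>'_def)
  moreover have "\<Lambda>' ` (hcone I g - {0}) = pcone F" unfolding pc g(4)[symmetric] by (simp add: \<Lambda>'_def image_image)
  moreover have "(b0, 0::real) \<noteq> 0" using b1 by (auto simp: zero_prod_def)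
  ultimately have "facet_chart (hcone I g - {0}) F (b0, 0) P"
    unfolding facet_chart_def using pP by blast
  then show ?thesis using that[OF g(1)] unfolding F_def by blast
qed

theorem theorem1p2:
  fixes d :: nat
  assumes "d \<ge> 2" and "CARD('n::finite) = d" and "CARD('m::finite) = d - 1"
  shows
    "(\<forall>(C\<^sub>1 :: (real^'m) set) (C\<^sub>2 :: (real^'m) set).
        combinatorial_cube (d - 1) C\<^sub>1 \<and> combinatorial_cube (d - 1) C\<^sub>2 \<longrightarrow>
        (\<exists>(C :: (real^'n) set) F F' m. m \<le> 4 * d \<and> tower m C F F' \<and>
           projectively_equivalent_to_facet C\<^sub>1 F \<and>
           projectively_equivalent_to_facet C\<^sub>2 F')) \<and>
     (\<forall>(P\<^sub>1 :: (real^'n) set) P\<^sub>2 F\<^sub>1 F\<^sub>2.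
        cubical_polytope d P\<^sub>1 \<and> cubical_polytope d P\<^sub>2 \<and>
        F\<^sub>1 facet_of P\<^sub>1 \<and> F\<^sub>2 facet_of P\<^sub>2 \<longrightarrow>
        (\<exists>\<phi> T m. projective_transformation_on P\<^sub>2 \<phi> \<and>
           m \<le> 4 * d \<and> tower m T (\<phi> ` F\<^sub>2) F\<^sub>1 \<and>
           convex (P\<^sub>1 \<union> T \<union> \<phi> ` P\<^sub>2) \<and>
           P\<^sub>1 \<inter> T = F\<^sub>1 \<and> \<phi> ` P\<^sub>2 \<inter> T = \<phi> ` F\<^sub>2))"
proof (rule conjI)
  define n where "n = d - 1"
  have d: "DIM(real^'n) = Suc n" "DIM(real^'m) = n" "1 \<le> n" using assms by (auto simp: n_def)
  obtain b0 :: "real^'n" where b0: "b0 \<in> Basis" using nonempty_Basis by blast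
  define I where "I = Basis - {b0}"
  \<comment> \<open>Here \<open>card I = d - 1\<close>, so the towers below have
    \<open>2 (d - 1)\<close> cubes.\<close>
  have cI: "2 * card I \<le> 4 * d" using d b0 by (simp add: I_def n_def)
  show "\<forall>(C\<^sub>1 :: (real^'m) set) (C\<^sub>2 :: (real^'m) set).
        combinatorial_cube (d - 1) C\<^sub>1 \<and> combinatorial_cube (d - 1) C\<^sub>2 \<longrightarrow>
        (\<exists>(C :: (real^'n) set) F F' m. m \<le> 4 * d \<and> tower m C F F' \<and>
           projectively_equivalent_to_facet C\<^sub>1 F \<and>
           projectively_equivalent_to_facet C\<^sub>2 F')"
  proof (intro allI impI, elim conjE)
    fix C\<^sub>1 C\<^sub>2 :: "(real^'m) set"
    assume C: "combinatorial_cube (d - 1) C\<^sub>1" "combinatorial_cube (d - 1) C\<^sub>2"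
    have "b0 \<noteq> 0" using b0 by auto
    then have "dim (UNIV :: (real^'m) set) = dim {x. b0 \<bullet> x = 0}" using d by (simp add: dim_hyperplane)
    then obtain \<iota> :: "real^'m \<Rightarrow> real^'n" and \<iota>' where \<iota>: "linear \<iota>" "range \<iota> = {x. b0 \<bullet> x = 0}" "\<And>x. \<iota>' (\<iota> x) = x"
      using isometries_subspaces[OF subspace_UNIV subspace_hyperplane] by (metis UNIV_I)
    have inj: "inj \<iota>" using \<iota>(3) by (metis injI)
    let ?J = "\<lambda>y. (\<iota> (fst y), snd y :: real)"
    have J: "linear ?J" "inj ?J"
      using inj by (auto intro!: linearI injI simp: linear_add[OF \<iota>(1)] linear_cmul[OF \<iota>(1)] prod_eq_iff inj_eq)
    obtain g1 P1 where P1: "cube_system I g1" "facet_chart (hcone I g1 - {0}) (\<iota> ` C\<^sub>1) (b0, 0) P1"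
      by (rule pyramid_chart[OF \<iota>(1) inj \<iota>(2) b0 I_def C(1)[folded n_def] d(1,3)])
    obtain g2 P2 where P2: "cube_system I g2" "facet_chart (hcone I g2 - {0}) (\<iota> ` C\<^sub>2) (b0, 0) P2"
      by (rule pyramid_chart[OF \<iota>(1) inj \<iota>(2) b0 I_def C(2)[folded n_def] d(1,3)])
    \<comment> \<open>The facet of the polytope passed first becomes the top of the tower, so the
      pyramid over the second cube comes first.\<close>
    obtain L T B where L: "linear L" "bij L" "pcone B = L ` pcone (\<iota> ` C\<^sub>1)" "tower (2 * card I) T B (\<iota> ` C\<^sub>2)"
      by (rule connecting_tower[OF b0 I_def P2(1) P1(1) P2(2) P1(2)])
    have ad: "aff_dim C\<^sub>1 = int CARD('m)" "aff_dim C\<^sub>2 = int CARD('m)"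
      using C assms(3) by (auto simp: combinatorial_cube_def)
    have "projectively_equivalent_to_facet C\<^sub>2 (\<iota> ` C\<^sub>2)"
      by (rule projectively_equivalent_to_facet_linear[OF J ad(2) pcone_linear_image[OF \<iota>(1)]])
    moreover have "projectively_equivalent_to_facet C\<^sub>1 B"
    proof (rule projectively_equivalent_to_facet_linear[OF _ _ ad(1)])
      show "linear (L \<circ> ?J)" by (rule linear_compose[OF J(1) L(1)])
      show "inj (L \<circ> ?J)" by (rule inj_compose[OF bij_is_inj[OF L(2)] J(2)])
      show "pcone B = (L \<circ> ?J) ` pcone C\<^sub>1" unfolding L(3) pcone_linear_image[OF \<iota>(1)] by (simp add: image_image)
    qed
    ultimately show "\<exists>(C :: (real^'n) set) F F' m. m \<le> 4 * d \<and> tower m C F F' \<and>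
           projectively_equivalent_to_facet C\<^sub>1 F \<and> projectively_equivalent_to_facet C\<^sub>2 F'"
      using L(4) cI by blast
  qed
  show "\<forall>(P\<^sub>1 :: (real^'n) set) P\<^sub>2 F\<^sub>1 F\<^sub>2.
        cubical_polytope d P\<^sub>1 \<and> cubical_polytope d P\<^sub>2 \<and>
        F\<^sub>1 facet_of P\<^sub>1 \<and> F\<^sub>2 facet_of P\<^sub>2 \<longrightarrow>
        (\<exists>\<phi> T m. projective_transformation_on P\<^sub>2 \<phi> \<and>
           m \<le> 4 * d \<and> tower m T (\<phi> ` F\<^sub>2) F\<^sub>1 \<and>
           convex (P\<^sub>1 \<union> T \<union> \<phi> ` P\<^sub>2) \<and>
           P\<^sub>1 \<inter> T = F\<^sub>1 \<and> \<phi> ` P\<^sub>2 \<inter> T = \<phi> ` F\<^sub>2)"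
  proof (intro allI impI, elim conjE)
    fix P\<^sub>1 P\<^sub>2 F\<^sub>1 F\<^sub>2 :: "(real^'n) set"
    assume P: "cubical_polytope d P\<^sub>1" "cubical_polytope d P\<^sub>2" and F: "F\<^sub>1 facet_of P\<^sub>1" "F\<^sub>2 facet_of P\<^sub>2"
    \<comment> \<open>The definition of a cubical polytope leaves the dimension of the cube open;
      the affine dimension of a facet fixes it.\<close>
    have cube: "combinatorial_cube n F" if P: "cubical_polytope d P" and F: "F facet_of P" for P F :: "(real^'n) set"
    proof -
      have "F face_of P" "F \<noteq> {}" "F \<noteq> P" and ad: "aff_dim F = aff_dim P - 1" using F by (auto simp: facet_of_def)
      then obtain k where k: "combinatorial_cube k F" using P by (auto simp: cubical_polytope_def)
      moreover have "int k = int n"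
        using k ad P d assms by (simp add: combinatorial_cube_def cubical_polytope_def n_def)
      ultimately show ?thesis by simp
    qed
    have pol: "polytope P" if "cubical_polytope d P" for P :: "(real^'n) set"
      using that by (simp add: cubical_polytope_def)
    obtain g1 h1 where 1: "cube_system I g1" "facet_chart (hcone I g1 - {0}) F\<^sub>1 h1 P\<^sub>1"
      by (rule facet_of_chart[OF pol[OF P(1)] F(1) cube[OF P(1) F(1)] d(1,3) b0 I_def])
    obtain g2 h2 where 2: "cube_system I g2" "facet_chart (hcone I g2 - {0}) F\<^sub>2 h2 P\<^sub>2"
      by (rule facet_of_chart[OF pol[OF P(2)] F(2) cube[OF P(2) F(2)] d(1,3) b0 I_def])
    obtain L Q T B where L: "linear L" "bij L" "pcone Q = L ` pcone P\<^sub>2" "pcone B = L ` pcone F\<^sub>2"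
      "tower (2 * card I) T B F\<^sub>1" "convex (P\<^sub>1 \<union> T \<union> Q)" "P\<^sub>1 \<inter> T = F\<^sub>1" "Q \<inter> T = B"
      by (rule connecting_tower[OF b0 I_def 1(1) 2(1) 1(2) 2(2)])
    define \<phi> where "\<phi> = (\<lambda>x. fst (L (x, 1)) /\<^sub>R snd (L (x, 1)))"
    have "snd (L (x, 1)) \<noteq> 0" if "x \<in> P\<^sub>2" for x
    proof -
      have "L (x, 1) \<in> pcone Q" using that L(3) by (metis imageI lift_in_pcone)
      then show ?thesis using pcone_snd_pos by fastforce
    qed
    then have "projective_transformation_on P\<^sub>2 \<phi>"
      unfolding \<phi>_def using projective_transformation_on_linear[OF L(1) bij_is_inj[OF L(2)]] by blast
    moreover have "\<phi> ` P\<^sub>2 = Q" "\<phi> ` F\<^sub>2 = B"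
      unfolding \<phi>_def by (rule projective_image[OF L(1,3)], rule projective_image[OF L(1,4)])
    ultimately show "\<exists>\<phi> T m. projective_transformation_on P\<^sub>2 \<phi> \<and>
           m \<le> 4 * d \<and> tower m T (\<phi> ` F\<^sub>2) F\<^sub>1 \<and>
           convex (P\<^sub>1 \<union> T \<union> \<phi> ` P\<^sub>2) \<and>
           P\<^sub>1 \<inter> T = F\<^sub>1 \<and> \<phi> ` P\<^sub>2 \<inter> T = \<phi> ` F\<^sub>2"
      using L(5-8) cI by (intro exI[of _ \<phi>] exI[of _ T] exI[of _ "2 * card I"]) simp
  qed
qed

end
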